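(* Let $P$ be an ergodic reversible Markov chain on a finite undirected graph $G=(X,E)$, all of whose eigenvalues lie in $[0,1]$, and let $M\subsetneq X$ be a non-empty set of marked vertices. Assume that we know the value of $\mathrm{HT}^+(P,M)$ and an approximation $p^*\le\tfrac12$ of $p_M$ such that $|p^*-p_M|\le p_M/3$, and put $s^*=1-\frac{p^*}{1-p^*}$. If $T\ge14\sqrt{\mathrm{HT}^+(P,M)}$, then the quantum algorithm $\mathbf{Search}(P,M,s^*,\lceil\log_2T\rceil)$ solves $\mathrm{FIND}(G)$ (i.e. outputs a marked vertex) with probability at least $1/36$ and complexity of order $\mathsf S+T\cdot(\mathsf U+\mathsf C)$.
   Context: Markov chains. $X$ is a finite set, $n=|X|$; a Markov chain on $X$ is a row-stochastic matrix $P=(P_{xy})_{x,y\in X}$. It is ergodic if it is irreducible and aperiodic; then it has a unique stationary distribution $\pi=(\pi_x)$ (row vector, $\pi P=\pi$), with all $\pi_x>0$. It is reversible if it is ergodic and $\pi_xP_{xy}=\pi_yP_{yx}$ for all $x,y$. $P$ is a Markov chain on $G$ if $P_{xy}=0$ whenever $x\ne y$ and $(x,y)\notin E$. For the marked set $M$, $p_M=\sum_{x\in M}\pi_x$. The absorbing chain $P'$ has $P'_{xy}=P_{xy}$ for $x\notin M$ and $P'_{xy}=\delta_{xy}$ for $x\in M$. The interpolated chain is $P(s)=(1-s)P+sP'$, $0\le s\le1$. Its discriminant matrix is the real symmetric matrix $D(s)$ with entries $D_{xy}(s)=\sqrt{P_{xy}(s)P_{yx}(s)}$; let $\lambda_1(s)\le\dots\le\lambda_n(s)$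 be its eigenvalues and $|v_1(s)\rangle,\dots,|v_n(s)\rangle$ a corresponding orthonormal basis of real eigenvectors (for $s<1$, $\lambda_n(s)=1$ is simple). Let $|U\rangle=\frac{1}{\sqrt{1-p_M}}\sum_{x\notin M}\sqrt{\pi_x}\,|x\rangle$. The interpolated hitting time, for $s\in[0,1)$, is $\mathrm{HT}(s)=\sum_{k=1}^{n-1}\frac{|\langle v_k(s)|U\rangle|^2}{1-\lambda_k(s)}$, and the extended hitting time is $\mathrm{HT}^+(P,M)=\lim_{s\to1}\mathrm{HT}(s)$. Quantum setting. $\mathcal H=\mathrm{span}\{|x\rangle:x\in X\}$; the state space is $\mathcal H\otimes\mathcal H$ (plus ancillas), the first register being the vertex register, and $|\bar0\rangle\in\mathcal H$ is a fixed reference unit vector. Allowed operations are static unitaries (controlled by the vertex register, of the form $\sum_x|x\rangle\langle x|\otimes U_x$) and SHIFT, the linear map with $|x,y\rangle\mapsto|y,x\rangle$ if $(x,y)\in E$ or $x=y$ and $|x,y\rangle\mapsto|x,y\rangle$ otherwise, together with the following black boxes (and their controlled versions), with associated costs: $\mathrm{Check}(M)$ (cost $\mathsf C$): $|x\rangle|b\rangle\mapsto|x\rangle|b\oplus[x\in M]\rangle$; $\mathrm{Setup}(P)$ (cost $\mathsf S$): prepares $|\pi\rangle=\sum_x\sqrt{\pi_x}|x\rangle$; $\mathrm{Update}(P)$ (cost $\mathsf U$): applies any of $V(P)$, $V(P)^\dagger$, SHIFT, where $V(P)$ is a unitary with $V(P)|x\rangle|\bar0\rangle=|x\rangle\sum_y\sqrt{P_{xy}}|y\rangle$.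 The probabilities $P_{xx}$ are assumed known (one call to $\mathrm{Update}(P)$ allows one to learn $P_{xx}$). Complexity is the total cost of black-box calls; "of order" means up to a universal constant factor. $\mathrm{FIND}(G)$: under these restrictions, find any marked vertex, promised that $M\ne\emptyset$. Quantum walk operator: $W(s)=V(s)^\dagger\,\mathrm{SHIFT}\,V(s)\cdot\mathrm{ref}_{\mathcal X}$, where $V(s)$ is a unitary with $V(s)|x\rangle|\bar0\rangle=|x\rangle\sum_y\sqrt{P_{xy}(s)}|y\rangle$ and $\mathrm{ref}_{\mathcal X}=I\otimes(2|\bar0\rangle\langle\bar0|-I)$. Eigenvalue estimation $\mathrm{EE}(W,t)$ for a unitary $W$ and integer $t\ge0$: a circuit using $2^t$ calls to controlled-$W$ that maps each eigenvector $|\Psi\rangle$ of $W$ with eigenvalue $e^{i\varphi}$ to $|\Psi\rangle\,\frac1{2^t}\sum_{l,m=0}^{2^t-1}e^{-2\pi i lm/2^t}e^{i\varphi l}|m\rangle$. Algorithm $\mathbf{Search}(P,M,s,t)$: (1) prepare $|\pi\rangle|\bar0\rangle$ with $\mathrm{Setup}(P)$; (2) attach a qubit $|0\rangle$, apply $\mathrm{Check}(M)$ to the vertex register and this qubit, and measure the qubit; (3) if the result is $1$, measure the vertex register in the vertex basis and output the outcome; (4) otherwise discard the qubit, apply $\mathrm{EE}(W(s),t)$ to the two registers, attach a new qubit $|0\rangle$, apply $\mathrm{Check}(M)$ and measure the qubit; if the result is $1$, measure the vertex register and output the outcome, otherwise output "no marked vertex". *)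

theory Defs
  imports Complex_Main
begin

section \<open>Reversible Markov chains and the extended hitting time\<close>

text \<open>
  Matrices are functions on a finite carrier \<open>X\<close> (rather than a finite type), so that one statement
  speaks about chains of all sizes and a constant can be independent of the size.
\<close>

definition markov_chain :: "'v set \<Rightarrow> ('v \<Rightarrow> 'v \<Rightarrow> real) \<Rightarrow> bool" where
  "markov_chain X P \<longleftrightarrow> finite X \<and> (\<forall>x\<in>X. \<forall>y\<in>X. 0 \<le> P x y) \<and> (\<forall>x\<in>X. (\<Sum>y\<in>X. P x y) = 1)"

primrec chain_pow :: "'v set \<Rightarrow> ('v \<Rightarrow> 'v \<Rightarrow> real) \<Rightarrow> nat \<Rightarrow> 'v \<Rightarrow> 'v \<Rightarrow> real" where
  "chain_pow X P 0 = (\<lambda>x y. of_bool (x = y))"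
| "chain_pow X P (Suc m) = (\<lambda>x y. \<Sum>u\<in>X. P x u * chain_pow X P m u y)"

definition irreducible_chain :: "'v set \<Rightarrow> ('v \<Rightarrow> 'v \<Rightarrow> real) \<Rightarrow> bool" where
  "irreducible_chain X P \<longleftrightarrow> (\<forall>x\<in>X. \<forall>y\<in>X. \<exists>m. 0 < chain_pow X P m x y)"

definition aperiodic_chain :: "'v set \<Rightarrow> ('v \<Rightarrow> 'v \<Rightarrow> real) \<Rightarrow> bool" where
  "aperiodic_chain X P \<longleftrightarrow> (\<forall>x\<in>X. Gcd {m. 0 < m \<and> 0 < chain_pow X P m x x} = 1)"

definition ergodic_chain :: "'v set \<Rightarrow> ('v \<Rightarrow> 'v \<Rightarrow> real) \<Rightarrow> bool" where
  "ergodic_chain X P \<longleftrightarrow> markov_chain X P \<and> irreducible_chain X P \<and> aperiodic_chain X P"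

definition stationary_dist :: "'v set \<Rightarrow> ('v \<Rightarrow> 'v \<Rightarrow> real) \<Rightarrow> ('v \<Rightarrow> real) \<Rightarrow> bool" where
  "stationary_dist X P \<pi> \<longleftrightarrow>
     (\<forall>x\<in>X. 0 \<le> \<pi> x) \<and> (\<Sum>x\<in>X. \<pi> x) = 1 \<and> (\<forall>y\<in>X. (\<Sum>x\<in>X. \<pi> x * P x y) = \<pi> y)"

text \<open>An ergodic chain determines its stationary distribution \<open>\<pi>\<close> on \<open>X\<close> uniquely.\<close>

definition reversible_chain :: "'v set \<Rightarrow> ('v \<Rightarrow> 'v \<Rightarrow> real) \<Rightarrow> ('v \<Rightarrow> real) \<Rightarrow> bool" where
  "reversible_chain X P \<pi> \<longleftrightarrow> ergodic_chain X P \<and> stationary_dist X P \<pi> \<and>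
     (\<forall>x\<in>X. \<forall>y\<in>X. \<pi> x * P x y = \<pi> y * P y x)"

definition chain_eigenvalue :: "'v set \<Rightarrow> ('v \<Rightarrow> 'v \<Rightarrow> real) \<Rightarrow> complex \<Rightarrow> bool" where
  "chain_eigenvalue X P \<mu> \<longleftrightarrow>
     (\<exists>f :: 'v \<Rightarrow> complex. (\<exists>x\<in>X. f x \<noteq> 0) \<and>
        (\<forall>x\<in>X. (\<Sum>y\<in>X. complex_of_real (P x y) * f y) = \<mu> * f x))"

definition undirected_graph :: "'v set \<Rightarrow> ('v \<times> 'v) set \<Rightarrow> bool" where
  "undirected_graph X E \<longleftrightarrow> finite X \<and> E \<subseteq> X \<times> X \<and> sym E"

definition chain_on_graph :: "'v set \<Rightarrow> ('v \<times> 'v) set \<Rightarrow> ('v \<Rightarrow> 'v \<Rightarrow> real) \<Rightarrow> bool" where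
  "chain_on_graph X E P \<longleftrightarrow> (\<forall>x\<in>X. \<forall>y\<in>X. x \<noteq> y \<and> (x, y) \<notin> E \<longrightarrow> P x y = 0)"

definition marked_mass :: "('v \<Rightarrow> real) \<Rightarrow> 'v set \<Rightarrow> real" where
  "marked_mass \<pi> M = (\<Sum>x\<in>M. \<pi> x)"

definition absorbing :: "('v \<Rightarrow> 'v \<Rightarrow> real) \<Rightarrow> 'v set \<Rightarrow> 'v \<Rightarrow> 'v \<Rightarrow> real" where
  "absorbing P M x y = (if x \<in> M then of_bool (x = y) else P x y)"

definition interpolated :: "('v \<Rightarrow> 'v \<Rightarrow> real) \<Rightarrow> 'v set \<Rightarrow> real \<Rightarrow> 'v \<Rightarrow> 'v \<Rightarrow> real" where
  "interpolated P M s x y = (1 - s) * P x y + s * absorbing P M x y"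

definition discriminant :: "('v \<Rightarrow> 'v \<Rightarrow> real) \<Rightarrow> 'v set \<Rightarrow> real \<Rightarrow> 'v \<Rightarrow> 'v \<Rightarrow> real" where
  "discriminant P M s x y = sqrt (interpolated P M s x y * interpolated P M s y x)"

text \<open>The eigenvalues \<open>lam 1 \<le> \<dots> \<le> lam n\<close>, \<open>n = card X\<close>, with an orthonormal basis \<open>v 1, \<dots>, v n\<close>.\<close>

definition sorted_eigenbasis ::
  "'v set \<Rightarrow> ('v \<Rightarrow> 'v \<Rightarrow> real) \<Rightarrow> (nat \<Rightarrow> real) \<Rightarrow> (nat \<Rightarrow> 'v \<Rightarrow> real) \<Rightarrow> bool" where
  "sorted_eigenbasis X D lam v \<longleftrightarrow>
     (\<forall>i\<in>{1..card X}. \<forall>j\<in>{1..card X}. i \<le> j \<longrightarrow> lam i \<le> lam j) \<and>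
     (\<forall>i\<in>{1..card X}. \<forall>j\<in>{1..card X}. (\<Sum>x\<in>X. v i x * v j x) = of_bool (i = j)) \<and>
     (\<forall>k\<in>{1..card X}. \<forall>x\<in>X. (\<Sum>y\<in>X. D x y * v k y) = lam k * v k x)"

definition unmarked_state :: "('v \<Rightarrow> real) \<Rightarrow> 'v set \<Rightarrow> 'v \<Rightarrow> real" where
  "unmarked_state \<pi> M x = (if x \<in> M then 0 else sqrt (\<pi> x) / sqrt (1 - marked_mass \<pi> M))"

text \<open>
  For \<open>0 \<le> s < 1\<close> the sum does not depend on the chosen eigenbasis, because the largest eigenvalue
  is simple.
\<close>

definition interpolated_HT ::
  "'v set \<Rightarrow> ('v \<Rightarrow> 'v \<Rightarrow> real) \<Rightarrow> ('v \<Rightarrow> real) \<Rightarrow> 'v set \<Rightarrow> real \<Rightarrow> real" where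
  "interpolated_HT X P \<pi> M s =
     (case (SOME (lam, v). sorted_eigenbasis X (discriminant P M s) lam v) of
        (lam, v) \<Rightarrow>
          \<Sum>k = 1..card X - 1. \<bar>\<Sum>x\<in>X. v k x * unmarked_state \<pi> M x\<bar>\<^sup>2 / (1 - lam k))"

definition extended_HT ::
  "'v set \<Rightarrow> ('v \<Rightarrow> 'v \<Rightarrow> real) \<Rightarrow> ('v \<Rightarrow> real) \<Rightarrow> 'v set \<Rightarrow> real" where
  "extended_HT X P \<pi> M = Lim (at_left 1) (interpolated_HT X P \<pi> M)"


section \<open>Matrices over a finite basis\<close>

type_synonym 'i cmat = "'i \<Rightarrow> 'i \<Rightarrow> complex"

definition mat_apply :: "'i set \<Rightarrow> 'i cmat \<Rightarrow> ('i \<Rightarrow> complex) \<Rightarrow> 'i \<Rightarrow> complex" where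
  "mat_apply B K f = (\<lambda>i. if i \<in> B then \<Sum>j\<in>B. K i j * f j else 0)"

definition adjoint_mat :: "'i cmat \<Rightarrow> 'i cmat" where
  "adjoint_mat K = (\<lambda>i j. cnj (K j i))"

definition unitary_on :: "'i set \<Rightarrow> 'i cmat \<Rightarrow> bool" where
  "unitary_on B K \<longleftrightarrow>
     (\<forall>i\<in>B. \<forall>j\<in>B. (\<Sum>l\<in>B. cnj (K l i) * K l j) = of_bool (i = j)) \<and>
     (\<forall>i\<in>B. \<forall>j\<in>B. (\<Sum>l\<in>B. K i l * cnj (K j l)) = of_bool (i = j))"

definition unit_vector :: "'v set \<Rightarrow> ('v \<Rightarrow> complex) \<Rightarrow> bool" where
  "unit_vector X z \<longleftrightarrow> (\<forall>x. x \<notin> X \<longrightarrow> z x = 0) \<and> (\<Sum>x\<in>X. (cmod (z x))\<^sup>2) = 1"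


section \<open>Circuits over the black boxes\<close>

text \<open>
  A state assigns an amplitude to every basis vector \<open>(x, y, a)\<close>: \<open>x\<close> is the content of the vertex
  register, \<open>y\<close> that of the second register, and the natural number \<open>a\<close> encodes the ancilla
  qubits in binary (qubit \<open>q\<close> is \<open>bit a q\<close>).
\<close>

type_synonym 'v state = "'v \<times> 'v \<times> nat \<Rightarrow> complex"

definition basis :: "'v set \<Rightarrow> nat \<Rightarrow> ('v \<times> 'v \<times> nat) set" where
  "basis X N = X \<times> X \<times> {..<2 ^ N}"

record 'v boxes =
  marked :: "'v set"
  edges :: "('v \<times> 'v) set"
  setup_mat :: "'v cmat"
  update_mat :: "('v \<times> 'v) cmat"

text \<open>
  Setup is a unitary taking the reference vector \<open>z\<close> to \<open>|\<pi>\<rangle>\<close>; neither it nor the update unitary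
  is specified on other inputs.
\<close>

definition boxes_for ::
  "'v set \<Rightarrow> ('v \<times> 'v) set \<Rightarrow> ('v \<Rightarrow> 'v \<Rightarrow> real) \<Rightarrow> ('v \<Rightarrow> real) \<Rightarrow> 'v set \<Rightarrow> ('v \<Rightarrow> complex)
    \<Rightarrow> 'v boxes \<Rightarrow> bool" where
  "boxes_for X E P \<pi> M z bx \<longleftrightarrow>
     marked bx = M \<and> edges bx = E \<and>
     unitary_on X (setup_mat bx) \<and>
     (\<forall>x\<in>X. mat_apply X (setup_mat bx) z x = complex_of_real (sqrt (\<pi> x))) \<and>
     unitary_on (X \<times> X) (update_mat bx) \<and>
     (\<forall>x\<in>X. \<forall>x'\<in>X. \<forall>y\<in>X.
        mat_apply (X \<times> X) (update_mat bx) (\<lambda>(u, v). of_bool (u = x) * z v) (x', y) =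
          of_bool (x' = x) * complex_of_real (sqrt (P x y)))"

text \<open>
  \<open>Static k U\<close> is the unitary \<open>\<Sum>\<^sub>x |x\<rangle>\<langle>x| \<otimes> U x\<close>, with \<open>U x\<close> acting on the second register
  and the ancilla qubits \<open>0, \<dots>, k - 1\<close>.  \<open>Gate Q g\<close> is \<open>g\<close> controlled by all qubits in \<open>Q\<close>;
  \<open>Q = {}\<close> is the plain operation.
\<close>

datatype 'v prim =
    Static nat "'v \<Rightarrow> ('v \<times> nat) cmat"
  | Check nat
  | Setup
  | UpdateV
  | UpdateVadj
  | Shift

datatype 'v gate = Gate "nat set" "'v prim"

type_synonym 'v circuit = "'v gate list"

definition shift_basis :: "('v \<times> 'v) set \<Rightarrow> 'v \<times> 'v \<Rightarrow> 'v \<times> 'v" where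
  "shift_basis E = (\<lambda>(x, y). if (x, y) \<in> E \<or> x = y then (y, x) else (x, y))"

text \<open>
  The amplitude of a basis vector after a permutation of the basis is the amplitude of its preimage
  before; \<open>Check\<close> and (for symmetric \<open>E\<close>) \<open>Shift\<close> are their own inverses.
\<close>

definition shift_op :: "('v \<times> 'v) set \<Rightarrow> 'v state \<Rightarrow> 'v state" where
  "shift_op E \<psi> = (\<lambda>(x, y, a). case shift_basis E (x, y) of (x', y') \<Rightarrow> \<psi> (x', y', a))"

primrec prim_sem :: "'v set \<Rightarrow> 'v boxes \<Rightarrow> 'v prim \<Rightarrow> 'v state \<Rightarrow> 'v state" where
  "prim_sem X bx (Static k U) = (\<lambda>\<psi> (x, y, a).
     mat_apply (X \<times> {..<2 ^ k}) (U x) (\<lambda>(y', w). \<psi> (x, y', (a div 2 ^ k) * 2 ^ k + w))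
       (y, a mod 2 ^ k))"
| "prim_sem X bx (Check q) = (\<lambda>\<psi> (x, y, a).
     \<psi> (x, y, if x \<in> marked bx then flip_bit q a else a))"
| "prim_sem X bx Setup = (\<lambda>\<psi> (x, y, a). mat_apply X (setup_mat bx) (\<lambda>x'. \<psi> (x', y, a)) x)"
| "prim_sem X bx UpdateV = (\<lambda>\<psi> (x, y, a).
     mat_apply (X \<times> X) (update_mat bx) (\<lambda>(x', y'). \<psi> (x', y', a)) (x, y))"
| "prim_sem X bx UpdateVadj = (\<lambda>\<psi> (x, y, a).
     mat_apply (X \<times> X) (adjoint_mat (update_mat bx)) (\<lambda>(x', y'). \<psi> (x', y', a)) (x, y))"
| "prim_sem X bx Shift = shift_op (edges bx)"

primrec gate_sem :: "'v set \<Rightarrow> 'v boxes \<Rightarrow> 'v gate \<Rightarrow> 'v state \<Rightarrow> 'v state" where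
  "gate_sem X bx (Gate Q g) = (\<lambda>\<psi> (x, y, a).
     if \<forall>q\<in>Q. bit a q then prim_sem X bx g \<psi> (x, y, a) else \<psi> (x, y, a))"

definition run :: "'v set \<Rightarrow> 'v boxes \<Rightarrow> 'v circuit \<Rightarrow> 'v state \<Rightarrow> 'v state" where
  "run X bx gs \<psi> = fold (gate_sem X bx) gs \<psi>"

primrec targets :: "'v prim \<Rightarrow> nat set" where
  "targets (Static k U) = {..<k}"
| "targets (Check q) = {q}"
| "targets Setup = {}"
| "targets UpdateV = {}"
| "targets UpdateVadj = {}"
| "targets Shift = {}"

primrec unitary_prim :: "'v set \<Rightarrow> 'v prim \<Rightarrow> bool" where
  "unitary_prim X (Static k U) = (\<forall>x\<in>X. unitary_on (X \<times> {..<2 ^ k}) (U x))"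
| "unitary_prim X (Check q) = True"
| "unitary_prim X Setup = True"
| "unitary_prim X UpdateV = True"
| "unitary_prim X UpdateVadj = True"
| "unitary_prim X Shift = True"

text \<open>Admissible gates on the ancilla qubits \<open>0, \<dots>, N - 1\<close>.\<close>

primrec wf_gate :: "'v set \<Rightarrow> nat \<Rightarrow> 'v gate \<Rightarrow> bool" where
  "wf_gate X N (Gate Q g) \<longleftrightarrow>
     targets g \<subseteq> {..<N} \<and> Q \<subseteq> {..<N} \<and> Q \<inter> targets g = {} \<and> unitary_prim X g"

definition wf_circuit :: "'v set \<Rightarrow> nat \<Rightarrow> 'v circuit \<Rightarrow> bool" where
  "wf_circuit X N gs \<longleftrightarrow> (\<forall>g\<in>set gs. wf_gate X N g)"

primrec control_gate :: "nat \<Rightarrow> 'v gate \<Rightarrow> 'v gate" where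
  "control_gate q (Gate Q g) = Gate (insert q Q) g"

definition controlled :: "nat \<Rightarrow> 'v circuit \<Rightarrow> 'v circuit" where
  "controlled q gs = map (control_gate q) gs"

primrec prim_cost :: "real \<Rightarrow> real \<Rightarrow> real \<Rightarrow> 'v prim \<Rightarrow> real" where
  "prim_cost S U C (Static k A) = 0"
| "prim_cost S U C (Check q) = C"
| "prim_cost S U C Setup = S"
| "prim_cost S U C UpdateV = U"
| "prim_cost S U C UpdateVadj = U"
| "prim_cost S U C Shift = U"

primrec gate_cost :: "real \<Rightarrow> real \<Rightarrow> real \<Rightarrow> 'v gate \<Rightarrow> real" where
  "gate_cost S U C (Gate Q g) = prim_cost S U C g"


section \<open>Algorithms with measurements\<close>

text \<open>
  \<open>Measure q A0 A1\<close> measures ancilla qubit \<open>q\<close> and continues with \<open>A0\<close> on result 0 and with \<open>A1\<close>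
  on result 1.  \<open>OutputVertex\<close> measures the vertex register and outputs the result.
\<close>

datatype 'v algorithm =
    Apply "'v circuit" "'v algorithm"
  | Measure nat "'v algorithm" "'v algorithm"
  | OutputVertex
  | NoMarkedVertex

primrec wf_algorithm :: "'v set \<Rightarrow> nat \<Rightarrow> 'v algorithm \<Rightarrow> bool" where
  "wf_algorithm X N (Apply gs A) \<longleftrightarrow> wf_circuit X N gs \<and> wf_algorithm X N A"
| "wf_algorithm X N (Measure q A0 A1) \<longleftrightarrow> q < N \<and> wf_algorithm X N A0 \<and> wf_algorithm X N A1"
| "wf_algorithm X N OutputVertex \<longleftrightarrow> True"
| "wf_algorithm X N NoMarkedVertex \<longleftrightarrow> True"

text \<open>
  Probability of the output \<open>x\<close>.  States are not renormalised after a measurement, so the numbers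
  at the leaves are already the joint probabilities.
\<close>

primrec output_prob :: "'v set \<Rightarrow> 'v boxes \<Rightarrow> nat \<Rightarrow> 'v algorithm \<Rightarrow> 'v state \<Rightarrow> 'v \<Rightarrow> real" where
  "output_prob X bx N (Apply gs A) = (\<lambda>\<psi>. output_prob X bx N A (run X bx gs \<psi>))"
| "output_prob X bx N (Measure q A0 A1) = (\<lambda>\<psi> x.
     output_prob X bx N A0 (\<lambda>(u, v, a). if bit a q then 0 else \<psi> (u, v, a)) x +
     output_prob X bx N A1 (\<lambda>(u, v, a). if bit a q then \<psi> (u, v, a) else 0) x)"
| "output_prob X bx N OutputVertex = (\<lambda>\<psi> x. \<Sum>y\<in>X. \<Sum>a<2 ^ N. (cmod (\<psi> (x, y, a)))\<^sup>2)"
| "output_prob X bx N NoMarkedVertex = (\<lambda>\<psi> x. 0)"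

definition initial_state :: "('v \<Rightarrow> complex) \<Rightarrow> 'v state" where
  "initial_state z = (\<lambda>(x, y, a). of_bool (a = 0) * (z x * z y))"

definition success_prob ::
  "'v set \<Rightarrow> 'v boxes \<Rightarrow> ('v \<Rightarrow> complex) \<Rightarrow> nat \<times> 'v algorithm \<Rightarrow> real" where
  "success_prob X bx z = (\<lambda>(N, A). \<Sum>x\<in>marked bx. output_prob X bx N A (initial_state z) x)"

text \<open>Worst case over the measurement results of the total cost of the black-box calls.\<close>

primrec alg_cost :: "real \<Rightarrow> real \<Rightarrow> real \<Rightarrow> 'v algorithm \<Rightarrow> real" where
  "alg_cost S U C (Apply gs A) = (\<Sum>g\<leftarrow>gs. gate_cost S U C g) + alg_cost S U C A"
| "alg_cost S U C (Measure q A0 A1) = max (alg_cost S U C A0) (alg_cost S U C A1)"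
| "alg_cost S U C OutputVertex = 0"
| "alg_cost S U C NoMarkedVertex = 0"

definition total_cost :: "real \<Rightarrow> real \<Rightarrow> real \<Rightarrow> nat \<times> 'v algorithm \<Rightarrow> real" where
  "total_cost S U C = (\<lambda>(N, A). alg_cost S U C A)"


section \<open>The search algorithm\<close>

text \<open>
  The walk lives on the two registers and \<open>k\<close> work qubits, which belong to the second register:
  its reference vector is \<open>z \<otimes> |0\<rangle>\<close>.
\<close>

definition interpolated_update ::
  "'v set \<Rightarrow> ('v \<Rightarrow> 'v \<Rightarrow> real) \<Rightarrow> 'v set \<Rightarrow> real \<Rightarrow> ('v \<Rightarrow> complex) \<Rightarrow> nat
    \<Rightarrow> ('v \<times> 'v \<times> nat) cmat \<Rightarrow> bool" where
  "interpolated_update X P M s z k V \<longleftrightarrow>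
     unitary_on (basis X k) V \<and>
     (\<forall>x\<in>X. \<forall>(x', y, w)\<in>basis X k.
        mat_apply (basis X k) V (\<lambda>(u, v, b). of_bool (u = x \<and> b = 0) * z v) (x', y, w) =
          of_bool (x' = x \<and> w = 0) * complex_of_real (sqrt (interpolated P M s x y)))"

definition ref_op :: "'v set \<Rightarrow> ('v \<Rightarrow> complex) \<Rightarrow> 'v state \<Rightarrow> 'v state" where
  "ref_op X z \<psi> = (\<lambda>(x, y, w).
     2 * (of_bool (w = 0) * z y * (\<Sum>y'\<in>X. cnj (z y') * \<psi> (x, y', 0))) - \<psi> (x, y, w))"

definition walk_op ::
  "'v set \<Rightarrow> ('v \<times> 'v) set \<Rightarrow> ('v \<Rightarrow> complex) \<Rightarrow> nat \<Rightarrow> ('v \<times> 'v \<times> nat) cmat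
    \<Rightarrow> 'v state \<Rightarrow> 'v state" where
  "walk_op X E z k V \<psi> =
     mat_apply (basis X k) (adjoint_mat V)
       (shift_op E (mat_apply (basis X k) V (ref_op X z \<psi>)))"

definition supported_on :: "'i set \<Rightarrow> ('i \<Rightarrow> complex) \<Rightarrow> bool" where
  "supported_on B \<psi> \<longleftrightarrow> (\<forall>i. i \<notin> B \<longrightarrow> \<psi> i = 0)"

definition implements ::
  "'v set \<Rightarrow> 'v boxes \<Rightarrow> nat \<Rightarrow> 'v circuit \<Rightarrow> ('v state \<Rightarrow> 'v state) \<Rightarrow> bool" where
  "implements X bx k w F \<longleftrightarrow> wf_circuit X k w \<and>
     (\<forall>\<psi>. supported_on (basis X k) \<psi> \<longrightarrow> run X bx w \<psi> = F \<psi>)"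

text \<open>
  Eigenvalue estimation alternates static unitaries with calls to the controlled circuit \<open>w\<close>.
  The estimate \<open>m\<close> is kept in the \<open>t\<close> qubits \<open>k, \<dots>, k + t - 1\<close>, so an ancilla value
  \<open>a < 2 ^ (k + t)\<close> stands for work register \<open>a mod 2 ^ k\<close> and estimate \<open>m = a div 2 ^ k\<close>; a state
  supported on \<open>basis X k\<close> has the estimate register in \<open>|0\<rangle>\<close>.
\<close>

datatype 'v estep = FreeStep "'v \<Rightarrow> ('v \<times> nat) cmat" | CallWalk nat

primrec expand_step :: "nat \<Rightarrow> nat \<Rightarrow> 'v circuit \<Rightarrow> 'v estep \<Rightarrow> 'v circuit" where
  "expand_step k t w (FreeStep A) = [Gate {} (Static (k + t) A)]"
| "expand_step k t w (CallWalk q) = controlled q w"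

definition is_call :: "'v estep \<Rightarrow> bool" where
  "is_call e \<longleftrightarrow> (\<exists>q. e = CallWalk q)"

definition eigenvalue_estimation ::
  "'v set \<Rightarrow> 'v boxes \<Rightarrow> nat \<Rightarrow> 'v circuit \<Rightarrow> ('v state \<Rightarrow> 'v state) \<Rightarrow> nat \<Rightarrow> 'v circuit \<Rightarrow> bool" where
  "eigenvalue_estimation X bx k w W t ee \<longleftrightarrow>
     (\<exists>es. ee = concat (map (expand_step k t w) es) \<and>
           (\<forall>q. CallWalk q \<in> set es \<longrightarrow> k \<le> q \<and> q < k + t) \<and>
           length (filter is_call es) \<le> 2 ^ t) \<and>
     wf_circuit X (k + t) ee \<and>
     (\<forall>\<Psi> \<phi>. supported_on (basis X k) \<Psi> \<and> \<Psi> \<noteq> (\<lambda>_. 0) \<and> W \<Psi> = (\<lambda>i. cis \<phi> * \<Psi> i) \<longrightarrow>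
        run X bx ee \<Psi> = (\<lambda>(x, y, a).
          let m = a div 2 ^ k in
          if m < 2 ^ t
          then \<Psi> (x, y, a mod 2 ^ k) *
                 (1 / 2 ^ t * (\<Sum>l<2 ^ t. exp (- 2 * pi * \<i> * of_nat l * of_nat m / 2 ^ t) *
                                          exp (\<i> * \<phi> * of_nat l)))
          else 0))"

text \<open>The two qubits attached for \<open>Check\<close> are \<open>k + t\<close> and \<open>k + t + 1\<close>.\<close>

definition search_algorithm :: "nat \<Rightarrow> nat \<Rightarrow> 'v circuit \<Rightarrow> 'v algorithm" where
  "search_algorithm k t ee =
     Apply [Gate {} Setup, Gate {} (Check (k + t))]
       (Measure (k + t)
          (Apply (ee @ [Gate {} (Check (k + t + 1))])
             (Measure (k + t + 1) NoMarkedVertex OutputVertex))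
          OutputVertex)"

text \<open>
  All algorithms \<open>Search(P, M, s, t)\<close>, together with their number of ancilla qubits: they differ in
  the choice of the unitary \<open>V(s)\<close>, which is not fully determined by the chain, and in the circuits
  used for the walk operator and for eigenvalue estimation.
\<close>

definition Search ::
  "'v set \<Rightarrow> ('v \<Rightarrow> complex) \<Rightarrow> 'v boxes \<Rightarrow> ('v \<Rightarrow> 'v \<Rightarrow> real) \<Rightarrow> 'v set \<Rightarrow> real \<Rightarrow> nat
    \<Rightarrow> (nat \<times> 'v algorithm) set" where
  "Search X z bx P M s t =
     {(k + t + 2, search_algorithm k t ee) | k ee.
        wf_algorithm X (k + t + 2) (search_algorithm k t ee) \<and>
        (\<exists>V w. interpolated_update X P M s z k V \<and>
               implements X bx k w (walk_op X (edges bx) z k V) \<and>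
               eigenvalue_estimation X bx k w (walk_op X (edges bx) z k V) t ee)}"

end

theory Submission
  imports Defs "HOL-Analysis.Function_Topology"
begin

text \<open>
  Write \<open>D(s)\<close> for the discriminant and \<open>|U\<rangle> = cos \<theta> |v\<^sub>n(s)\<rangle> + |u'\<rangle>\<close> with \<open>|u'\<rangle>\<close> orthogonal to the
  top eigenvector \<open>|v\<^sub>n(s)\<rangle>\<close>, which has marked mass \<open>sin\<^sup>2 \<theta>\<close>.  From \<open>I - D(s) = S (I - D(0)) S\<close>, with
  \<open>S\<close> diagonal, one gets \<open>HT(s) = sin\<^sup>4 \<theta> HT\<^sup>+\<close> without differentiating in \<open>s\<close>.

  On vectors \<open>|f\<rangle>|0\<rangle>\<close> the walk satisfies \<open>W + W\<^sup>-\<^sup>1 = 2 D(s)\<close>.  Hence each \<open>|v\<^sub>k\<rangle>|0\<rangle>\<close> is a combination of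
  at most two eigenvectors of \<open>W\<close>, and the amplitude of eigenvalue estimation at \<open>m = 0\<close> is the mean of
  \<open>W\<^sup>l\<close> over \<open>l < 2\<^sup>t\<close>.  The mean fixes \<open>|v\<^sub>n\<rangle>|0\<rangle>\<close>.  If \<open>(I - D(s)) w = u'\<close>, then
  \<open>|u'\<rangle> = (I - W) (I - W\<^sup>-\<^sup>1) |w\<rangle> / 2\<close>, so the sum of the \<open>W\<^sup>l |u'\<rangle>\<close> telescopes and its mean has squared norm
  at most \<open>2 HT(s) / 4\<^sup>t \<le> sin\<^sup>4 \<theta> / 98\<close>.  What remains, \<open>cos \<theta> |v\<^sub>n\<rangle>\<close> up to this error, is marked with
  probability at least \<open>cos\<^sup>2 \<theta> sin\<^sup>2 \<theta> / 2 - sin\<^sup>4 \<theta> / 98\<close>, and the bounds on \<open>p\<close> confine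
  \<open>sin\<^sup>2 \<theta>\<close> to \<open>[3/8, 3/4]\<close>.
\<close>

section \<open>Real symmetric matrices on a finite set\<close>

text \<open>The bound on the success probability concerns every member of \<open>Search\<close>,
  whose estimation circuit is specified only on eigenvectors of the walk; its action on any other
  vector has to be obtained by linearity, which is what forces the decomposition into eigenvectors.
  The cost bound needs a concrete circuit, and \<open>Q\<close> is chosen before the chain, the
  marked set and the boxes: it may depend on \<open>X\<close>, \<open>z\<close>, \<open>d\<close>,
  \<open>p\<close> and \<open>T\<close> only. The obstacle there is V(s) at a marked vertex x.
  Staying with weight s and the loop of P both end at x, and their amplitudes must be merged into
  one, \<open>sqrt ((1 - s) * P x x + s)\<close>, with the coin that told them apart back at 0. The
  reflection that achieves this has entries depending on P x x, which is why the loop probabilities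
  \<open>d\<close> are part of the input. The constant 14 enters through its square 196: T^2 <= 4^t
  gives 196 HT+ <= 4^t, hence the error 1/98 relative to sin^4. Half of the main term comes from a
  plain |a|^2 <= 2 |r|^2 + 2 |error|^2.\<close>

definition dot :: "'v set \<Rightarrow> ('v \<Rightarrow> real) \<Rightarrow> ('v \<Rightarrow> real) \<Rightarrow> real" where
  "dot X f g = (\<Sum>x\<in>X. f x * g x)"

definition mv :: "'v set \<Rightarrow> ('v \<Rightarrow> 'v \<Rightarrow> real) \<Rightarrow> ('v \<Rightarrow> real) \<Rightarrow> 'v \<Rightarrow> real" where
  "mv X D f = (\<lambda>x. \<Sum>y\<in>X. D x y * f y)"

lemma dot_commute: "dot X f g = dot X g f"
  by (simp add: dot_def mult.commute)

lemma dot_add_left: "dot X (\<lambda>x. f x + g x) h = dot X f h + dot X g h"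
  by (simp add: dot_def distrib_right sum.distrib)

lemma dot_add_right: "dot X h (\<lambda>x. f x + g x) = dot X h f + dot X h g"
  by (simp add: dot_def distrib_left sum.distrib)

lemma dot_diff_left: "dot X (\<lambda>x. f x - g x) h = dot X f h - dot X g h"
  by (simp add: dot_def left_diff_distrib sum_subtractf)

lemma dot_diff_right: "dot X h (\<lambda>x. f x - g x) = dot X h f - dot X h g"
  by (simp add: dot_def right_diff_distrib sum_subtractf)

lemma dot_scale_left: "dot X (\<lambda>x. c * f x) h = c * dot X f h"
  by (simp add: dot_def sum_distrib_left mult.assoc)

lemma dot_scale_right: "dot X h (\<lambda>x. c * f x) = c * dot X h f"
  by (simp add: dot_def sum_distrib_left mult.left_commute)

lemma dot_sum_left: "dot X (\<lambda>x. \<Sum>i\<in>I. f i x) h = (\<Sum>i\<in>I. dot X (f i) h)"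
  unfolding dot_def by (simp add: sum_distrib_right) (rule sum.swap)

lemma dot_sum_right: "dot X h (\<lambda>x. \<Sum>i\<in>I. f i x) = (\<Sum>i\<in>I. dot X h (f i))"
  unfolding dot_def by (simp add: sum_distrib_left) (rule sum.swap)

lemmas dot_lin = dot_add_left dot_add_right dot_diff_left dot_diff_right dot_scale_left
  dot_scale_right dot_sum_left dot_sum_right

lemma dot_cong: "(\<And>x. x \<in> X \<Longrightarrow> f x = f' x) \<Longrightarrow> (\<And>x. x \<in> X \<Longrightarrow> g x = g' x) \<Longrightarrow> dot X f g = dot X f' g'"
  by (simp add: dot_def)

lemma dot_self_nonneg [simp]: "0 \<le> dot X f f"
  by (simp add: dot_def sum_nonneg)

lemma dot_self_eq_0: "finite X \<Longrightarrow> dot X f f = 0 \<longleftrightarrow> (\<forall>x\<in>X. f x = 0)"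
  by (simp add: dot_def sum_nonneg_eq_0_iff)

lemma mv_diff: "mv X D (\<lambda>x. f x - g x) = (\<lambda>x. mv X D f x - mv X D g x)"
  by (simp add: mv_def right_diff_distrib sum_subtractf)

lemma mv_scale: "mv X D (\<lambda>x. c * f x) = (\<lambda>x. c * mv X D f x)"
  by (simp add: mv_def sum_distrib_left mult.left_commute)

lemma mv_sum: "mv X D (\<lambda>x. \<Sum>i\<in>I. f i x) = (\<lambda>x. \<Sum>i\<in>I. mv X D (f i) x)"
  unfolding mv_def by (simp add: sum_distrib_left) (rule ext, rule sum.swap)

lemma mv_cong: "(\<And>x. x \<in> X \<Longrightarrow> f x = g x) \<Longrightarrow> mv X D f = mv X D g"
  by (simp add: mv_def)

lemma dot_mv_symmetric:
  assumes "\<And>x y. x \<in> X \<Longrightarrow> y \<in> X \<Longrightarrow> D x y = D y x"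
  shows "dot X f (mv X D g) = dot X (mv X D f) g"
proof -
  have "dot X f (mv X D g) = (\<Sum>x\<in>X. \<Sum>y\<in>X. f x * D x y * g y)"
    by (simp add: dot_def mv_def sum_distrib_left mult.assoc)
  also have "\<dots> = (\<Sum>y\<in>X. \<Sum>x\<in>X. f x * D x y * g y)"
    by (rule sum.swap)
  also have "\<dots> = dot X (mv X D f) g"
    unfolding dot_def mv_def sum_distrib_right
    by (intro sum.cong refl) (use assms in \<open>simp add: mult.commute mult.left_commute\<close>)
  finally show ?thesis .
qed

section \<open>Orthonormal families: residuals, completeness, Parseval\<close>

definition orthonormal :: "'v set \<Rightarrow> nat \<Rightarrow> (nat \<Rightarrow> 'v \<Rightarrow> real) \<Rightarrow> bool" where
  "orthonormal X m v \<longleftrightarrow> (\<forall>i\<in>{1..m}. \<forall>j\<in>{1..m}. dot X (v i) (v j) = of_bool (i = j))"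

lemma dot_unit:
  assumes "finite X" "x \<in> X"
  shows "dot X (\<lambda>y. of_bool (x = y)) f = f x"
  using assms by (simp add: dot_def of_bool_def if_distrib[of "\<lambda>c. c * _"] sum.delta cong: if_cong)

lemma residual_norm:
  fixes v :: "nat \<Rightarrow> 'v \<Rightarrow> real"
  assumes "orthonormal X m v"
  defines "r \<equiv> \<lambda>f x. f x - (\<Sum>i=1..m. dot X (v i) f * v i x)"
  shows "i \<in> {1..m} \<Longrightarrow> dot X (v i) (r f) = 0"
    and "dot X (r f) (r f) = dot X f f - (\<Sum>i=1..m. (dot X (v i) f)\<^sup>2)"
proof -
  have o: "dot X (v i) (r f) = 0" if i: "i \<in> {1..m}" for i
  proof -
    have "(\<Sum>j=1..m. dot X (v j) f * dot X (v i) (v j)) = (\<Sum>j=1..m. if i = j then dot X (v j) f else 0)"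
      using assms i by (intro sum.cong) (auto simp: orthonormal_def)
    also have "\<dots> = dot X (v i) f" using i by simp
    finally show ?thesis unfolding r_def by (simp add: dot_lin)
  qed
  show "i \<in> {1..m} \<Longrightarrow> dot X (v i) (r f) = 0" by (rule o)
  have "dot X (r f) (r f) = dot X f (r f) - (\<Sum>i=1..m. dot X (v i) f * dot X (v i) (r f))"
    by (subst (1) r_def) (simp add: dot_lin)
  also have "(\<Sum>i=1..m. dot X (v i) f * dot X (v i) (r f)) = 0"
    using o by (intro sum.neutral) auto
  also have "dot X f (r f) = dot X f f - (\<Sum>i=1..m. (dot X (v i) f)\<^sup>2)"
    unfolding r_def by (simp add: dot_lin power2_eq_square dot_commute[of X f "v _"])
  finally show "dot X (r f) (r f) = dot X f f - (\<Sum>i=1..m. (dot X (v i) f)\<^sup>2)" by simp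
qed

text \<open>The left side is the trace of the projection onto the span of the \<open>v i\<close>.
  This count takes the place of dimension theory: it shows below that fewer than
  \<open>card X\<close> vectors leave room for another one, and that \<open>card X\<close> of them
  are complete.\<close>

lemma orthonormal_sum_coords:
  assumes "orthonormal X m v"
  shows "(\<Sum>x\<in>X. \<Sum>i=1..m. (v i x)\<^sup>2) = real m"
proof -
  have "(\<Sum>x\<in>X. \<Sum>i=1..m. (v i x)\<^sup>2) = (\<Sum>i=1..m. dot X (v i) (v i))"
    unfolding dot_def by (subst sum.swap) (simp add: power2_eq_square)
  also have "\<dots> = (\<Sum>i=1..m. 1)"
    using assms by (intro sum.cong) (auto simp: orthonormal_def)
  finally show ?thesis by simp
qed

lemma residual_unit_norm:
  assumes "finite X" "orthonormal X m v" "x \<in> X"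
  defines "r \<equiv> \<lambda>y. of_bool (x = y) - (\<Sum>i=1..m. v i x * v i y)"
  shows "dot X r r = 1 - (\<Sum>i=1..m. (v i x)\<^sup>2)" "i \<in> {1..m} \<Longrightarrow> dot X (v i) r = 0"
proof -
  have e: "dot X (v i) (\<lambda>y. of_bool (x = y)) = v i x" for i
    using dot_unit[OF assms(1,3)] by (simp add: dot_commute[of X "v i"])
  show "dot X r r = 1 - (\<Sum>i=1..m. (v i x)\<^sup>2)" "i \<in> {1..m} \<Longrightarrow> dot X (v i) r = 0"
    using residual_norm[OF assms(2), where f = "\<lambda>y. of_bool (x = y)"] dot_unit[OF assms(1,3), of "\<lambda>y. of_bool (x = y)"]
    by (simp_all add: e r_def)
qed

text \<open>If every standard unit vector lay in the span, each row sum in the trace identity would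
  be at least 1 and the trace at least \<open>card X\<close>. So some unit vector has a nonzero
  residual, which is normalised and cut to \<open>X\<close>.\<close>

lemma orthonormal_complement:
  assumes "finite X" "orthonormal X m v" "m < card X"
  obtains f where "dot X f f = 1" "\<And>i. i \<in> {1..m} \<Longrightarrow> dot X (v i) f = 0" "\<And>x. x \<notin> X \<Longrightarrow> f x = 0"
proof -
  have "\<exists>x\<in>X. (\<Sum>i=1..m. (v i x)\<^sup>2) < 1"
  proof (rule ccontr)
    assume "\<not> ?thesis"
    then have "(\<Sum>x\<in>X. 1) \<le> (\<Sum>x\<in>X. \<Sum>i=1..m. (v i x)\<^sup>2)"
      by (intro sum_mono) (auto simp: not_less)
    then show False using orthonormal_sum_coords[OF assms(2)] assms(3) by simp
  qed
  then obtain x where x: "x \<in> X" "(\<Sum>i=1..m. (v i x)\<^sup>2) < 1" by auto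
  define r where "r = (\<lambda>y. of_bool (x = y) - (\<Sum>i=1..m. v i x * v i y))"
  have r: "dot X r r > 0" "\<And>i. i \<in> {1..m} \<Longrightarrow> dot X (v i) r = 0"
    using residual_unit_norm[OF assms(1,2) x(1), folded r_def] x(2) by auto
  define f where "f = (\<lambda>y. if y \<in> X then 1 / sqrt (dot X r r) * r y else 0)"
  have f: "dot X g f = 1 / sqrt (dot X r r) * dot X g r" for g
    unfolding dot_scale_right[symmetric] by (rule dot_cong) (auto simp: f_def)
  have "dot X f f = 1"
    using f[of f] f[of r] r(1) by (simp add: dot_commute[of X f r])
  then show thesis using that[of f] r(2) f by (simp add: f_def)
qed

text \<open>The squared norms of the residuals of all standard unit vectors add up to
  \<open>card X\<close> minus the trace, which is 0, so each residual vanishes.\<close>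

lemma orthonormal_expansion:
  assumes "finite X" "orthonormal X (card X) v" "x \<in> X"
  shows "f x = (\<Sum>i=1..card X. dot X (v i) f * v i x)"
proof -
  define r where "r = (\<lambda>x y. of_bool (x = y) - (\<Sum>i=1..card X. v i x * v i y))"
  have n: "dot X (r x) (r x) = 1 - (\<Sum>i=1..card X. (v i x)\<^sup>2)" if "x \<in> X" for x
    unfolding r_def using residual_unit_norm(1)[OF assms(1,2) that] .
  have "(\<Sum>x\<in>X. dot X (r x) (r x)) = 0"
    using n orthonormal_sum_coords[OF assms(2)] by (simp add: sum_subtractf)
  then have "dot X (r x) (r x) = 0"
    using assms by (simp add: sum_nonneg_eq_0_iff)
  then have z: "\<forall>y\<in>X. r x y = 0"
    using assms by (simp add: dot_self_eq_0)
  have "f x = dot X (\<lambda>y. of_bool (x = y)) f"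
    by (simp add: dot_unit assms)
  also have "\<dots> = dot X (\<lambda>y. \<Sum>i=1..card X. v i x * v i y) f"
    by (rule dot_cong) (use z in \<open>auto simp: r_def\<close>)
  also have "\<dots> = (\<Sum>i=1..card X. dot X (v i) f * v i x)"
    unfolding dot_lin by (rule sum.cong) (simp_all add: mult.commute)
  finally show ?thesis .
qed

lemma parseval:
  assumes "finite X" "orthonormal X (card X) v"
  shows "dot X f g = (\<Sum>i=1..card X. dot X (v i) f * dot X (v i) g)"
proof -
  have "dot X f g = dot X (\<lambda>x. \<Sum>i=1..card X. dot X (v i) f * v i x) g"
    by (rule dot_cong) (use orthonormal_expansion[OF assms] in auto)
  also have "\<dots> = (\<Sum>i=1..card X. dot X (v i) f * dot X (v i) g)"
    by (simp add: dot_lin)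
  finally show ?thesis .
qed

section \<open>Diagonalisation of symmetric matrices by minimising the Rayleigh quotient\<close>

lemma compact_box_functions:
  fixes B :: "'v \<Rightarrow> real set"
  assumes "\<And>x. compact (B x)"
  shows "compact {f. \<forall>x. f x \<in> B x}"
proof -
  have "compactin (product_topology (\<lambda>i::'v. euclidean) UNIV) (PiE UNIV B)"
    unfolding compactin_PiE using assms by simp
  moreover have "PiE UNIV B = {f. \<forall>x. f x \<in> B x}" by auto
  ultimately show ?thesis
    by (metis compactin_euclidean_iff euclidean_product_topology)
qed

text \<open>A minimiser of the quadratic form on the unit vectors orthogonal to the earlier
  eigenvectors is itself an eigenvector, because its first variation vanishes. The type
  \<open>'v\<close> may be infinite, so compactness is taken from the product topology: the box
  \<open>K\<close> consists of functions with values in [-1, 1] on \<open>X\<close> and 0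
  elsewhere.\<close>

lemma rayleigh_minimiser:
  fixes D :: "'v \<Rightarrow> 'v \<Rightarrow> real"
  assumes fin: "finite X" and sym: "\<And>x y. x \<in> X \<Longrightarrow> y \<in> X \<Longrightarrow> D x y = D y x"
    and on: "orthonormal X m v" and m: "m < card X"
    and eig: "\<And>i x. i \<in> {1..m} \<Longrightarrow> x \<in> X \<Longrightarrow> mv X D (v i) x = lam i * v i x"
  obtains f l where "dot X f f = 1" "\<And>i. i \<in> {1..m} \<Longrightarrow> dot X (v i) f = 0"
    "\<And>x. x \<in> X \<Longrightarrow> mv X D f x = l * f x"
    "\<And>g. (\<And>i. i \<in> {1..m} \<Longrightarrow> dot X (v i) g = 0) \<Longrightarrow> l * dot X g g \<le> dot X g (mv X D g)"
proof -
  define K where "K = {f :: 'v \<Rightarrow> real. \<forall>x. f x \<in> (if x \<in> X then {-1..1} else {0})}"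
  define S where "S = {f. dot X f f = 1 \<and> (\<forall>i\<in>{1..m}. dot X (v i) f = 0)}"
  have dcont: "continuous_on UNIV (\<lambda>f. dot X (F f) (G f))"
    if "\<And>x. continuous_on UNIV (\<lambda>f :: 'v \<Rightarrow> real. F f x)" "\<And>x. continuous_on UNIV (\<lambda>f. G f x)" for F G
    unfolding dot_def using that by (intro continuous_intros)
  have c0: "continuous_on UNIV (\<lambda>f :: 'v \<Rightarrow> real. f x)" for x
    by simp
  have cm: "continuous_on UNIV (\<lambda>f. mv X D f x)" for x
    unfolding mv_def by (intro continuous_intros c0)
  have "compact K" unfolding K_def by (rule compact_box_functions) simp
  moreover have "closed S"
  proof -
    have "S = {f. dot X f f = 1} \<inter> (\<Inter>i\<in>{1..m}. {f. dot X (v i) f = 0})"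
      unfolding S_def by auto
    moreover have "closed {f. dot X f f = 1}"
      by (rule closed_Collect_eq) (intro dcont c0 continuous_intros)+
    moreover have "closed {f. dot X (v i) f = 0}" for i
      by (rule closed_Collect_eq) (intro dcont c0 continuous_intros)+
    ultimately show ?thesis by auto
  qed
  ultimately have cpt: "compact (K \<inter> S)" by (rule compact_Int_closed)
  \<comment> \<open>A coordinate of a unit vector has modulus at most 1, so the box excludes no
    competitor once functions are cut to \<open>X\<close>.\<close>
  have unitK: "(\<lambda>x. if x \<in> X then f x else 0) \<in> K" if "dot X f f = 1" for f
  proof -
    have "\<bar>f x\<bar> \<le> 1" if x: "x \<in> X" for x
    proof -
      have "f x * f x \<le> dot X f f" unfolding dot_def
        using x fin by (intro member_le_sum) auto
      then have "(f x)\<^sup>2 \<le> 1" using \<open>dot X f f = 1\<close> by (simp add: power2_eq_square)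
      then show ?thesis by (simp add: abs_square_le_1)
    qed
    then show ?thesis by (auto simp: K_def abs_le_iff)
  qed
  obtain f0 where f0: "dot X f0 f0 = 1" "\<And>i. i \<in> {1..m} \<Longrightarrow> dot X (v i) f0 = 0" "\<And>x. x \<notin> X \<Longrightarrow> f0 x = 0"
    using orthonormal_complement[OF fin on m] by metis
  have "(\<lambda>x. if x \<in> X then f0 x else 0) = f0" using f0(3) by auto
  then have "f0 \<in> K \<inter> S" using unitK[OF f0(1)] f0(1,2) by (auto simp: S_def)
  then have ne: "K \<inter> S \<noteq> {}" by auto
  have "continuous_on (K \<inter> S) (\<lambda>f. dot X f (mv X D f))"
    by (rule continuous_on_subset[OF dcont]) (auto intro: c0 cm)
  then obtain f where f: "f \<in> K \<inter> S" and min: "\<And>g. g \<in> K \<inter> S \<Longrightarrow> dot X f (mv X D f) \<le> dot X g (mv X D g)"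
    using continuous_attains_inf[OF cpt ne] by metis
  define l where "l = dot X f (mv X D f)"
  have f1: "dot X f f = 1" and fo: "\<And>i. i \<in> {1..m} \<Longrightarrow> dot X (v i) f = 0"
    using f by (auto simp: S_def)
  have ray: "l * dot X g g \<le> dot X g (mv X D g)" if g: "\<And>i. i \<in> {1..m} \<Longrightarrow> dot X (v i) g = 0" for g
  proof (cases "dot X g g = 0")
    case True
    then have "\<forall>x\<in>X. g x = 0" using fin by (simp add: dot_self_eq_0)
    then have "dot X g (mv X D g) = 0" by (simp add: dot_def)
    then show ?thesis using True by simp
  next
    case False
    then have pos: "dot X g g > 0" using dot_self_nonneg[of X g] by linarith
    define c where "c = 1 / sqrt (dot X g g)"
    have cc: "c * c * dot X g g = 1" using pos by (simp add: c_def)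
    define g' where "g' = (\<lambda>x. if x \<in> X then c * g x else 0)"
    have g'd: "dot X h g' = c * dot X h g" for h
      unfolding dot_scale_right[symmetric] by (rule dot_cong) (auto simp: g'_def)
    have g'd2: "dot X g' h = c * dot X g h" for h
      using g'd[of h] by (simp add: dot_commute)
    have g'1: "dot X g' g' = 1" using cc by (simp add: g'd g'd2)
    have "g' \<in> K \<inter> S"
      using unitK[OF g'1] g'1 g by (auto simp: S_def g'd) (simp add: g'_def cong: if_cong)?
    then have "l \<le> dot X g' (mv X D g')" unfolding l_def by (rule min)
    also have "mv X D g' = mv X D (\<lambda>x. c * g x)" by (rule mv_cong) (simp add: g'_def)
    also have "dot X g' \<dots> = c * c * dot X g (mv X D g)" by (simp add: g'd2 mv_scale dot_scale_right)
    finally have "l * dot X g g \<le> (c * c * dot X g (mv X D g)) * dot X g g"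
      using pos by (intro mult_right_mono) auto
    also have "\<dots> = dot X g (mv X D g)" using cc by (metis mult.assoc mult.commute mult.right_neutral)
    finally show ?thesis .
  qed
  define e where "e = (\<lambda>x. mv X D f x - l * f x)"
  \<comment> \<open>By symmetry \<open>D\<close> preserves the orthogonal complement of the earlier
    eigenvectors, so the residual \<open>e\<close> is an admissible direction of variation.\<close>
  have eo: "dot X (v i) e = 0" if i: "i \<in> {1..m}" for i
  proof -
    have "dot X (v i) (mv X D f) = dot X (mv X D (v i)) f" by (rule dot_mv_symmetric[OF sym])
    also have "\<dots> = dot X (\<lambda>x. lam i * v i x) f" by (rule dot_cong) (use eig i in auto)
    finally show ?thesis using fo[OF i] by (simp add: e_def dot_lin)
  qed
  text \<open>First variation of the Rayleigh quotient at \<open>f\<close> in the direction \<open>-e\<close>.\<close>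
  have "dot X e e = 0"
  proof (rule ccontr)
    assume "dot X e e \<noteq> 0"
    then have pos: "dot X e e > 0" using dot_self_nonneg[of X e] by linarith
    define b where "b = dot X e (mv X D e) - l * dot X e e"
    have ineq: "0 \<le> t\<^sup>2 * b - 2 * t * dot X e e" for t
    proof -
      define g where "g = (\<lambda>x. f x - t * e x)"
      have "l * dot X g g \<le> dot X g (mv X D g)"
        by (rule ray) (use fo eo in \<open>simp add: g_def dot_lin\<close>)
      moreover have "dot X f (mv X D e) = dot X e (mv X D f)"
        using dot_mv_symmetric[where X = X and D = D and f = f and g = e, OF sym]
        by (simp add: dot_commute)
      moreover have "dot X e (mv X D f) = dot X e e + l * dot X e f"
      proof -
        have "dot X e (mv X D f) = dot X e (\<lambda>x. e x + l * f x)" by (rule dot_cong) (auto simp: e_def)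
        then show ?thesis by (simp only: dot_lin)
      qed
      ultimately show ?thesis
        unfolding g_def b_def
        by (simp add: dot_lin mv_diff mv_scale f1 l_def[symmetric] dot_commute[of X f e] algebra_simps power2_eq_square)
    qed
    have "b \<ge> 0" using ineq[of 1] pos by simp
    \<comment> \<open>The \<open>+ 1\<close> prevents division by 0 and still gives
      \<open>t * b \<le> dot X e e\<close>, so that the linear term outweighs the quadratic
      one.\<close>
    define t where "t = dot X e e / (b + 1)"
    have "t > 0" using pos \<open>b \<ge> 0\<close> by (simp add: t_def)
    have "t * b \<le> dot X e e" using \<open>b \<ge> 0\<close> pos by (simp add: t_def field_simps)
    then have "t * (t * b - 2 * dot X e e) < 0"
      using \<open>t > 0\<close> pos by (intro mult_pos_neg) auto
    then show False using ineq[of t] by (simp add: power2_eq_square algebra_simps)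
  qed
  then have "\<forall>x\<in>X. e x = 0" using fin by (simp add: dot_self_eq_0)
  then show thesis
    by (intro that[of f l] f1 fo ray) (auto simp: e_def)
qed

text \<open>Eigenvectors are added one at a time. The last clause of the induction hypothesis
  records that \<open>lam i\<close> bounds the quadratic form from below on the complement of the
  first i - 1 vectors; applied to the newly found vector, it shows that the list of eigenvalues
  stays sorted.\<close>

lemma sorted_eigenbasis_exists:
  fixes D :: "'v \<Rightarrow> 'v \<Rightarrow> real"
  assumes fin: "finite X" and sym: "\<And>x y. x \<in> X \<Longrightarrow> y \<in> X \<Longrightarrow> D x y = D y x"
  shows "\<exists>lam v. sorted_eigenbasis X D lam v"
proof -
  have "\<exists>lam v. orthonormal X m v \<and> (\<forall>i\<in>{1..m}. \<forall>x\<in>X. mv X D (v i) x = lam i * v i x) \<and>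
      (\<forall>i\<in>{1..m}. \<forall>j\<in>{1..m}. i \<le> j \<longrightarrow> lam i \<le> lam j) \<and>
      (\<forall>i\<in>{1..m}. \<forall>g. (\<forall>j\<in>{1..<i}. dot X (v j) g = 0) \<longrightarrow> lam i * dot X g g \<le> dot X g (mv X D g))"
    if "m \<le> card X" for m
    using that
  proof (induction m)
    case 0
    then show ?case by (simp add: orthonormal_def)
  next
    case (Suc m)
    then have "m \<le> card X" by simp
    from Suc.IH[OF this] obtain lam v where on: "orthonormal X m v"
      and eig': "\<forall>i\<in>{1..m}. \<forall>x\<in>X. mv X D (v i) x = lam i * v i x"
      and srt: "\<forall>i\<in>{1..m}. \<forall>j\<in>{1..m}. i \<le> j \<longrightarrow> lam i \<le> lam j"
      and ray: "\<forall>i\<in>{1..m}. \<forall>g. (\<forall>j\<in>{1..<i}. dot X (v j) g = 0) \<longrightarrow> lam i * dot X g g \<le> dot X g (mv X D g)"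
      by (elim exE conjE)
    have eig: "\<And>i x. i \<in> {1..m} \<Longrightarrow> x \<in> X \<Longrightarrow> mv X D (v i) x = lam i * v i x"
      using eig' by blast
    obtain f l where f: "dot X f f = 1" "\<And>i. i \<in> {1..m} \<Longrightarrow> dot X (v i) f = 0"
      "\<And>x. x \<in> X \<Longrightarrow> mv X D f x = l * f x"
      "\<And>g. (\<And>i. i \<in> {1..m} \<Longrightarrow> dot X (v i) g = 0) \<Longrightarrow> l * dot X g g \<le> dot X g (mv X D g)"
      using rayleigh_minimiser[OF fin sym on _ eig] Suc.prems by (metis Suc_le_lessD)
    have le: "lam i \<le> l" if i: "i \<in> {1..m}" for i
    proof -
      have "lam i * dot X f f \<le> dot X f (mv X D f)" using i f(2) by (intro ray[rule_format]) auto
      also have "dot X f (mv X D f) = dot X f (\<lambda>x. l * f x)" by (rule dot_cong) (use f(3) in auto)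
      finally show ?thesis by (simp add: dot_lin f(1))
    qed
    define v' where "v' = v(Suc m := f)"
    define lam' where "lam' = lam(Suc m := l)"
    have old: "v' i = v i" "lam' i = lam i" if "i \<in> {1..m}" for i
      using that by (auto simp: v'_def lam'_def)
    have new: "v' (Suc m) = f" "lam' (Suc m) = l" by (auto simp: v'_def lam'_def)
    have split: "{1..Suc m} = insert (Suc m) {1..m}" by auto
    have "orthonormal X (Suc m) v'"
      using on f(1,2) unfolding orthonormal_def split
      by (auto simp: old new dot_commute[of X f "v _"])
    moreover have "\<forall>i\<in>{1..Suc m}. \<forall>x\<in>X. mv X D (v' i) x = lam' i * v' i x"
      unfolding split using eig f(3) by (auto simp: old new)
    moreover have "\<forall>i\<in>{1..Suc m}. \<forall>j\<in>{1..Suc m}. i \<le> j \<longrightarrow> lam' i \<le> lam' j"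
      unfolding split using srt le by (auto simp: old new)
    moreover have "\<forall>i\<in>{1..Suc m}. \<forall>g. (\<forall>j\<in>{1..<i}. dot X (v' j) g = 0) \<longrightarrow> lam' i * dot X g g \<le> dot X g (mv X D g)"
    proof (intro ballI allI impI)
      fix i g assume i: "i \<in> {1..Suc m}" and g: "\<forall>j\<in>{1..<i}. dot X (v' j) g = 0"
      have g': "\<forall>j\<in>{1..<i}. dot X (v j) g = 0" using g i old(1) by auto
      show "lam' i * dot X g g \<le> dot X g (mv X D g)"
      proof (cases "i = Suc m")
        case True
        then show ?thesis using f(4)[of g] g' by (auto simp: new)
      next
        case False
        then have i': "i \<in> {1..m}" using i by auto
        show ?thesis using ray[rule_format, OF i', of g] g' old[OF i'] by simp
      qed
    qed
    ultimately show ?case by blast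
  qed
  from this[OF order_refl] obtain lam v where "orthonormal X (card X) v"
    "\<forall>i\<in>{1..card X}. \<forall>x\<in>X. mv X D (v i) x = lam i * v i x"
    "\<forall>i\<in>{1..card X}. \<forall>j\<in>{1..card X}. i \<le> j \<longrightarrow> lam i \<le> lam j"
    by (elim exE conjE)
  then have "sorted_eigenbasis X D lam v"
    by (simp add: sorted_eigenbasis_def orthonormal_def dot_def mv_def)
  then show ?thesis by (intro exI)
qed

section \<open>The interpolated chain\<close>

locale marked_chain =
  fixes X :: "'v set" and P :: "'v \<Rightarrow> 'v \<Rightarrow> real" and \<pi> :: "'v \<Rightarrow> real" and M :: "'v set"
  assumes reversible: "reversible_chain X P \<pi>" and M_proper: "M \<subset> X" and M_nonempty: "M \<noteq> {}"
begin

section \<open>Irreducibility and positivity of the stationary distribution\<close>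

lemma fin: "finite X"
  and P_nonneg: "x \<in> X \<Longrightarrow> y \<in> X \<Longrightarrow> 0 \<le> P x y"
  and P_sum: "x \<in> X \<Longrightarrow> (\<Sum>y\<in>X. P x y) = 1"
  and pi_nonneg: "x \<in> X \<Longrightarrow> 0 \<le> \<pi> x"
  and pi_sum: "(\<Sum>x\<in>X. \<pi> x) = 1"
  and detailed_balance: "x \<in> X \<Longrightarrow> y \<in> X \<Longrightarrow> \<pi> x * P x y = \<pi> y * P y x"
  using reversible
  by (auto simp: reversible_chain_def ergodic_chain_def markov_chain_def stationary_dist_def)

text \<open>Irreducibility as an induction principle: a property inherited along transitions of
  positive probability spreads from one vertex to all. It serves for the positivity of the
  stationary distribution and for the constancy of harmonic functions.\<close>

lemma chain_propagate:
  assumes step: "\<And>x y. x \<in> X \<Longrightarrow> y \<in> X \<Longrightarrow> Q x \<Longrightarrow> 0 < P x y \<Longrightarrow> Q y"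
    and "x \<in> X" "y \<in> X" "Q x"
  shows "Q y"
proof -
  have pow_nonneg: "0 \<le> chain_pow X P m x y" if "x \<in> X" "y \<in> X" for m x y
    using that by (induction m arbitrary: x) (auto intro!: sum_nonneg mult_nonneg_nonneg P_nonneg)
  have "0 < chain_pow X P m x y \<Longrightarrow> x \<in> X \<Longrightarrow> Q x \<Longrightarrow> Q y" for m
  proof (induction m arbitrary: x)
    case 0
    then show ?case by (simp split: if_splits)
  next
    case (Suc m)
    have "\<exists>u\<in>X. 0 < P x u * chain_pow X P m u y"
    proof (rule ccontr)
      assume "\<not> ?thesis"
      then have "(\<Sum>u\<in>X. P x u * chain_pow X P m u y) \<le> 0"
        by (intro sum_nonpos) (auto simp: not_less)
      then show False using Suc.prems by simp
    qed
    then obtain u where u: "u \<in> X" "0 < P x u * chain_pow X P m u y" by blast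
    then have "0 < P x u" "0 < chain_pow X P m u y"
      using P_nonneg[OF Suc.prems(2) u(1)] pow_nonneg[OF u(1) assms(3), of m]
      by (auto simp: zero_less_mult_iff)
    then show ?case using Suc.IH u(1) step[OF Suc.prems(2) u(1) Suc.prems(3)] by blast
  qed
  moreover obtain m where "0 < chain_pow X P m x y"
    using reversible assms(2,3)
    unfolding reversible_chain_def ergodic_chain_def irreducible_chain_def by blast
  ultimately show ?thesis using assms(2,4) by blast
qed

lemma pi_pos:
  assumes "x \<in> X"
  shows "0 < \<pi> x"
proof -
  have "\<exists>x0\<in>X. 0 < \<pi> x0"
  proof (rule ccontr)
    assume "\<not> ?thesis"
    then have "(\<Sum>x\<in>X. \<pi> x) \<le> 0" by (intro sum_nonpos) (auto simp: not_less)
    then show False using pi_sum by simp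
  qed
  then obtain x0 where x0: "x0 \<in> X" "0 < \<pi> x0" by blast
  show ?thesis
  proof (rule chain_propagate[where Q = "\<lambda>x. 0 < \<pi> x", OF _ x0(1) assms x0(2)])
    fix x y assume "x \<in> X" "y \<in> X" "0 < \<pi> x" "0 < P x y"
    then have "0 < \<pi> y * P y x" using detailed_balance[of x y] by (metis mult_pos_pos)
    then show "0 < \<pi> y" using pi_nonneg[OF \<open>y \<in> X\<close>] by (auto simp: zero_less_mult_iff)
  qed
qed

abbreviation pM :: real where "pM \<equiv> marked_mass \<pi> M"

lemma fin_M: "finite M"
  using fin M_proper by (meson finite_subset psubset_imp_subset)

lemma sum_split: "(\<Sum>x\<in>X. f x) = (\<Sum>x\<in>M. f x) + (\<Sum>x\<in>X - M. f x)" for f :: "'v \<Rightarrow> real"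
  using fin M_proper by (metis add.commute psubset_imp_subset sum.subset_diff)

lemma unmarked_mass: "(\<Sum>x\<in>X - M. \<pi> x) = 1 - pM"
  using sum_split[of \<pi>] pi_sum by (simp add: marked_mass_def)

lemma pM_pos: "0 < pM"
  unfolding marked_mass_def using fin_M M_nonempty M_proper by (intro sum_pos) (auto intro: pi_pos)

lemma pM_less_1: "pM < 1"
proof -
  have "0 < (\<Sum>x\<in>X - M. \<pi> x)"
    using fin M_proper by (intro sum_pos) (auto intro: pi_pos)
  then show ?thesis by (simp add: unmarked_mass)
qed

section \<open>The discriminant and its spectrum\<close>

definition disc :: "'v \<Rightarrow> 'v \<Rightarrow> real" where
  "disc x y = sqrt (P x y * P y x)"

definition scal :: "real \<Rightarrow> 'v \<Rightarrow> real" where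
  "scal s x = (if x \<in> M then sqrt (1 - s) else 1)"

lemma scal_pos: "s < 1 \<Longrightarrow> 0 < scal s x"
  by (simp add: scal_def)

lemma scal_0: "scal 0 x = 1"
  by (simp add: scal_def)

text \<open>P(s) multiplies the off-diagonal entries of a marked row by 1 - s, and the geometric
  mean of the two directions turns this into a factor \<open>sqrt (1 - s)\<close> per marked end
  point. A marked diagonal entry is \<open>(1 - s) * P x x + s\<close>, whence the extra
  summand.\<close>

lemma discriminant_eq:
  assumes "0 \<le> s" "s \<le> 1" "x \<in> X" "y \<in> X"
  shows "discriminant P M s x y = scal s x * scal s y * disc x y + (if x \<in> M \<and> x = y then s else 0)"
proof (cases "x = y \<and> x \<in> M")
  case True
  have "interpolated P M s x x \<ge> 0"
    using assms True P_nonneg[of x x] by (simp add: interpolated_def absorbing_def)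
  moreover have "y = x" "x \<in> M" using True by auto
  ultimately show ?thesis using assms(1,2) P_nonneg[OF assms(3,3)]
    by (simp add: discriminant_def interpolated_def absorbing_def scal_def disc_def)
next
  case False
  have "interpolated P M s x y = (scal s x)\<^sup>2 * P x y" "interpolated P M s y x = (scal s y)\<^sup>2 * P y x"
    using False assms by (auto simp: interpolated_def absorbing_def scal_def algebra_simps)
  then show ?thesis using False assms
    by (auto simp: discriminant_def disc_def real_sqrt_mult scal_def)
qed

lemma discriminant_sym: "discriminant P M s x y = discriminant P M s y x"
  by (simp add: discriminant_def mult.commute)

text \<open>Detailed balance under the square root: the discriminant at s = 0 is P conjugated by the
  diagonal matrix of the \<open>sqrt (\<pi> x)\<close>.\<close>

lemma disc_sqrt_pi:
  assumes "x \<in> X" "y \<in> X"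
  shows "disc x y * sqrt (\<pi> y) = sqrt (\<pi> x) * P x y"
proof -
  have "disc x y * sqrt (\<pi> y) = sqrt (P x y * (\<pi> y * P y x))"
    by (simp add: disc_def real_sqrt_mult mult.commute mult.left_commute)
  also have "\<dots> = sqrt (\<pi> x * (P x y)\<^sup>2)"
    by (simp add: detailed_balance[OF assms, symmetric] power2_eq_square mult.left_commute)
  also have "\<dots> = sqrt (\<pi> x) * P x y"
    using P_nonneg[OF assms] by (simp add: real_sqrt_mult)
  finally show ?thesis .
qed

text \<open>\<open>\<sigma> = -1\<close> bounds the spectrum of the discriminant by 1 from above, \<open>\<sigma> = 1\<close> by -1 from below.\<close>

lemma dirichlet_form:
  assumes "\<sigma> * \<sigma> = 1"
  shows "(\<Sum>x\<in>X. \<Sum>y\<in>X. \<pi> x * P x y * (f x / sqrt (\<pi> x) + \<sigma> * (f y / sqrt (\<pi> y)))\<^sup>2)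
    = 2 * (dot X f f + \<sigma> * dot X f (mv X disc f))"
proof -
  have summand: "\<pi> x * P x y * (f x / sqrt (\<pi> x) + \<sigma> * (f y / sqrt (\<pi> y)))\<^sup>2
      = P x y * (f x * f x) + P y x * (f y * f y) + 2 * \<sigma> * (f x * (disc x y * f y))"
    if xy: "x \<in> X" "y \<in> X" for x y
  proof -
    have px: "0 < \<pi> x" "0 < \<pi> y" using pi_pos xy by auto
    define a where "a = sqrt (\<pi> x)"
    define b where "b = sqrt (\<pi> y)"
    have ab: "a > 0" "b > 0" "\<pi> x = a * a" "\<pi> y = b * b" using px by (auto simp: a_def b_def)
    have d: "disc x y = a * P x y / b"
      using disc_sqrt_pi[OF xy, folded a_def b_def] ab(1,2) by (simp add: field_simps)
    have e: "P y x = a * a * P x y / (b * b)"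
      using detailed_balance[OF xy] ab by (simp add: field_simps)
    have s2: "\<sigma>\<^sup>2 = 1" using assms by (simp add: power2_eq_square)
    have "(f x / a + \<sigma> * (f y / b))\<^sup>2 = (f x / a)\<^sup>2 + 2 * \<sigma> * (f x / a) * (f y / b) + \<sigma>\<^sup>2 * (f y / b)\<^sup>2"
      by (simp add: power2_eq_square algebra_simps)
    then show ?thesis
      unfolding a_def[symmetric] b_def[symmetric] d e ab(3) s2
      using ab(1,2) assms by (simp add: power2_eq_square field_simps)
  qed
  have s1: "(\<Sum>x\<in>X. \<Sum>y\<in>X. P x y * (f x * f x)) = dot X f f"
    by (simp add: sum_distrib_right[symmetric] P_sum dot_def)
  have s2: "(\<Sum>x\<in>X. \<Sum>y\<in>X. P y x * (f y * f y)) = dot X f f"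
    by (subst sum.swap) (rule s1)
  have s3: "(\<Sum>x\<in>X. \<Sum>y\<in>X. 2 * \<sigma> * (f x * (disc x y * f y))) = 2 * \<sigma> * dot X f (mv X disc f)"
    by (simp add: dot_def mv_def sum_distrib_left)
  have "(\<Sum>x\<in>X. \<Sum>y\<in>X. \<pi> x * P x y * (f x / sqrt (\<pi> x) + \<sigma> * (f y / sqrt (\<pi> y)))\<^sup>2)
      = (\<Sum>x\<in>X. \<Sum>y\<in>X. P x y * (f x * f x) + P y x * (f y * f y) + 2 * \<sigma> * (f x * (disc x y * f y)))"
    by (intro sum.cong refl summand)
  also have "\<dots> = 2 * (dot X f f + \<sigma> * dot X f (mv X disc f))"
    unfolding sum.distrib s1 s2 s3 by (simp add: algebra_simps)
  finally show ?thesis .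
qed

lemma disc_form_bound:
  assumes "\<sigma> * \<sigma> = 1"
  shows "0 \<le> dot X f f + \<sigma> * dot X f (mv X disc f)"
proof -
  have "0 \<le> (\<Sum>x\<in>X. \<Sum>y\<in>X. \<pi> x * P x y * (f x / sqrt (\<pi> x) + \<sigma> * (f y / sqrt (\<pi> y)))\<^sup>2)"
    by (intro sum_nonneg mult_nonneg_nonneg pi_nonneg P_nonneg) auto
  then show ?thesis unfolding dirichlet_form[OF assms] by simp
qed

text \<open>For such an \<open>f\<close> the Dirichlet form with sign -1 is 0. Its summands are
  nonnegative, so \<open>f x / sqrt (\<pi> x)\<close> takes equal values at the ends of every
  transition of positive probability, and irreducibility makes it constant.\<close>

lemma disc_kernel:
  assumes "\<And>x. x \<in> X \<Longrightarrow> mv X disc f x = f x"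
  obtains c where "\<And>x. x \<in> X \<Longrightarrow> f x = c * sqrt (\<pi> x)"
proof -
  have "dot X f (mv X disc f) = dot X f f" by (rule dot_cong) (use assms in auto)
  moreover define F where "F = (\<lambda>x y. \<pi> x * P x y * (f x / sqrt (\<pi> x) + (-1) * (f y / sqrt (\<pi> y)))\<^sup>2)"
  ultimately have sum0: "(\<Sum>x\<in>X. \<Sum>y\<in>X. F x y) = 0"
    unfolding F_def by (subst dirichlet_form) auto
  have nn: "0 \<le> F x y" if "x \<in> X" "y \<in> X" for x y
    unfolding F_def using pi_nonneg P_nonneg that by (intro mult_nonneg_nonneg) auto
  have "(\<Sum>y\<in>X. F x y) = 0" if "x \<in> X" for x
    using sum0 fin that nn sum_nonneg_eq_0_iff[of X "\<lambda>x. \<Sum>y\<in>X. F x y"] by (simp add: sum_nonneg)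
  then have "F x y = 0" if "x \<in> X" "y \<in> X" for x y
    using fin that nn sum_nonneg_eq_0_iff[of X "F x"] by simp
  then have "\<pi> x * P x y * (f x / sqrt (\<pi> x) - f y / sqrt (\<pi> y))\<^sup>2 = 0"
    if "x \<in> X" "y \<in> X" for x y
    using that by (simp add: F_def)
  then have step: "f x / sqrt (\<pi> x) = f y / sqrt (\<pi> y)" if "x \<in> X" "y \<in> X" "0 < P x y" for x y
    using that pi_pos[of x] by fastforce
  obtain x0 where x0: "x0 \<in> X" using M_proper by blast
  have "f x / sqrt (\<pi> x) = f x0 / sqrt (\<pi> x0)" if "x \<in> X" for x
    by (rule chain_propagate[where Q = "\<lambda>x. f x / sqrt (\<pi> x) = f x0 / sqrt (\<pi> x0)", OF _ x0 that])
      (use step in auto)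
  then have "f x0 / sqrt (\<pi> x0) * sqrt (\<pi> x) = f x" if "x \<in> X" for x
    using pi_pos[OF that] that by (metis less_irrefl nonzero_eq_divide_eq real_sqrt_gt_0_iff)
  then show thesis by (metis that)
qed

text \<open>The factorisation \<open>I - D(s) = S (I - D) S\<close> with \<open>S = scal s\<close> diagonal reduces everything to \<open>s = 0\<close>.\<close>

lemma one_minus_discriminant:
  assumes "0 \<le> s" "s < 1" "x \<in> X"
  shows "f x - mv X (discriminant P M s) f x
    = scal s x * (scal s x * f x - mv X disc (\<lambda>y. scal s y * f y) x)"
proof -
  have "mv X (discriminant P M s) f x
      = (\<Sum>y\<in>X. scal s x * (disc x y * (scal s y * f y)) + (if y = x then (if x \<in> M then s * f x else 0) else 0))"
    unfolding mv_def using assms by (intro sum.cong) (auto simp: discriminant_eq algebra_simps)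
  also have "\<dots> = scal s x * mv X disc (\<lambda>y. scal s y * f y) x + (if x \<in> M then s * f x else 0)"
    using fin assms by (simp add: sum.distrib sum_distrib_left mv_def)
  finally show ?thesis
    using assms by (simp add: algebra_simps) (simp add: scal_def algebra_simps)
qed

lemma discriminant_upper:
  assumes "0 \<le> s" "s < 1"
  shows "dot X f (mv X (discriminant P M s) f) \<le> dot X f f"
proof -
  let ?g = "\<lambda>y. scal s y * f y"
  have "dot X f f - dot X f (mv X (discriminant P M s) f)
      = dot X f (\<lambda>x. scal s x * (scal s x * f x - mv X disc ?g x))"
    unfolding dot_diff_right[symmetric]
    by (rule dot_cong) (use one_minus_discriminant[OF assms] in auto)
  also have "\<dots> = dot X ?g ?g - dot X ?g (mv X disc ?g)"
    by (simp add: dot_def sum_subtractf[symmetric] algebra_simps)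
  finally show ?thesis using disc_form_bound[of "-1" ?g] by simp
qed

text \<open>Here I + D(s) = 2 (I - S^2) + S (I + D) S, where the first summand is nonnegative
  because the entries of S are at most 1 and the second by the Dirichlet form with sign 1.\<close>

lemma discriminant_lower:
  assumes "0 \<le> s" "s < 1"
  shows "- dot X f f \<le> dot X f (mv X (discriminant P M s) f)"
proof -
  let ?g = "\<lambda>y. scal s y * f y"
  have "dot X f f + dot X f (mv X (discriminant P M s) f)
      = dot X f (\<lambda>x. 2 * f x - scal s x * (scal s x * f x - mv X disc ?g x))"
    unfolding dot_add_right[symmetric]
    by (rule dot_cong) (use one_minus_discriminant[OF assms] in \<open>auto simp: algebra_simps\<close>)
  also have "\<dots> = (\<Sum>x\<in>X. 2 * (1 - (scal s x)\<^sup>2) * (f x)\<^sup>2) + (dot X ?g ?g + dot X ?g (mv X disc ?g))"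
    by (simp add: dot_def sum.distrib[symmetric] algebra_simps power2_eq_square)
  also have "0 \<le> \<dots>"
  proof (rule add_nonneg_nonneg)
    show "0 \<le> (\<Sum>x\<in>X. 2 * (1 - (scal s x)\<^sup>2) * (f x)\<^sup>2)"
      using assms by (intro sum_nonneg mult_nonneg_nonneg) (auto simp: scal_def)
    show "0 \<le> dot X ?g ?g + dot X ?g (mv X disc ?g)"
      using disc_form_bound[of 1 ?g] by simp
  qed
  finally show ?thesis by linarith
qed

text \<open>
  The unit eigenvector \<open>|v\<^sub>n(s)\<rangle>\<close> is \<open>principal s\<close>; it equals \<open>cos \<theta> |U\<rangle> + sin \<theta> |M\<rangle>\<close> with
  \<open>cos \<theta> = cosine s\<close> and \<open>sin\<^sup>2 \<theta> = sin2 s\<close>.  The component \<open>rest s\<close> of \<open>|U\<rangle>\<close> orthogonal to it is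
  \<open>sin\<^sup>2 \<theta> S contrast\<close>, where \<open>contrast\<close> does not depend on \<open>s\<close>.
\<close>

definition qs :: "real \<Rightarrow> real" where
  "qs s = 1 - s * (1 - pM)"

definition sin2 :: "real \<Rightarrow> real" where
  "sin2 s = pM / qs s"

definition principal :: "real \<Rightarrow> 'v \<Rightarrow> real" where
  "principal s x = sqrt (1 - s) / sqrt (qs s) * (sqrt (\<pi> x) / scal s x)"

definition cosine :: "real \<Rightarrow> real" where
  "cosine s = sqrt (1 - s) * sqrt (1 - pM) / sqrt (qs s)"

definition rest :: "real \<Rightarrow> 'v \<Rightarrow> real" where
  "rest s x = unmarked_state \<pi> M x - cosine s * principal s x"

definition contrast :: "'v \<Rightarrow> real" where
  "contrast x = (if x \<in> M then - sqrt (\<pi> x) * sqrt (1 - pM) / pM else sqrt (\<pi> x) / sqrt (1 - pM))"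

lemma qs_eq: "qs s = pM + (1 - s) * (1 - pM)"
  by (simp add: qs_def algebra_simps)

lemma qs_pos: "s < 1 \<Longrightarrow> 0 < qs s"
  unfolding qs_eq using pM_pos pM_less_1 by (simp add: add_pos_pos)

lemma scal_top:
  assumes "s < 1"
  shows "scal s x * principal s x = sqrt (1 - s) / sqrt (qs s) * sqrt (\<pi> x)"
  using scal_pos[OF assms, of x] by (simp add: principal_def)

lemma mv_disc_sqrt_pi: "x \<in> X \<Longrightarrow> mv X disc (\<lambda>y. sqrt (\<pi> y)) x = sqrt (\<pi> x)"
  using P_sum by (simp add: mv_def disc_sqrt_pi sum_distrib_left[symmetric])

lemma top_eigenvector:
  assumes "0 \<le> s" "s < 1" "x \<in> X"
  shows "mv X (discriminant P M s) (principal s) x = principal s x"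
proof -
  have "mv X disc (\<lambda>y. scal s y * principal s y) x = scal s x * principal s x"
    unfolding scal_top[OF assms(2)] mv_scale mv_disc_sqrt_pi[OF assms(3)] ..
  then show ?thesis using one_minus_discriminant[OF assms, of "principal s"] by simp
qed

lemma top_sq: "s < 1 \<Longrightarrow> x \<in> X \<Longrightarrow> (principal s x)\<^sup>2 = (if x \<in> M then \<pi> x / qs s else (1 - s) * \<pi> x / qs s)"
  using qs_pos[of s] pi_nonneg[of x]
  by (auto simp: principal_def scal_def power_mult_distrib power_divide)

lemma top_marked_mass:
  assumes "s < 1"
  shows "(\<Sum>x\<in>M. (principal s x)\<^sup>2) = sin2 s"
proof -
  have "(\<Sum>x\<in>M. (principal s x)\<^sup>2) = (\<Sum>x\<in>M. \<pi> x / qs s)"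
    using M_proper by (intro sum.cong) (auto simp: top_sq[OF assms])
  then show ?thesis by (simp add: sum_divide_distrib[symmetric] sin2_def marked_mass_def)
qed

lemma top_norm:
  assumes "s < 1"
  shows "dot X (principal s) (principal s) = 1"
proof -
  have "(\<Sum>x\<in>X - M. (principal s x)\<^sup>2) = (\<Sum>x\<in>X - M. (1 - s) / qs s * \<pi> x)"
    by (intro sum.cong) (auto simp: top_sq[OF assms])
  also have "\<dots> = (1 - s) / qs s * (1 - pM)"
    by (simp only: sum_distrib_left[symmetric] unmarked_mass)
  finally have "dot X (principal s) (principal s) = sin2 s + (1 - s) / qs s * (1 - pM)"
    unfolding dot_def power2_eq_square[symmetric] sum_split top_marked_mass[OF assms] by simp
  then show ?thesis
    using qs_pos[OF assms] unfolding sin2_def qs_eq by (simp add: add_divide_distrib[symmetric])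
qed

lemma unmarked_norm: "dot X (unmarked_state \<pi> M) (unmarked_state \<pi> M) = 1"
proof -
  have "dot X (unmarked_state \<pi> M) (unmarked_state \<pi> M) = (\<Sum>x\<in>X - M. \<pi> x / (1 - pM))"
    unfolding dot_def sum_split using pi_nonneg pM_less_1
    by (auto simp: unmarked_state_def intro!: sum.cong)
  then show ?thesis
    using pM_less_1 by (simp add: sum_divide_distrib[symmetric] unmarked_mass)
qed

lemma unmarked_top:
  assumes "s < 1"
  shows "dot X (unmarked_state \<pi> M) (principal s) = cosine s"
proof -
  have "dot X (unmarked_state \<pi> M) (principal s)
      = (\<Sum>x\<in>X - M. sqrt (1 - s) / (sqrt (qs s) * sqrt (1 - pM)) * \<pi> x)"
  proof -
    have "unmarked_state \<pi> M x * principal s x = sqrt (1 - s) / (sqrt (qs s) * sqrt (1 - pM)) * (sqrt (\<pi> x) * sqrt (\<pi> x))"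
      if "x \<in> X - M" for x
      using that by (simp add: unmarked_state_def principal_def scal_def mult.left_commute)
    moreover have "(\<Sum>x\<in>M. unmarked_state \<pi> M x * principal s x) = 0"
      by (simp add: unmarked_state_def)
    ultimately show ?thesis unfolding dot_def sum_split using pi_nonneg
      by (auto intro!: sum.cong)
  qed
  also have "\<dots> = sqrt (1 - s) / (sqrt (qs s) * sqrt (1 - pM)) * (1 - pM)"
    by (simp only: sum_distrib_left[symmetric] unmarked_mass)
  also have "\<dots> = cosine s"
    using pM_less_1 by (simp add: cosine_def divide_simps)
  finally show ?thesis .
qed

lemma cosine_sq:
  assumes "s < 1"
  shows "(cosine s)\<^sup>2 = 1 - sin2 s"
proof -
  have "(cosine s)\<^sup>2 = (1 - s) * (1 - pM) / qs s"
    using assms pM_less_1 qs_pos[OF assms] by (simp add: cosine_def power_mult_distrib power_divide)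
  also have "\<dots> = 1 - sin2 s"
    using qs_pos[OF assms] unfolding sin2_def by (simp add: qs_eq divide_simps)
  finally show ?thesis .
qed

lemma rest_eq_contrast:
  assumes "s < 1"
  shows "rest s x = sin2 s * (scal s x * contrast x)"
proof (cases "x \<in> M")
  case True
  have q: "0 < qs s" "sqrt (qs s) * sqrt (qs s) = qs s" using qs_pos[OF assms] by auto
  have s: "0 < sqrt (1 - s)" using assms by simp
  have "rest s x = - (sqrt (1 - s) * sqrt (1 - pM) * sqrt (\<pi> x) / (sqrt (qs s) * sqrt (qs s)))"
    using True s by (simp add: rest_def unmarked_state_def cosine_def principal_def scal_def)
  then show ?thesis using True pM_pos unfolding q
    by (simp add: sin2_def scal_def contrast_def)
next
  case False
  have q: "0 < qs s" "sqrt (qs s) * sqrt (qs s) = qs s" using qs_pos[OF assms] by auto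
  define b where "b = sqrt (1 - pM)"
  have b: "b > 0" "b * b = 1 - pM" using pM_less_1 by (auto simp: b_def)
  have t: "sqrt (1 - s) * sqrt (1 - s) = 1 - s" using assms by simp
  have "rest s x = sqrt (\<pi> x) / b - (sqrt (1 - s) * sqrt (1 - s)) * b * sqrt (\<pi> x) / (sqrt (qs s) * sqrt (qs s))"
    using False by (simp add: rest_def unmarked_state_def cosine_def principal_def scal_def b_def)
  also have "\<dots> = sqrt (\<pi> x) / b * (qs s - (1 - s) * (b * b)) / qs s"
    unfolding q t using b q(1) by (simp add: field_simps)
  also have "qs s - (1 - s) * (b * b) = pM" by (simp add: b qs_eq)
  finally show ?thesis using False
    by (simp add: sin2_def scal_def contrast_def b_def mult.commute)
qed

text \<open>Up to the factor 1 / (pM sqrt(1 - pM)), \<open>contrast\<close> is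
  \<open>sqrt (\<pi> x)\<close> times the indicator of the unmarked vertices minus its stationary
  mean. The orthogonality is the solvability condition of the Poisson equation at s = 0.\<close>

lemma contrast_top: "dot X contrast (principal 0) = 0"
proof -
  have "dot X contrast (principal 0) = dot X contrast (\<lambda>x. sqrt (\<pi> x))"
    by (rule dot_cong) (auto simp: principal_def scal_def qs_def)
  also have "\<dots> = (\<Sum>x\<in>M. - (sqrt (1 - pM) / pM) * \<pi> x) + (\<Sum>x\<in>X - M. \<pi> x / sqrt (1 - pM))"
    unfolding dot_def sum_split using pi_nonneg M_proper
    by (intro arg_cong2[where f = "(+)"] sum.cong) (auto simp: contrast_def subset_iff psubset_eq)
  also have "\<dots> = - (sqrt (1 - pM) / pM) * pM + (1 - pM) / sqrt (1 - pM)"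
    by (simp only: sum_distrib_left[symmetric] sum_divide_distrib[symmetric] unmarked_mass)
      (simp only: marked_mass_def)
  also have "\<dots> = 0" using pM_pos pM_less_1 by (simp add: real_div_sqrt)
  finally show ?thesis .
qed

text \<open>Two facts determine the position of the top eigenvector. An eigenvector for 1 is a
  multiple of \<open>principal s\<close>, and by symmetry any eigenvector not orthogonal to
  \<open>principal s\<close> has eigenvalue 1. Some basis vector is of the latter kind, so sorting
  puts 1 at the last index; the other basis vectors are orthogonal to that one, which keeps their
  eigenvalues below 1.\<close>

lemma eigenbasis_top:
  assumes s: "0 \<le> s" "s < 1" and eb: "sorted_eigenbasis X (discriminant P M s) lam v"
  shows "orthonormal X (card X) v"
    and "k \<in> {1..card X} \<Longrightarrow> x \<in> X \<Longrightarrow> mv X (discriminant P M s) (v k) x = lam k * v k x"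
    and "k \<in> {1..card X} \<Longrightarrow> -1 \<le> lam k \<and> lam k \<le> 1"
    and "k \<in> {1..card X - 1} \<Longrightarrow> lam k < 1"
    and "k \<in> {1..card X - 1} \<Longrightarrow> dot X (v k) (principal s) = 0"
    and "\<exists>c. \<forall>x\<in>X. v (card X) x = c * principal s x"
proof -
  let ?D = "discriminant P M s"
  let ?n = "card X"
  show on: "orthonormal X ?n v"
    using eb by (simp add: sorted_eigenbasis_def orthonormal_def dot_def)
  have eig: "mv X ?D (v k) x = lam k * v k x" if "k \<in> {1..?n}" "x \<in> X" for k x
    using eb that by (simp add: sorted_eigenbasis_def mv_def)
  then show "k \<in> {1..?n} \<Longrightarrow> x \<in> X \<Longrightarrow> mv X ?D (v k) x = lam k * v k x" .
  have n: "?n \<ge> 1" using M_proper fin by (metis Suc_leI One_nat_def card_gt_0_iff empty_iff psubsetE subset_empty)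
  have nin: "?n \<in> {1..?n}" using n by auto
  have norm: "dot X (v k) (v k) = 1" if "k \<in> {1..?n}" for k
    using on that by (simp add: orthonormal_def)
  have ray: "dot X (v k) (mv X ?D (v k)) = lam k" if k: "k \<in> {1..?n}" for k
  proof -
    have "dot X (v k) (mv X ?D (v k)) = dot X (v k) (\<lambda>x. lam k * v k x)"
      by (rule dot_cong) (use eig k in auto)
    then show ?thesis using norm[OF k] by (simp add: dot_scale_right)
  qed
  have bounds: "-1 \<le> lam k \<and> lam k \<le> 1" if "k \<in> {1..?n}" for k
    using discriminant_upper[OF s, of "v k"] discriminant_lower[OF s, of "v k"] ray[OF that] norm[OF that] by simp
  then show "k \<in> {1..?n} \<Longrightarrow> -1 \<le> lam k \<and> lam k \<le> 1" .
  \<comment> \<open>Multiplication by \<open>scal s\<close> carries an eigenvector of D(s) for 1 to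
    one of \<open>disc\<close>, where \<open>disc_kernel\<close> applies.\<close>
  have ker: "\<exists>c. \<forall>x\<in>X. v k x = c * principal s x" if k: "k \<in> {1..?n}" "lam k = 1" for k
  proof -
    have "mv X disc (\<lambda>y. scal s y * v k y) x = scal s x * v k x" if "x \<in> X" for x
      using one_minus_discriminant[OF s that, of "v k"] eig[OF k(1) that] k(2) scal_pos[OF s(2), of x] by simp
    then obtain c where c: "\<And>x. x \<in> X \<Longrightarrow> scal s x * v k x = c * sqrt (\<pi> x)"
      using disc_kernel[of "\<lambda>y. scal s y * v k y"] by blast
    define e where "e = sqrt (1 - s) / sqrt (qs s)"
    have e: "e > 0" using s qs_pos[of s] by (simp add: e_def)
    have "v k x = c / e * principal s x" if "x \<in> X" for x
    proof -
      have "scal s x * v k x = scal s x * (c / e * principal s x)"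
        using c[OF that] scal_top[OF s(2), of x, folded e_def] e by (simp add: mult.left_commute)
      then show ?thesis using scal_pos[OF s(2), of x] by (simp only: mult_cancel_left) simp
    qed
    then show ?thesis by blast
  qed
  have orth: "lam k = 1" if k: "k \<in> {1..?n}" "dot X (v k) (principal s) \<noteq> 0" for k
  proof -
    have "dot X (v k) (mv X ?D (principal s)) = dot X (mv X ?D (v k)) (principal s)"
      by (rule dot_mv_symmetric) (rule discriminant_sym)
    moreover have "dot X (v k) (mv X ?D (principal s)) = dot X (v k) (principal s)"
      by (rule dot_cong) (use top_eigenvector[OF s] in auto)
    moreover have "dot X (mv X ?D (v k)) (principal s) = dot X (\<lambda>x. lam k * v k x) (principal s)"
      by (rule dot_cong) (use eig k in auto)
    ultimately show ?thesis using k by (simp add: dot_scale_left)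
  qed
  \<comment> \<open>If all these products were 0, Parseval would give the unit vector
    \<open>principal s\<close> norm 0.\<close>
  have "\<exists>k\<in>{1..?n}. dot X (v k) (principal s) \<noteq> 0"
    using parseval[OF fin on, of "principal s" "principal s"] top_norm[OF s(2)] by (metis (no_types, lifting) mult_zero_left sum.neutral zero_neq_one)
  then obtain k0 where k0: "k0 \<in> {1..?n}" "lam k0 = 1" using orth by blast
  have "\<forall>i\<in>{1..?n}. \<forall>j\<in>{1..?n}. i \<le> j \<longrightarrow> lam i \<le> lam j"
    using eb unfolding sorted_eigenbasis_def by (elim conjE)
  from bspec[OF bspec[OF this k0(1)] nin] have "1 \<le> lam ?n" using k0 by simp
  then have "lam ?n = 1" using bounds[OF nin] by simp
  then obtain c where c: "\<And>x. x \<in> X \<Longrightarrow> v ?n x = c * principal s x" using ker[OF nin] by blast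
  then show "\<exists>c. \<forall>x\<in>X. v ?n x = c * principal s x" by blast
  have cdot: "dot X f (v ?n) = c * dot X f (principal s)" for f
    unfolding dot_scale_right[symmetric] by (rule dot_cong) (use c in auto)
  have zero: "dot X (v k) (principal s) = 0" if k: "k \<in> {1..?n - 1}" for k
  proof -
    have "k \<in> {1..?n}" "k \<noteq> ?n" using k n by auto
    then have "dot X (v k) (v ?n) = 0" using on nin by (simp add: orthonormal_def)
    moreover have "c \<noteq> 0" using norm[OF nin] cdot[of "v ?n"] by auto
    ultimately show ?thesis using cdot by simp
  qed
  then show "k \<in> {1..?n - 1} \<Longrightarrow> dot X (v k) (principal s) = 0" .
  show "lam k < 1" if k: "k \<in> {1..?n - 1}"
  proof (rule ccontr)
    assume "\<not> lam k < 1"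
    moreover have kn: "k \<in> {1..?n}" using k by auto
    ultimately have "lam k = 1" using bounds[OF kn] by simp
    then obtain c' where c': "\<And>x. x \<in> X \<Longrightarrow> v k x = c' * principal s x" using ker[OF kn] by blast
    have "dot X (v k) (v k) = c' * dot X (v k) (principal s)"
      unfolding dot_scale_right[symmetric] by (rule dot_cong) (use c' in auto)
    then show False using norm[OF kn] zero[OF k] by simp
  qed
qed

section \<open>The Poisson equation and the extended hitting time\<close>

lemma discriminant_basis_exists: "\<exists>lam v. sorted_eigenbasis X (discriminant P M s) lam v"
  by (rule sorted_eigenbasis_exists[OF fin discriminant_sym])

lemma card_X: "1 \<le> card X"
  using M_proper fin by (metis Suc_leI One_nat_def card_gt_0_iff empty_iff psubsetE subset_empty)

lemma sum_upto_card: "(\<Sum>k=1..card X. f k) = (\<Sum>k=1..card X - 1. f k) + f (card X)" for f :: "nat \<Rightarrow> real"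
proof -
  have "{1..card X} = insert (card X) {1..card X - 1}" using card_X by auto
  then show ?thesis using card_X by simp
qed

text \<open>I - D is inverted on the complement of its kernel by dividing the spectral coefficients
  by 1 - lam k. The coefficient of \<open>contrast\<close> at the top eigenvector is 0, so leaving
  out the last index loses nothing.\<close>

lemma poisson_equation: "\<exists>h. \<forall>x\<in>X. h x - mv X disc h x = contrast x"
proof -
  let ?n = "card X"
  obtain lam v where eb: "sorted_eigenbasis X (discriminant P M 0) lam v"
    using discriminant_basis_exists by blast
  have "(0::real) \<le> 0" "(0::real) < 1" by auto
  note T = eigenbasis_top[OF this eb]
  obtain c where c: "\<And>x. x \<in> X \<Longrightarrow> v ?n x = c * principal 0 x" using T(6) by blast
  have "dot X (v ?n) contrast = dot X (\<lambda>x. c * principal 0 x) contrast"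
    by (rule dot_cong) (use c in auto)
  then have last: "dot X (v ?n) contrast = 0"
    using contrast_top by (simp add: dot_scale_left dot_commute)
  define h where "h = (\<lambda>x. \<Sum>k=1..?n - 1. dot X (v k) contrast / (1 - lam k) * v k x)"
  have "h x - mv X disc h x = contrast x" if x: "x \<in> X" for x
  proof -
    have "h x - mv X disc h x = h x - mv X (discriminant P M 0) h x"
      using one_minus_discriminant[of 0 x h] x by (simp add: scal_0)
    also have "\<dots> = (\<Sum>k=1..?n - 1. dot X (v k) contrast / (1 - lam k) * (v k x - mv X (discriminant P M 0) (v k) x))"
      unfolding h_def mv_sum mv_scale right_diff_distrib sum_subtractf ..
    also have "\<dots> = (\<Sum>k=1..?n - 1. dot X (v k) contrast * v k x)"
    proof (rule sum.cong)
      fix k assume k: "k \<in> {1..?n - 1}"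
      then have "v k x - mv X (discriminant P M 0) (v k) x = (1 - lam k) * v k x"
        using T(2)[of k x] x by (auto simp: algebra_simps)
      then show "dot X (v k) contrast / (1 - lam k) * (v k x - mv X (discriminant P M 0) (v k) x)
          = dot X (v k) contrast * v k x"
        using T(4)[OF k] by simp
    qed simp
    also have "\<dots> = (\<Sum>k=1..?n. dot X (v k) contrast * v k x)"
      by (simp only: sum_upto_card last)
    also have "\<dots> = contrast x"
      by (rule orthonormal_expansion[OF fin T(1) x, symmetric])
    finally show ?thesis .
  qed
  then show ?thesis by blast
qed

text \<open>
  Since \<open>I - D(s) = S (I - D) S\<close>, the solution \<open>hit\<close> of the Poisson equation at \<open>s = 0\<close> gives
  \<open>(I - D(s))\<^sup>-\<^sup>1 rest s = sin\<^sup>2 \<theta> S\<^sup>-\<^sup>1 hit\<close>, and \<open>HT(s) = \<langle>rest s, resolvent s\<rangle>\<close> is \<open>sin\<^sup>4 \<theta>\<close> times a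
  constant, which is therefore the extended hitting time.
\<close>

definition hit :: "'v \<Rightarrow> real" where
  "hit = (SOME h. \<forall>x\<in>X. h x - mv X disc h x = contrast x)"

lemma hit: "x \<in> X \<Longrightarrow> hit x - mv X disc hit x = contrast x"
  using someI_ex[OF poisson_equation] by (simp add: hit_def)

definition resolvent :: "real \<Rightarrow> 'v \<Rightarrow> real" where
  "resolvent s x = sin2 s * (hit x / scal s x)"

lemma resolvent:
  assumes "0 \<le> s" "s < 1" "x \<in> X"
  shows "resolvent s x - mv X (discriminant P M s) (resolvent s) x = rest s x"
proof -
  have e: "scal s y * resolvent s y = sin2 s * hit y" for y
    using scal_pos[OF assms(2), of y] by (simp add: resolvent_def)
  have "resolvent s x - mv X (discriminant P M s) (resolvent s) x
      = scal s x * (sin2 s * (hit x - mv X disc hit x))"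
    by (simp add: one_minus_discriminant[OF assms] e mv_scale right_diff_distrib)
  then show ?thesis by (simp add: hit[OF assms(3)] rest_eq_contrast[OF assms(2)])
qed

lemma rest_resolvent:
  assumes "s < 1"
  shows "dot X (rest s) (resolvent s) = (sin2 s)\<^sup>2 * dot X contrast hit"
proof -
  have "dot X (rest s) (resolvent s) = dot X (\<lambda>x. sin2 s * contrast x) (\<lambda>x. sin2 s * hit x)"
    unfolding dot_def using scal_pos[OF assms]
    by (intro sum.cong) (auto simp: resolvent_def rest_eq_contrast[OF assms] less_le)
  then show ?thesis by (simp add: dot_lin power2_eq_square)
qed

text \<open>Symmetry of D(s) gives <v k, rest> = (1 - lam k) <v k, resolvent>, so each quotient
  equals <v k, rest> <v k, resolvent>. The missing term at the last index is 0 because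
  \<open>rest s\<close> is orthogonal to \<open>principal s\<close>, and Parseval sums the products.
  The value is free of the basis, which settles the choice made by \<open>SOME\<close> in
  \<open>interpolated_HT\<close>.\<close>

lemma HT_sum:
  assumes s: "0 \<le> s" "s < 1" and eb: "sorted_eigenbasis X (discriminant P M s) lam v"
  shows "(\<Sum>k=1..card X - 1. (dot X (v k) (unmarked_state \<pi> M))\<^sup>2 / (1 - lam k))
    = (sin2 s)\<^sup>2 * dot X contrast hit"
proof -
  let ?n = "card X" and ?u = "unmarked_state \<pi> M"
  note T = eigenbasis_top[OF s eb]
  have "(\<Sum>k=1..?n - 1. (dot X (v k) ?u)\<^sup>2 / (1 - lam k))
      = (\<Sum>k=1..?n - 1. dot X (v k) (rest s) * dot X (v k) (resolvent s))"
  proof (rule sum.cong)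
    fix k assume k: "k \<in> {1..?n - 1}"
    then have kn: "k \<in> {1..?n}" by auto
    have r: "dot X (v k) (rest s) = dot X (v k) ?u"
      unfolding rest_def using T(5)[OF k] by (simp add: dot_lin)
    have "dot X (v k) (rest s) = dot X (v k) (\<lambda>x. resolvent s x - mv X (discriminant P M s) (resolvent s) x)"
      by (rule dot_cong) (use resolvent[OF s] in auto)
    also have "\<dots> = dot X (v k) (resolvent s) - dot X (mv X (discriminant P M s) (v k)) (resolvent s)"
      using dot_mv_symmetric[where D = "discriminant P M s" and X = X and f = "v k" and g = "resolvent s"]
        discriminant_sym by (simp add: dot_lin)
    also have "dot X (mv X (discriminant P M s) (v k)) (resolvent s) = dot X (\<lambda>x. lam k * v k x) (resolvent s)"
      by (rule dot_cong) (use T(2)[OF kn] in auto)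
    finally have "dot X (v k) (rest s) = (1 - lam k) * dot X (v k) (resolvent s)"
      by (simp add: dot_lin algebra_simps)
    then show "(dot X (v k) ?u)\<^sup>2 / (1 - lam k) = dot X (v k) (rest s) * dot X (v k) (resolvent s)"
      using T(4)[OF k] r by (simp add: power2_eq_square)
  qed simp
  also have "\<dots> = (\<Sum>k=1..?n. dot X (v k) (rest s) * dot X (v k) (resolvent s))"
  proof -
    obtain c where c: "\<And>x. x \<in> X \<Longrightarrow> v ?n x = c * principal s x" using T(6) by blast
    have "dot X (v ?n) (rest s) = dot X (\<lambda>x. c * principal s x) (rest s)"
      by (rule dot_cong) (use c in auto)
    also have "\<dots> = 0"
      unfolding rest_def using unmarked_top[OF s(2)] top_norm[OF s(2)]
      by (simp add: dot_lin dot_commute[of X "principal s" "unmarked_state \<pi> M"])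
    finally show ?thesis by (simp only: sum_upto_card)
  qed
  also have "\<dots> = dot X (rest s) (resolvent s)"
    by (rule parseval[OF fin T(1), symmetric])
  finally show ?thesis using rest_resolvent[OF s(2)] by simp
qed

lemma interpolated_HT_eq:
  assumes "0 \<le> s" "s < 1"
  shows "interpolated_HT X P \<pi> M s = (sin2 s)\<^sup>2 * dot X contrast hit"
proof -
  have "\<exists>b. (\<lambda>(lam, v). sorted_eigenbasis X (discriminant P M s) lam v) b"
    using discriminant_basis_exists[of s] by auto
  from someI_ex[OF this] show ?thesis
    unfolding interpolated_HT_def
    using HT_sum[OF assms] by (auto simp: dot_def split: prod.splits)
qed

lemma extended_HT_eq: "extended_HT X P \<pi> M = dot X contrast hit"
proof -
  have "(sin2 \<longlongrightarrow> sin2 1) (at_left 1)"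
    unfolding sin2_def qs_def by (intro tendsto_intros) (use pM_pos in auto)
  then have "((\<lambda>s. (sin2 s)\<^sup>2 * dot X contrast hit) \<longlongrightarrow> (sin2 1)\<^sup>2 * dot X contrast hit) (at_left 1)"
    by (intro tendsto_intros)
  moreover have "sin2 1 = 1" using pM_pos by (simp add: sin2_def qs_def)
  moreover have "\<forall>\<^sub>F s in at_left 1. (sin2 s)\<^sup>2 * dot X contrast hit = interpolated_HT X P \<pi> M s"
    using eventually_at_left_real[OF zero_less_one] by eventually_elim (simp_all add: interpolated_HT_eq)
  ultimately have "(interpolated_HT X P \<pi> M \<longlongrightarrow> dot X contrast hit) (at_left 1)"
    by (simp add: tendsto_cong)
  then show ?thesis unfolding extended_HT_def by (intro tendsto_Lim) auto
qed

lemma rest_resolvent_HT: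
  "s < 1 \<Longrightarrow> dot X (rest s) (resolvent s) = (sin2 s)\<^sup>2 * extended_HT X P \<pi> M"
  by (simp add: rest_resolvent extended_HT_eq)

text \<open>At s = 0 every denominator 1 - lam k is at most 2, while the weights of U below the top
  add up to sin^2 = pM; this gives pM / 2 <= pM^2 HT+. The bound is what ensures
  \<open>1 \<le> T\<close>, so that the logarithm of T is nonnegative and T can absorb constants in
  the cost.\<close>

lemma extended_HT_ge: "1 / 2 \<le> extended_HT X P \<pi> M"
proof -
  let ?n = "card X" and ?u = "unmarked_state \<pi> M"
  obtain lam v where eb: "sorted_eigenbasis X (discriminant P M 0) lam v"
    using discriminant_basis_exists by blast
  have s: "(0::real) \<le> 0" "(0::real) < 1" by auto
  note T = eigenbasis_top[OF s eb]
  have sin0: "sin2 0 = pM" by (simp add: sin2_def qs_def)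
  have n: "?n \<in> {1..?n}" using card_X by auto
  obtain c where c: "\<And>x. x \<in> X \<Longrightarrow> v ?n x = c * principal 0 x" using T(6) by blast
  have cd: "dot X f (v ?n) = c * dot X f (principal 0)" for f
    unfolding dot_scale_right[symmetric] by (rule dot_cong) (use c in auto)
  have "dot X (v ?n) (v ?n) = c * c"
    using cd[of "v ?n"] cd[of "principal 0"] top_norm[OF s(2)] by (simp add: dot_commute[of X "v ?n" "principal 0"])
  then have c1: "c * c = 1" using T(1) n by (simp add: orthonormal_def)
  have "dot X (v ?n) ?u = c * cosine 0"
    using cd[of ?u] unmarked_top[OF s(2)] by (simp add: dot_commute[of X "v ?n"])
  then have "(dot X (v ?n) ?u)\<^sup>2 = 1 - pM"
    using c1 cosine_sq[OF s(2)] sin0 by (simp add: power_mult_distrib power2_eq_square[of c])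
  moreover have "1 = (\<Sum>k=1..?n. (dot X (v k) ?u)\<^sup>2)"
    using parseval[OF fin T(1), of ?u ?u] unmarked_norm by (simp add: power2_eq_square)
  ultimately have sum: "(\<Sum>k=1..?n - 1. (dot X (v k) ?u)\<^sup>2) = pM"
    by (simp only: sum_upto_card)
  have "pM / 2 = (\<Sum>k=1..?n - 1. (dot X (v k) ?u)\<^sup>2 / 2)"
    by (simp only: sum sum_divide_distrib[symmetric])
  also have "\<dots> \<le> (\<Sum>k=1..?n - 1. (dot X (v k) ?u)\<^sup>2 / (1 - lam k))"
  proof (rule sum_mono)
    fix k assume k: "k \<in> {1..?n - 1}"
    then have "-1 \<le> lam k" "lam k < 1" using T(3)[of k] T(4)[OF k] by auto
    then show "(dot X (v k) ?u)\<^sup>2 / 2 \<le> (dot X (v k) ?u)\<^sup>2 / (1 - lam k)"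
      by (intro divide_left_mono) auto
  qed
  also have "\<dots> = pM\<^sup>2 * extended_HT X P \<pi> M"
    by (simp only: HT_sum[OF s eb] sin0 extended_HT_eq)
  finally have "pM * (1 / 2) \<le> pM * (pM * extended_HT X P \<pi> M)" by (simp add: power2_eq_square)
  then have h: "1 / 2 \<le> pM * extended_HT X P \<pi> M" using pM_pos by (simp only: mult_le_cancel_left_pos)
  then have "0 < pM * extended_HT X P \<pi> M" by simp
  then have "0 \<le> extended_HT X P \<pi> M" using pM_pos by (simp add: zero_less_mult_iff)
  then have "pM * extended_HT X P \<pi> M \<le> 1 * extended_HT X P \<pi> M"
    using pM_less_1 by (intro mult_right_mono) auto
  then show ?thesis using h by simp
qed

end

section \<open>Complex amplitudes and isometries\<close>

definition cip :: "'i set \<Rightarrow> ('i \<Rightarrow> complex) \<Rightarrow> ('i \<Rightarrow> complex) \<Rightarrow> complex" where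
  "cip B f g = (\<Sum>i\<in>B. cnj (f i) * g i)"

definition nsq :: "'i set \<Rightarrow> ('i \<Rightarrow> complex) \<Rightarrow> real" where
  "nsq B f = (\<Sum>i\<in>B. (cmod (f i))\<^sup>2)"

lemma cip_add_left: "cip B (\<lambda>i. f i + g i) h = cip B f h + cip B g h"
  by (simp add: cip_def distrib_right sum.distrib)

lemma cip_add_right: "cip B h (\<lambda>i. f i + g i) = cip B h f + cip B h g"
  by (simp add: cip_def distrib_left sum.distrib)

lemma cip_diff_left: "cip B (\<lambda>i. f i - g i) h = cip B f h - cip B g h"
  by (simp add: cip_def left_diff_distrib sum_subtractf)

lemma cip_diff_right: "cip B h (\<lambda>i. f i - g i) = cip B h f - cip B h g"
  by (simp add: cip_def right_diff_distrib sum_subtractf)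

lemma cip_scale_left: "cip B (\<lambda>i. c * f i) h = cnj c * cip B f h"
  by (simp add: cip_def sum_distrib_left mult.assoc)

lemma cip_scale_right: "cip B h (\<lambda>i. c * f i) = c * cip B h f"
  by (simp add: cip_def sum_distrib_left mult.left_commute)

lemmas cip_lin = cip_add_left cip_add_right cip_diff_left cip_diff_right cip_scale_left cip_scale_right

lemma cnj_cip: "cnj (cip B f g) = cip B g f"
  by (simp add: cip_def mult.commute)

lemma cip_self: "cip B f f = complex_of_real (nsq B f)"
  by (simp add: cip_def nsq_def complex_norm_square[symmetric] mult.commute)

lemma nsq_eq_cip: "nsq B f = Re (cip B f f)"
  by (simp add: cip_self)

lemma nsq_nonneg [simp]: "0 \<le> nsq B f"
  by (simp add: nsq_def sum_nonneg)

lemma nsq_scale: "nsq B (\<lambda>i. c * f i) = (cmod c)\<^sup>2 * nsq B f"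
  by (simp add: nsq_def norm_mult power_mult_distrib sum_distrib_left)

lemma nsq_add_le: "nsq B (\<lambda>i. f i + g i) \<le> 2 * nsq B f + 2 * nsq B g"
proof -
  have "(cmod (a + b))\<^sup>2 \<le> 2 * (cmod a)\<^sup>2 + 2 * (cmod b)\<^sup>2" for a b :: complex
  proof -
    have "(cmod (a + b))\<^sup>2 \<le> (cmod a + cmod b)\<^sup>2"
      by (intro power_mono norm_triangle_ineq) auto
    also have "\<dots> \<le> 2 * (cmod a)\<^sup>2 + 2 * (cmod b)\<^sup>2"
      using zero_le_power2[of "cmod a - cmod b"] by (simp add: power2_eq_square algebra_simps)
    finally show ?thesis .
  qed
  then show ?thesis
    by (simp add: nsq_def sum_distrib_left sum.distrib[symmetric] sum_mono)
qed

lemma nsq_diff_le: "nsq B (\<lambda>i. f i - g i) \<le> 2 * nsq B f + 2 * nsq B g"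
  using nsq_add_le[of B f "\<lambda>i. - g i"] by (simp add: nsq_def)

lemma nsq_eq_0_supported:
  assumes "finite B" "supported_on B f" "nsq B f = 0"
  shows "f = (\<lambda>_. 0)"
  using assms by (auto simp: nsq_def supported_on_def sum_nonneg_eq_0_iff)

section \<open>Linear operators and supports\<close>

definition linear_op :: "(('i \<Rightarrow> complex) \<Rightarrow> ('j \<Rightarrow> complex)) \<Rightarrow> bool" where
  "linear_op F \<longleftrightarrow> (\<forall>f g. F (\<lambda>i. f i + g i) = (\<lambda>i. F f i + F g i)) \<and>
    (\<forall>c f. F (\<lambda>i. c * f i) = (\<lambda>i. c * F f i))"

lemma linear_opI:
  assumes "\<And>f g. F (\<lambda>i. f i + g i) = (\<lambda>i. F f i + F g i)" "\<And>c f. F (\<lambda>i. c * f i) = (\<lambda>i. c * F f i)"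
  shows "linear_op F"
  using assms by (simp add: linear_op_def)

lemma linear_op_add: "linear_op F \<Longrightarrow> F (\<lambda>i. f i + g i) = (\<lambda>i. F f i + F g i)"
  and linear_op_scale: "linear_op F \<Longrightarrow> F (\<lambda>i. c * f i) = (\<lambda>i. c * F f i)"
  by (auto simp: linear_op_def)

lemma linear_op_zero: "linear_op F \<Longrightarrow> F (\<lambda>i. 0) = (\<lambda>i. 0)"
  using linear_op_scale[of F 0 "\<lambda>i. 0"] by simp

lemma linear_op_diff:
  assumes "linear_op F"
  shows "F (\<lambda>i. f i - g i) = (\<lambda>i. F f i - F g i)"
  using linear_op_add[OF assms, of f "\<lambda>i. -1 * g i"] linear_op_scale[OF assms, of "-1" g] by simp

lemma linear_op_sum:
  assumes "linear_op F"
  shows "F (\<lambda>i. \<Sum>a\<in>A. c a * f a i) = (\<lambda>i. \<Sum>a\<in>A. c a * F (f a) i)"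
  by (induction A rule: infinite_finite_induct)
    (simp_all add: linear_op_zero[OF assms] linear_op_add[OF assms] linear_op_scale[OF assms])

lemma linear_op_comp: "linear_op F \<Longrightarrow> linear_op G \<Longrightarrow> linear_op (\<lambda>f. F (G f))"
  by (simp add: linear_op_def)

lemma linear_op_funpow:
  fixes F :: "('i \<Rightarrow> complex) \<Rightarrow> ('i \<Rightarrow> complex)"
  shows "linear_op F \<Longrightarrow> linear_op (F ^^ n)"
  by (induction n) (simp_all add: linear_op_def)

lemma supported_add: "supported_on B f \<Longrightarrow> supported_on B g \<Longrightarrow> supported_on B (\<lambda>i. f i + g i)"
  and supported_diff: "supported_on B f \<Longrightarrow> supported_on B g \<Longrightarrow> supported_on B (\<lambda>i. f i - g i)"
  and supported_scale: "supported_on B f \<Longrightarrow> supported_on B (\<lambda>i. c * f i)"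
  and supported_sum: "(\<And>a. a \<in> A \<Longrightarrow> supported_on B (h a)) \<Longrightarrow> supported_on B (\<lambda>i. \<Sum>a\<in>A. h a i)"
  by (auto simp: supported_on_def)

lemmas supported_intros = supported_add supported_diff supported_scale supported_sum

section \<open>Isometries obeying a quadratic relation on one vector\<close>

locale isometry_on =
  fixes B :: "'i set" and W :: "('i \<Rightarrow> complex) \<Rightarrow> ('i \<Rightarrow> complex)"
  assumes fin: "finite B" and lin: "linear_op W"
    and supp: "\<And>f. supported_on B f \<Longrightarrow> supported_on B (W f)"
    and iso: "\<And>f g. supported_on B f \<Longrightarrow> supported_on B g \<Longrightarrow> cip B (W f) (W g) = cip B f g"
begin

lemma supp_pow: "supported_on B f \<Longrightarrow> supported_on B ((W ^^ n) f)"
  by (induction n) (simp_all add: supp)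

lemma nsq_W: "supported_on B f \<Longrightarrow> nsq B (W f) = nsq B f"
  by (simp add: nsq_eq_cip iso)

lemma nsq_pow: "supported_on B f \<Longrightarrow> nsq B ((W ^^ n) f) = nsq B f"
  by (induction n) (simp_all add: nsq_W supp_pow)

text \<open>
  In the next lemmas \<open>W\<^sup>2 f = 2 W g - f\<close> expresses \<open>(W + W\<^sup>-\<^sup>1) f = 2 g\<close> without the inverse.
\<close>

lemma Re_cip_W:
  assumes f: "supported_on B f" and g: "supported_on B g" and rel: "W (W f) = (\<lambda>i. 2 * W g i - f i)"
  shows "Re (cip B f (W f)) = Re (cip B f g)"
proof -
  have "cip B f (W f) = cip B (W f) (W (W f))" using iso[OF f supp[OF f]] by simp
  also have "\<dots> = 2 * cip B (W f) (W g) - cip B (W f) f" by (simp add: rel cip_lin)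
  also have "\<dots> = 2 * cip B f g - cnj (cip B f (W f))" by (simp add: iso[OF f g] cnj_cip)
  finally have "Re (cip B f (W f)) = Re (2 * cip B f g - cnj (cip B f (W f)))" by simp
  then show ?thesis by simp
qed

lemma nsq_W_minus_id:
  assumes f: "supported_on B f" and g: "supported_on B g" and rel: "W (W f) = (\<lambda>i. 2 * W g i - f i)"
  shows "nsq B (\<lambda>i. W f i - f i) = 2 * Re (cip B f (\<lambda>i. f i - g i))"
proof -
  have "Re (cip B (W f) f) = Re (cip B f (W f))"
    using cnj_cip[of B f "W f"] by (metis complex_cnj(1) complex_cnj_cnj cnj.sel(1))
  then show ?thesis
    using Re_cip_W[OF assms] iso[OF f f] by (simp add: nsq_eq_cip cip_lin)
qed

text \<open>
  Geometric sum: \<open>W (f - g) = - (W - 1)\<^sup>2 f / 2\<close>, so summing \<open>W\<^sup>l (f - g)\<close> telescopes and leaves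
  two terms of the size of \<open>(W - 1) f\<close>.
\<close>

lemma nsq_geometric_sum:
  assumes f: "supported_on B f" and g: "supported_on B g" and rel: "W (W f) = (\<lambda>i. 2 * W g i - f i)"
  shows "nsq B (\<lambda>i. \<Sum>l<N. (W ^^ l) (\<lambda>i. f i - g i) i) \<le> 2 * Re (cip B f (\<lambda>i. f i - g i))"
proof -
  define u where "u = (\<lambda>i. f i - g i)"
  define e where "e = (\<lambda>i. W f i - f i)"
  have su: "supported_on B u" and se: "supported_on B e"
    unfolding u_def e_def using f g supp by (auto intro!: supported_intros)
  have "W g i = (W (W f) i + f i) / 2" for i by (simp add: rel)
  then have Wu: "W u = (\<lambda>i. (-1/2) * (W e i - e i))"
    unfolding u_def e_def by (auto simp: linear_op_diff[OF lin] field_simps)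
  have tele: "W (\<lambda>i. \<Sum>l<n. (W ^^ l) u i) = (\<lambda>i. (-1/2) * ((W ^^ n) e i - e i))" for n
  proof (induction n)
    case 0
    then show ?case by (simp add: linear_op_zero[OF lin])
  next
    case (Suc n)
    have "(W ^^ n) (W u) = (\<lambda>i. (-1/2) * ((W ^^ n) (W e) i - (W ^^ n) e i))"
      unfolding Wu using linear_op_scale[OF linear_op_funpow[OF lin]] linear_op_diff[OF linear_op_funpow[OF lin]]
      by metis
    then have step: "W ((W ^^ n) u) = (\<lambda>i. (-1/2) * (W ((W ^^ n) e) i - (W ^^ n) e i))"
      by (simp add: funpow_swap1)
    show ?case
      by (simp add: linear_op_add[OF lin] Suc.IH step fun_eq_iff field_simps)
  qed
  have s: "supported_on B (\<lambda>i. \<Sum>l<N. (W ^^ l) u i)"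
    by (intro supported_sum supp_pow su)
  \<comment> \<open>Since \<open>W\<close> preserves norms, the sum may be measured after one more
    application of \<open>W\<close>, which is where \<open>tele\<close> evaluates it.\<close>
  have "nsq B (\<lambda>i. \<Sum>l<N. (W ^^ l) u i) = nsq B (\<lambda>i. (-1/2) * ((W ^^ N) e i - e i))"
    using nsq_W[OF s] by (simp add: tele)
  also have "\<dots> = 1/4 * nsq B (\<lambda>i. (W ^^ N) e i - e i)"
    by (subst nsq_scale) (simp add: power2_eq_square)
  also have "\<dots> \<le> 1/4 * (2 * nsq B ((W ^^ N) e) + 2 * nsq B e)"
    by (intro mult_left_mono nsq_diff_le) auto
  also have "\<dots> = nsq B e" by (simp add: nsq_pow[OF se])
  also have "\<dots> = 2 * Re (cip B f (\<lambda>i. f i - g i))"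
    unfolding e_def by (rule nsq_W_minus_id[OF assms])
  finally show ?thesis by (simp add: u_def)
qed

text \<open>On the span of f and W f the relation reads W^2 - 2 l W + 1 = 0, with roots p, q =
  e^(+-i arccos l). If p and q differ, (W - q) f and (W - p) f are eigenvectors for p and q or zero,
  and their difference is (p - q) f. If p = q, then l^2 = 1 and |W f - l f|^2 = 2 - 2 l Re<f, W f> =
  0, so f itself is an eigenvector.\<close>

lemma eigenvector_decomposition:
  assumes f: "supported_on B f" and nf: "nsq B f = 1" and l: "-1 \<le> l" "l \<le> 1"
    and rel: "W (W f) = (\<lambda>i. 2 * (complex_of_real l * W f i) - f i)"
  obtains c1 c2 \<Psi>1 \<Psi>2 \<phi>1 \<phi>2 where "f = (\<lambda>i. c1 * \<Psi>1 i + c2 * \<Psi>2 i)"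
    "supported_on B \<Psi>1" "W \<Psi>1 = (\<lambda>i. cis \<phi>1 * \<Psi>1 i)"
    "supported_on B \<Psi>2" "W \<Psi>2 = (\<lambda>i. cis \<phi>2 * \<Psi>2 i)"
proof -
  define \<phi> where "\<phi> = arccos l"
  have cos: "cos \<phi> = l" using l by (simp add: \<phi>_def)
  define p where "p = cis \<phi>"
  define q where "q = cis (- \<phi>)"
  have pq: "p * q = 1" by (simp add: p_def q_def cis_mult)
  have psum: "p + q = 2 * complex_of_real l" by (simp add: p_def q_def complex_eq_iff cos)
  show thesis
  proof (cases "p = q")
    case True
    then have pl: "p = complex_of_real l" using psum by simp
    have ll: "l * l = 1"
    proof -
      have "complex_of_real (l * l) = complex_of_real 1" using pq True pl by simp
      then show ?thesis by (simp only: of_real_eq_iff)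
    qed
    have rel': "W (W f) = (\<lambda>i. 2 * W (\<lambda>i. complex_of_real l * f i) i - f i)"
      by (simp add: rel linear_op_scale[OF lin])
    have sl: "supported_on B (\<lambda>i. complex_of_real l * f i)" by (intro supported_scale f)
    have Re: "Re (cip B f (W f)) = l"
      using Re_cip_W[OF f sl rel'] nf by (simp add: cip_lin cip_self)
    have "Re (cip B (W f) f) = l"
      using Re cnj_cip[of B f "W f"] by (metis complex_cnj(1) complex_cnj_cnj cnj.sel(1))
    then have "nsq B (\<lambda>i. W f i - complex_of_real l * f i) = 0"
      using Re nf ll by (simp add: nsq_eq_cip cip_lin iso[OF f f])
    then have "(\<lambda>i. W f i - complex_of_real l * f i) = (\<lambda>_. 0)"
      by (intro nsq_eq_0_supported[OF fin] supported_intros supp f)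
    then have "W f = (\<lambda>i. cis \<phi> * f i)" using pl by (auto simp: p_def fun_eq_iff)
    then show thesis using that[of 1 f 0 f \<phi> \<phi>] f by simp
  next
    case False
    define \<Psi>1 where "\<Psi>1 = (\<lambda>i. W f i - q * f i)"
    define \<Psi>2 where "\<Psi>2 = (\<lambda>i. W f i - p * f i)"
    have s: "supported_on B \<Psi>1" "supported_on B \<Psi>2"
      unfolding \<Psi>1_def \<Psi>2_def by (intro supported_intros supp f)+
    have WW: "W (W f) i = (p + q) * W f i - p * q * f i" for i
      by (simp add: rel pq psum)
    have "W \<Psi>1 = (\<lambda>i. p * \<Psi>1 i)" "W \<Psi>2 = (\<lambda>i. q * \<Psi>2 i)"
      unfolding \<Psi>1_def \<Psi>2_def
      by (auto simp: linear_op_diff[OF lin] linear_op_scale[OF lin] WW algebra_simps fun_eq_iff)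
    moreover have "f = (\<lambda>i. 1 / (p - q) * \<Psi>1 i + (- 1 / (p - q)) * \<Psi>2 i)"
    proof
      fix i
      have "1 / (p - q) * \<Psi>1 i + (- 1 / (p - q)) * \<Psi>2 i = (\<Psi>1 i - \<Psi>2 i) / (p - q)"
        by (simp add: diff_divide_distrib)
      also have "\<Psi>1 i - \<Psi>2 i = (p - q) * f i" by (simp add: \<Psi>1_def \<Psi>2_def algebra_simps)
      finally show "f i = 1 / (p - q) * \<Psi>1 i + (- 1 / (p - q)) * \<Psi>2 i" using False by simp
    qed
    ultimately show thesis
      using that[of "1 / (p - q)" \<Psi>1 "- 1 / (p - q)" \<Psi>2 \<phi> "- \<phi>"] s by (simp add: p_def q_def)
  qed
qed

lemma eigenvector_one:
  assumes f: "supported_on B f" and rel: "W (W f) = (\<lambda>i. 2 * W f i - f i)"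
  shows "W f = f"
proof -
  have "nsq B (\<lambda>i. W f i - f i) = 0"
    using nsq_W_minus_id[OF f f] rel by (simp add: cip_def)
  then have "(\<lambda>i. W f i - f i) = (\<lambda>_. 0)"
    by (intro nsq_eq_0_supported[OF fin] supported_intros supp f)
  then show ?thesis by (auto simp: fun_eq_iff)
qed

end

section \<open>Unitary matrices as operators\<close>

lemma mat_apply_linear: "linear_op (mat_apply B K)"
  by (rule linear_opI)
    (auto simp: mat_apply_def distrib_left sum.distrib sum_distrib_left mult.left_commute)

lemma mat_apply_supported: "supported_on B (mat_apply B K f)"
  by (simp add: supported_on_def mat_apply_def)

lemma cip_mat_apply_adjoint:
  "cip B (mat_apply B (adjoint_mat K) f) g = cip B f (mat_apply B K g)"
proof -
  have "cip B (mat_apply B (adjoint_mat K) f) g = (\<Sum>i\<in>B. \<Sum>j\<in>B. K j i * cnj (f j) * g i)"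
    by (simp add: cip_def mat_apply_def adjoint_mat_def sum_distrib_right)
  also have "\<dots> = (\<Sum>j\<in>B. \<Sum>i\<in>B. K j i * cnj (f j) * g i)"
    by (rule sum.swap)
  also have "\<dots> = cip B f (mat_apply B K g)"
    by (simp add: cip_def mat_apply_def sum_distrib_left mult.commute mult.left_commute)
  finally show ?thesis .
qed

lemma mat_apply_mat_apply:
  assumes fin: "finite B" and f: "supported_on B f"
    and KL: "\<And>i j. i \<in> B \<Longrightarrow> j \<in> B \<Longrightarrow> (\<Sum>l\<in>B. K i l * L l j) = of_bool (i = j)"
  shows "mat_apply B K (mat_apply B L f) = f"
proof
  fix i
  show "mat_apply B K (mat_apply B L f) i = f i"
  proof (cases "i \<in> B")
    case True
    have "mat_apply B K (mat_apply B L f) i = (\<Sum>l\<in>B. \<Sum>j\<in>B. K i l * L l j * f j)"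
      using True by (simp add: mat_apply_def sum_distrib_left mult.assoc)
    also have "\<dots> = (\<Sum>j\<in>B. (\<Sum>l\<in>B. K i l * L l j) * f j)"
      by (subst sum.swap) (simp add: sum_distrib_right)
    also have "\<dots> = (\<Sum>j\<in>B. of_bool (i = j) * f j)"
      by (intro sum.cong) (use KL True in auto)
    also have "\<dots> = (\<Sum>j\<in>B. if i = j then f j else 0)"
      by (intro sum.cong) auto
    also have "\<dots> = f i" using True fin by simp
    finally show ?thesis .
  next
    case False
    then show ?thesis using f by (simp add: mat_apply_def supported_on_def)
  qed
qed

lemma unitary_adjoint_left:
  assumes "finite B" "unitary_on B K" "supported_on B f"
  shows "mat_apply B (adjoint_mat K) (mat_apply B K f) = f"
  using assms by (intro mat_apply_mat_apply) (auto simp: unitary_on_def adjoint_mat_def)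

lemma unitary_adjoint_right:
  assumes "finite B" "unitary_on B K" "supported_on B f"
  shows "mat_apply B K (mat_apply B (adjoint_mat K) f) = f"
  using assms by (intro mat_apply_mat_apply) (auto simp: unitary_on_def adjoint_mat_def)

lemma adjoint_adjoint [simp]: "adjoint_mat (adjoint_mat K) = K"
  by (simp add: adjoint_mat_def)

lemma unitary_on_adjoint: "unitary_on B K \<Longrightarrow> unitary_on B (adjoint_mat K)"
  by (simp add: unitary_on_def adjoint_mat_def)

lemma unitary_cip:
  assumes "finite B" "unitary_on B K" "supported_on B f"
  shows "cip B (mat_apply B K f) (mat_apply B K g) = cip B f g"
  using cip_mat_apply_adjoint[of B K "mat_apply B K f" g] unitary_adjoint_left[OF assms] by simp

section \<open>The walk operator\<close>

lemma finite_basis: "finite X \<Longrightarrow> finite (basis X k)"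
  by (simp add: basis_def)

lemma sum_basis: "(\<Sum>i\<in>basis X k. F i) = (\<Sum>x\<in>X. \<Sum>y\<in>X. \<Sum>a<2 ^ k. F (x, y, a))"
  by (simp add: basis_def sum.cartesian_product case_prod_unfold)

section \<open>SHIFT, and the projection onto the reference vector\<close>

definition shift3 :: "('v \<times> 'v) set \<Rightarrow> 'v \<times> 'v \<times> nat \<Rightarrow> 'v \<times> 'v \<times> nat" where
  "shift3 E = (\<lambda>(x, y, a). if (x, y) \<in> E \<or> x = y then (y, x, a) else (x, y, a))"

lemma shift_op_eq: "shift_op E f i = f (shift3 E i)"
  by (cases i) (simp add: shift_op_def shift3_def shift_basis_def)

lemma shift3_involution: "sym E \<Longrightarrow> shift3 E (shift3 E i) = i"
  by (cases i) (auto simp: shift3_def dest: symD)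

lemma shift3_basis:
  assumes "undirected_graph X E"
  shows "shift3 E i \<in> basis X k \<longleftrightarrow> i \<in> basis X k"
  using assms by (cases i) (auto simp: shift3_def basis_def undirected_graph_def)

lemma shift_op_linear: "linear_op (shift_op E)"
  by (rule linear_opI) (auto simp: shift_op_eq)

lemma shift_op_supported:
  "undirected_graph X E \<Longrightarrow> supported_on (basis X k) f \<Longrightarrow> supported_on (basis X k) (shift_op E f)"
  by (simp add: supported_on_def shift_op_eq shift3_basis del: split_paired_All)

lemma shift_op_involution: "sym E \<Longrightarrow> shift_op E (shift_op E f) = f"
  by (rule ext) (simp add: shift_op_eq shift3_involution)

lemma cip_shift_op:
  assumes "undirected_graph X E"
  shows "cip (basis X k) (shift_op E f) (shift_op E g) = cip (basis X k) f g"
proof -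
  have "sym E" using assms by (simp add: undirected_graph_def)
  then have "bij_betw (shift3 E) (basis X k) (basis X k)"
    by (intro bij_betw_byWitness[where f' = "shift3 E"])
      (auto simp: shift3_involution shift3_basis[OF assms])
  then show ?thesis
    unfolding cip_def shift_op_eq by (rule sum.reindex_bij_betw)
qed

text \<open>The partial inner product of the state with |z>|0> in the second register and the work
  qubits. With it \<open>zproj\<close> is the projection onto |z>|0>, and \<open>ref_op\<close> is
  twice that projection minus the identity.\<close>

definition zcoord :: "'v set \<Rightarrow> ('v \<Rightarrow> complex) \<Rightarrow> 'v state \<Rightarrow> 'v \<Rightarrow> complex" where
  "zcoord X z f x = (\<Sum>y\<in>X. cnj (z y) * f (x, y, 0))"

definition zproj :: "'v set \<Rightarrow> ('v \<Rightarrow> complex) \<Rightarrow> 'v state \<Rightarrow> 'v state" where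
  "zproj X z f = (\<lambda>(x, y, w). of_bool (w = 0) * z y * zcoord X z f x)"

lemma ref_op_eq: "ref_op X z f = (\<lambda>i. 2 * zproj X z f i - f i)"
  by (auto simp: ref_op_def zproj_def zcoord_def)

lemma zproj_linear: "linear_op (zproj X z)"
  by (rule linear_opI)
    (auto simp: zproj_def zcoord_def distrib_left sum.distrib sum_distrib_left algebra_simps)

lemma ref_op_linear: "linear_op (ref_op X z)"
  unfolding ref_op_eq
  by (rule linear_opI) (auto simp: linear_op_add[OF zproj_linear] linear_op_scale[OF zproj_linear] algebra_simps)

text \<open>The state |f>|z>|0>, which carries the real spectral theory of D(s) into the space of
  the walk.\<close>

definition lift :: "'v set \<Rightarrow> ('v \<Rightarrow> complex) \<Rightarrow> ('v \<Rightarrow> real) \<Rightarrow> 'v state" where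
  "lift X z f = (\<lambda>(x, y, w). if x \<in> X \<and> w = 0 then complex_of_real (f x) * z y else 0)"

lemma lift_cong: "(\<And>x. x \<in> X \<Longrightarrow> f x = g x) \<Longrightarrow> lift X z f = lift X z g"
  by (auto simp: lift_def)

lemma lift_add: "lift X z (\<lambda>x. f x + g x) = (\<lambda>i. lift X z f i + lift X z g i)"
  and lift_diff: "lift X z (\<lambda>x. f x - g x) = (\<lambda>i. lift X z f i - lift X z g i)"
  and lift_scale: "lift X z (\<lambda>x. c * f x) = (\<lambda>i. complex_of_real c * lift X z f i)"
  by (auto simp: lift_def algebra_simps)

lemma lift_sum: "lift X z (\<lambda>x. \<Sum>k\<in>K. c k * f k x) = (\<lambda>i. \<Sum>k\<in>K. complex_of_real (c k) * lift X z (f k) i)"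
  by (auto simp: lift_def fun_eq_iff sum_distrib_right mult.assoc)

locale reference_vector =
  fixes X :: "'v set" and z :: "'v \<Rightarrow> complex"
  assumes fin_X: "finite X" and unit: "unit_vector X z"
begin

lemma z_outside: "x \<notin> X \<Longrightarrow> z x = 0"
  using unit by (simp add: unit_vector_def)

lemma z_norm: "(\<Sum>y\<in>X. cnj (z y) * z y) = 1"
proof -
  have "(\<Sum>y\<in>X. cnj (z y) * z y) = complex_of_real (\<Sum>y\<in>X. (cmod (z y))\<^sup>2)"
    by (simp add: complex_norm_square[symmetric] mult.commute)
  also have "(\<Sum>y\<in>X. (cmod (z y))\<^sup>2) = 1" using unit by (simp add: unit_vector_def)
  finally show ?thesis by (simp only: of_real_1)
qed

lemma sum_of_bool_0: "(\<Sum>w<2 ^ k. of_bool (w = 0) * F w) = F (0::nat)" for F :: "nat \<Rightarrow> complex"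
proof -
  have "(\<Sum>w<2 ^ k. of_bool (w = 0) * F w) = (\<Sum>w<2 ^ k. if w = 0 then F w else 0)"
    by (intro sum.cong) auto
  also have "\<dots> = F 0" by (subst sum.delta) auto
  finally show ?thesis .
qed

lemma cip_zproj: "cip (basis X k) (zproj X z f) g = (\<Sum>x\<in>X. cnj (zcoord X z f x) * zcoord X z g x)"
proof -
  have "cip (basis X k) (zproj X z f) g
      = (\<Sum>x\<in>X. \<Sum>y\<in>X. \<Sum>w<2^k. of_bool (w = 0) * (cnj (zcoord X z f x) * (cnj (z y) * g (x, y, w))))"
    unfolding cip_def sum_basis zproj_def
    by (intro sum.cong refl) (simp add: mult.commute mult.left_commute)
  then show ?thesis
    by (simp only: sum_of_bool_0) (simp add: zcoord_def[of X z g] sum_distrib_left)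
qed

lemma cip_zproj_right: "cip (basis X k) f (zproj X z g) = (\<Sum>x\<in>X. cnj (zcoord X z f x) * zcoord X z g x)"
  by (subst cnj_cip[symmetric]) (simp add: cip_zproj mult.commute)

lemma zcoord_zproj: "zcoord X z (zproj X z f) x = zcoord X z f x"
proof -
  have "zcoord X z (zproj X z f) x = (\<Sum>y\<in>X. cnj (z y) * z y) * zcoord X z f x"
    unfolding zcoord_def[of X z "zproj X z f"] sum_distrib_right by (simp add: zproj_def mult.assoc)
  then show ?thesis by (simp add: z_norm)
qed

lemma cip_ref_op: "cip (basis X k) (ref_op X z f) (ref_op X z g) = cip (basis X k) f g"
  unfolding ref_op_eq
  by (simp add: cip_lin cip_zproj cip_zproj_right zcoord_zproj)

lemma ref_op_supported: "supported_on (basis X k) f \<Longrightarrow> supported_on (basis X k) (ref_op X z f)"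
proof -
  assume f: "supported_on (basis X k) f"
  have "zcoord X z f x = 0" if "x \<notin> X" for x
    using f that by (auto simp: zcoord_def supported_on_def basis_def intro!: sum.neutral)
  then have "supported_on (basis X k) (zproj X z f)"
    by (auto simp: supported_on_def zproj_def basis_def z_outside)
  then show ?thesis unfolding ref_op_eq by (intro supported_intros f)
qed

lemma lift_supported: "supported_on (basis X k) (lift X z f)"
  by (auto simp: supported_on_def lift_def basis_def z_outside)

lemma zcoord_lift: "zcoord X z (lift X z f) x = (if x \<in> X then complex_of_real (f x) else 0)"
proof -
  have "zcoord X z (lift X z f) x = (\<Sum>y\<in>X. cnj (z y) * z y) * (if x \<in> X then complex_of_real (f x) else 0)"
    unfolding zcoord_def sum_distrib_right by (intro sum.cong) (auto simp: lift_def)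
  then show ?thesis by (simp add: z_norm)
qed

lemma zproj_lift: "zproj X z (lift X z f) = lift X z f"
  by (auto simp: zproj_def zcoord_lift) (auto simp: lift_def)

lemma ref_op_lift: "ref_op X z (lift X z f) = lift X z f"
  by (simp add: ref_op_eq zproj_lift)

lemma cip_lift: "cip (basis X k) (lift X z f) (lift X z g) = complex_of_real (\<Sum>x\<in>X. f x * g x)"
  by (subst zproj_lift[symmetric]) (simp add: cip_zproj zcoord_lift)

lemma nsq_lift: "nsq (basis X k) (lift X z f) = (\<Sum>x\<in>X. f x * f x)"
  by (simp add: nsq_eq_cip cip_lift)

lemma lift_expansion:
  "lift X z f = (\<lambda>i. \<Sum>x\<in>X. complex_of_real (f x) * (case i of (u, v, b) \<Rightarrow> of_bool (u = x \<and> b = 0) * z v))"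
  (is "_ = ?rhs")
proof -
  have *: "?rhs (u, v, b) = lift X z f (u, v, b)" for u v b
  proof -
    have "?rhs (u, v, b) = (\<Sum>x\<in>X. if u = x then of_bool (b = 0) * complex_of_real (f x) * z v else 0)"
      by (intro sum.cong) auto
    then show ?thesis using fin_X by (auto simp: lift_def)
  qed
  show ?thesis
  proof (rule ext)
    fix i
    show "lift X z f i = ?rhs i"
      using *[of "fst i" "fst (snd i)" "snd (snd i)"] by (simp only: prod.collapse)
  qed
qed

lemma zcoord_eq_cip:
  assumes "x \<in> X"
  shows "zcoord X z f x = cip (basis X k) (lift X z (\<lambda>u. of_bool (u = x))) f"
proof -
  have "cip (basis X k) (lift X z (\<lambda>u. of_bool (u = x))) f
      = (\<Sum>u\<in>X. cnj (complex_of_real (of_bool (u = x))) * zcoord X z f u)"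
    by (subst zproj_lift[symmetric]) (simp add: cip_zproj zcoord_lift)
  also have "\<dots> = (\<Sum>u\<in>X. if u = x then zcoord X z f u else 0)"
    by (intro sum.cong) auto
  finally show ?thesis using assms fin_X by simp
qed

end

section \<open>The walk operator and its relation to D(s)\<close>

locale interpolated_walk = reference_vector X z
  for X :: "'v set" and z :: "'v \<Rightarrow> complex" +
  fixes E :: "('v \<times> 'v) set" and P :: "'v \<Rightarrow> 'v \<Rightarrow> real" and M :: "'v set" and s :: real
    and k :: nat and V :: "('v \<times> 'v \<times> nat) cmat"
  assumes graph: "undirected_graph X E" and on_graph: "chain_on_graph X E P"
    and update: "interpolated_update X P M s z k V"
begin

abbreviation "B \<equiv> basis X k"
abbreviation "D \<equiv> discriminant P M s"
abbreviation "Ps \<equiv> interpolated P M s"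
abbreviation "L \<equiv> lift X z"
abbreviation "W \<equiv> walk_op X E z k V"

text \<open>The operator V^-1 SHIFT V, an involution; the walk is the product of the two reflections
  \<open>flip\<close> and \<open>ref_op\<close>.\<close>

definition flip :: "'v state \<Rightarrow> 'v state" where
  "flip f = mat_apply B (adjoint_mat V) (shift_op E (mat_apply B V f))"

lemma fin_B: "finite B"
  by (simp add: finite_basis fin_X)

lemma V_unitary: "unitary_on B V"
  using update by (simp add: interpolated_update_def)

lemma walk_op_eq: "W f = flip (ref_op X z f)"
  by (simp add: walk_op_def flip_def)

lemma flip_linear: "linear_op flip"
  unfolding flip_def
  by (rule linear_op_comp[OF mat_apply_linear linear_op_comp[OF shift_op_linear mat_apply_linear]])

lemma flip_supported: "supported_on B (flip f)"
  unfolding flip_def by (rule mat_apply_supported)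

lemma flip_flip:
  assumes "supported_on B f"
  shows "flip (flip f) = f"
proof -
  have "supported_on B (shift_op E (mat_apply B V f))"
    by (intro shift_op_supported[OF graph] mat_apply_supported)
  then have "mat_apply B V (flip f) = shift_op E (mat_apply B V f)"
    unfolding flip_def by (rule unitary_adjoint_right[OF fin_B V_unitary])
  then show ?thesis
    using graph unitary_adjoint_left[OF fin_B V_unitary assms]
    unfolding flip_def[of "flip f"] by (simp add: shift_op_involution undirected_graph_def)
qed

lemma cip_flip:
  assumes "supported_on B f"
  shows "cip B (flip f) (flip g) = cip B f g"
proof -
  have "supported_on B (shift_op E (mat_apply B V f))"
    by (intro shift_op_supported[OF graph] mat_apply_supported)
  then show ?thesis unfolding flip_def
    by (simp add: unitary_cip[OF fin_B unitary_on_adjoint[OF V_unitary]] cip_shift_op[OF graph]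
        unitary_cip[OF fin_B V_unitary assms])
qed

sublocale isometry_on B W
proof
  show "linear_op W"
    unfolding walk_op_eq by (rule linear_op_comp[OF flip_linear ref_op_linear])
qed (simp_all add: fin_B walk_op_eq flip_supported cip_flip ref_op_supported cip_ref_op)

text \<open>\<open>V\<close> is specified only on the vectors |x>|z>|0>, and
  \<open>lift_expansion\<close> writes every lifted vector as a combination of these.\<close>

lemma V_lift:
  assumes "x' \<in> X" "y \<in> X" "w < 2 ^ k"
  shows "mat_apply B V (L f) (x', y, w) = of_bool (w = 0) * complex_of_real (f x' * sqrt (Ps x' y))"
proof -
  define e :: "'v \<Rightarrow> 'v state" where "e = (\<lambda>x i. case i of (u, v, b) \<Rightarrow> of_bool (u = x \<and> b = 0) * z v)"
  have "L f = (\<lambda>i. \<Sum>x\<in>X. complex_of_real (f x) * e x i)"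
    unfolding e_def by (rule lift_expansion)
  then have "mat_apply B V (L f) (x', y, w) = (\<Sum>x\<in>X. complex_of_real (f x) * mat_apply B V (e x) (x', y, w))"
    by (simp add: linear_op_sum[OF mat_apply_linear])
  also have "\<dots> = (\<Sum>x\<in>X. if x' = x then of_bool (w = 0) * complex_of_real (f x * sqrt (Ps x y)) else 0)"
  proof (intro sum.cong refl)
    fix x assume "x \<in> X"
    with update have V1: "\<forall>i\<in>B. case i of (x', y, w) \<Rightarrow>
        mat_apply B V (\<lambda>(u, v, b). of_bool (u = x \<and> b = 0) * z v) (x', y, w) =
          of_bool (x' = x \<and> w = 0) * complex_of_real (sqrt (Ps x y))"
      unfolding interpolated_update_def by blast
    have "(x', y, w) \<in> B" using assms by (simp add: basis_def)
    from bspec[OF V1 this] have "mat_apply B V (e x) (x', y, w) = of_bool (x' = x \<and> w = 0) * complex_of_real (sqrt (Ps x y))"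
      unfolding e_def by (simp only: prod.case)
    then show "complex_of_real (f x) * mat_apply B V (e x) (x', y, w)
        = (if x' = x then of_bool (w = 0) * complex_of_real (f x * sqrt (Ps x y)) else 0)"
      by simp
  qed
  finally show ?thesis using assms(1) fin_X by simp
qed

lemma Ps_off_graph: "x \<in> X \<Longrightarrow> y \<in> X \<Longrightarrow> (x, y) \<notin> E \<Longrightarrow> x \<noteq> y \<Longrightarrow> Ps x y = 0 \<and> Ps y x = 0"
proof -
  assume *: "x \<in> X" "y \<in> X" "(x, y) \<notin> E" "x \<noteq> y"
  then have "(y, x) \<notin> E" using graph by (auto simp: undirected_graph_def dest: symD)
  then have "P x y = 0" "P y x = 0" using * on_graph by (auto simp: chain_on_graph_def)
  then show ?thesis using * by (auto simp: interpolated_def absorbing_def)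
qed

text \<open>SHIFT leaves |x,y> in place when (x, y) is neither an edge nor a loop, but there the
  transition probabilities vanish in both directions. On the image of lifted vectors it therefore
  acts as the full swap.\<close>

lemma shift_V_lift:
  assumes "x \<in> X" "y \<in> X" "w < 2 ^ k"
  shows "shift_op E (mat_apply B V (L f)) (x, y, w) = of_bool (w = 0) * complex_of_real (f y * sqrt (Ps y x))"
  using assms Ps_off_graph[of x y] by (auto simp: shift_op_eq shift3_def V_lift)

text \<open>Moving \<open>V\<close> to the other side of the inner product pairs sqrt(P(s) x y) with
  the swapped amplitude sqrt(P(s) y x), and their product is the entry of D(s).\<close>

lemma zcoord_flip_lift:
  assumes x: "x \<in> X"
  shows "zcoord X z (flip (L f)) x = complex_of_real (\<Sum>y\<in>X. D x y * f y)"
proof -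
  let ?e = "\<lambda>u. of_bool (u = x)"
  have "zcoord X z (flip (L f)) x = cip B (L ?e) (flip (L f))"
    by (rule zcoord_eq_cip[OF x])
  also have "\<dots> = cip B (mat_apply B V (L ?e)) (shift_op E (mat_apply B V (L f)))"
    unfolding flip_def using cip_mat_apply_adjoint[of B "adjoint_mat V"] by simp
  also have "\<dots> = (\<Sum>u\<in>X. \<Sum>y\<in>X. \<Sum>w<2^k. of_bool (w = (0::nat)) *
      complex_of_real (of_bool (u = x) * (sqrt (Ps u y) * (f y * sqrt (Ps y u)))))"
    unfolding cip_def sum_basis
    by (intro sum.cong refl) (auto simp: V_lift shift_V_lift)
  also have "\<dots> = (\<Sum>u\<in>X. if u = x then complex_of_real (\<Sum>y\<in>X. D u y * f y) else 0)"
    unfolding sum_of_bool_0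
    by (intro sum.cong refl) (auto simp: discriminant_def real_sqrt_mult mult.commute mult.left_commute)
  finally show ?thesis using x fin_X by simp
qed

lemma zproj_flip_lift: "zproj X z (flip (L f)) = L (\<lambda>x. \<Sum>y\<in>X. D x y * f y)"
proof -
  have "zcoord X z (flip (L f)) x = 0" if "x \<notin> X" for x
    using flip_supported[of "L f"] that by (auto simp: zcoord_def supported_on_def basis_def intro!: sum.neutral)
  then have "zproj X z (flip (L f)) (x, y, w) = L (\<lambda>x. \<Sum>y\<in>X. D x y * f y) (x, y, w)" for x y w
    unfolding zproj_def by (cases "x \<in> X") (simp_all add: zcoord_flip_lift lift_def[of X z "\<lambda>x. \<Sum>y\<in>X. D x y * f y"])
  then show ?thesis by auto
qed

text \<open>\<open>ref_op\<close> fixes L f, so W (L f) = flip (L f). Its component along |z>|0> is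
  L (D f), so reflecting it gives 2 L (D f) - flip (L f), and \<open>flip\<close> cancels itself in
  the second term.\<close>

theorem walk_relation: "W (W (L f)) = (\<lambda>i. 2 * W (L (\<lambda>x. \<Sum>y\<in>X. D x y * f y)) i - L f i)"
proof -
  have "W (W (L f)) = flip (\<lambda>i. 2 * L (\<lambda>x. \<Sum>y\<in>X. D x y * f y) i - flip (L f) i)"
    by (simp add: walk_op_eq ref_op_lift ref_op_eq[of X z "flip (L f)"] zproj_flip_lift)
  also have "\<dots> = (\<lambda>i. 2 * flip (L (\<lambda>x. \<Sum>y\<in>X. D x y * f y)) i - L f i)"
    by (simp add: linear_op_diff[OF flip_linear] linear_op_scale[OF flip_linear] flip_flip[OF lift_supported])
  finally show ?thesis by (simp add: walk_op_eq ref_op_lift)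
qed

end

section \<open>Circuits\<close>

lemma flip_bit_involution: "flip_bit n (flip_bit n a) = a" for a :: nat
  by (rule bit_eqI) (auto simp: bit_flip_bit_iff)

lemma not_bit_small: "a < 2 ^ n \<Longrightarrow> n \<le> m \<Longrightarrow> \<not> bit a m" for a :: nat
  by (metis bit_take_bit_iff not_less take_bit_nat_eq_self)

lemma flip_bit_small: "a < 2 ^ n \<Longrightarrow> flip_bit n a = a + 2 ^ n" for a :: nat
  using not_bit_small[of a n n] by (simp add: flip_bit_eq_if set_bit_eq)

lemma flip_bit_eq_0_iff: "flip_bit n a = 0 \<longleftrightarrow> a = 2 ^ n" for a :: nat
  by (metis add_0 flip_bit_involution flip_bit_small zero_less_numeral zero_less_power)

lemma flip_bit_less:
  fixes b :: nat
  assumes "b < 2 ^ k" "q < k"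
  shows "flip_bit q b < 2 ^ k"
proof -
  have "take_bit k (flip_bit q b) = flip_bit q (take_bit k b)"
    using assms(2) by (simp add: take_bit_flip_bit_eq)
  then have "take_bit k (flip_bit q b) = flip_bit q b"
    using assms(1) by (simp add: take_bit_nat_eq_self)
  then show ?thesis by (metis take_bit_nat_less_exp)
qed

lemma prim_sem_linear: "linear_op (prim_sem X bx g)"
proof (cases g)
  case (Static k U)
  then show ?thesis
    by (intro linear_opI ext) (auto simp: mat_apply_def distrib_left sum.distrib sum_distrib_left mult.left_commute case_prod_unfold)
next
  case (Check q)
  then show ?thesis by (intro linear_opI ext) auto
next
  case Setup
  then show ?thesis
    by (intro linear_opI ext) (auto simp: mat_apply_def distrib_left sum.distrib sum_distrib_left mult.left_commute)
next
  case UpdateV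
  then show ?thesis
    by (intro linear_opI ext) (auto simp: mat_apply_def distrib_left sum.distrib sum_distrib_left mult.left_commute case_prod_unfold)
next
  case UpdateVadj
  then show ?thesis
    by (intro linear_opI ext) (auto simp: mat_apply_def distrib_left sum.distrib sum_distrib_left mult.left_commute case_prod_unfold)
next
  case Shift
  then show ?thesis using shift_op_linear by simp
qed

lemma gate_sem_linear: "linear_op (gate_sem X bx g)"
proof (cases g)
  case (Gate Q p)
  show ?thesis
    unfolding Gate
    by (intro linear_opI ext)
      (auto simp: linear_op_add[OF prim_sem_linear] linear_op_scale[OF prim_sem_linear])
qed

lemma run_Nil [simp]: "run X bx [] \<psi> = \<psi>"
  and run_Cons [simp]: "run X bx (g # gs) \<psi> = run X bx gs (gate_sem X bx g \<psi>)"
  and run_append: "run X bx (gs @ hs) \<psi> = run X bx hs (run X bx gs \<psi>)"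
  by (simp_all add: run_def)

lemma run_linear: "linear_op (run X bx gs)"
proof (induction gs)
  case Nil
  then show ?case by (simp add: linear_op_def)
next
  case (Cons g gs)
  have "linear_op (\<lambda>\<psi>. run X bx gs (gate_sem X bx g \<psi>))"
    by (rule linear_op_comp[OF Cons gate_sem_linear])
  moreover have "run X bx (g # gs) = (\<lambda>\<psi>. run X bx gs (gate_sem X bx g \<psi>))" by auto
  ultimately show ?case by simp
qed

section \<open>Success probability\<close>

locale search_walk = interpolated_walk X z E P M s k V + marked_chain X P \<pi> M
  for X :: "'v set" and z E P M s k V and \<pi> :: "'v \<Rightarrow> real" +
  assumes s0: "0 \<le> s" and s1: "s < 1"
begin

abbreviation "U \<equiv> unmarked_state \<pi> M"

lemma L_mv: "(\<lambda>x. \<Sum>y\<in>X. D x y * f y) = mv X D f"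
  by (simp add: mv_def)

lemma walk_mv: "W (W (L f)) = (\<lambda>i. 2 * W (L (mv X D f)) i - L f i)"
  using walk_relation[of f] by (simp add: L_mv)

lemma W_principal: "W (L (principal s)) = L (principal s)"
proof (rule eigenvector_one)
  show "supported_on B (L (principal s))" by (rule lift_supported)
  have "L (mv X D (principal s)) = L (principal s)"
    by (rule lift_cong) (use top_eigenvector[OF s0 s1] in auto)
  then show "W (W (L (principal s))) = (\<lambda>i. 2 * W (L (principal s)) i - L (principal s) i)"
    using walk_mv[of "principal s"] by simp
qed

lemma pow_principal: "(W ^^ n) (L (principal s)) = L (principal s)"
  by (induction n) (simp_all add: W_principal)

lemma nsq_pow_rest:
  "nsq B (\<lambda>i. \<Sum>l<N. (W ^^ l) (L (rest s)) i) \<le> 2 * ((sin2 s)\<^sup>2 * extended_HT X P \<pi> M)"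
proof -
  let ?r = "resolvent s"
  have eq: "(\<lambda>i. L ?r i - L (mv X D ?r) i) = L (rest s)"
    unfolding lift_diff[symmetric] by (rule lift_cong) (use resolvent[OF s0 s1] in auto)
  have "nsq B (\<lambda>i. \<Sum>l<N. (W ^^ l) (L (rest s)) i) \<le> 2 * Re (cip B (L ?r) (L (rest s)))"
    using nsq_geometric_sum[OF lift_supported lift_supported walk_mv[of ?r], of N] unfolding eq .
  also have "Re (cip B (L ?r) (L (rest s))) = dot X (rest s) ?r"
    by (simp add: cip_lift dot_def mult.commute)
  finally show ?thesis by (simp add: rest_resolvent_HT[OF s1])
qed

text \<open>The amplitudes of \<open>EE(W, t)\<close> at the estimate \<open>m = 0\<close>.\<close>

definition mean_at_zero :: "'v boxes \<Rightarrow> nat \<Rightarrow> 'v circuit \<Rightarrow> 'v state \<Rightarrow> bool" where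
  "mean_at_zero bx t ee \<psi> \<longleftrightarrow> (\<forall>x y b. b < 2 ^ k \<longrightarrow>
     run X bx ee \<psi> (x, y, b) = (\<Sum>l<2 ^ t. (W ^^ l) \<psi> (x, y, b)) / 2 ^ t)"

text \<open>At m = 0 the phases of the inverse Fourier transform are 1, leaving the mean of the
  powers of the eigenvalue. The zero vector, which the specification of eigenvalue estimation
  excludes, must be covered because a component supplied by \<open>eigenvector_decomposition\<close>
  can vanish.\<close>

lemma mean_at_zero_eigenvector:
  assumes ee: "eigenvalue_estimation X bx k w W t ee" and \<Psi>: "supported_on B \<Psi>"
    and eig: "W \<Psi> = (\<lambda>i. cis \<phi> * \<Psi> i)"
  shows "mean_at_zero bx t ee \<Psi>"
proof (cases "\<Psi> = (\<lambda>_. 0)")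
  case True
  then show ?thesis
    by (simp add: mean_at_zero_def linear_op_zero[OF run_linear] linear_op_zero[OF linear_op_funpow[OF lin]])
next
  case False
  have pow: "(W ^^ l) \<Psi> = (\<lambda>i. cis \<phi> ^ l * \<Psi> i)" for l
    by (induction l) (simp_all add: linear_op_scale[OF lin] eig mult.assoc mult.left_commute)
  have expo: "exp (\<i> * complex_of_real \<phi> * of_nat l) = cis \<phi> ^ l" for l
    by (metis cis_conv_exp exp_of_nat_mult mult.commute)
  have "run X bx ee \<Psi> = (\<lambda>(x, y, a).
          let m = a div 2 ^ k in
          if m < 2 ^ t
          then \<Psi> (x, y, a mod 2 ^ k) *
                 (1 / 2 ^ t * (\<Sum>l<2 ^ t. exp (- 2 * pi * \<i> * of_nat l * of_nat m / 2 ^ t) *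
                                          exp (\<i> * \<phi> * of_nat l)))
          else 0)"
    using ee \<Psi> False eig unfolding eigenvalue_estimation_def by blast
  then have "run X bx ee \<Psi> (x, y, b) = \<Psi> (x, y, b) * (1 / 2 ^ t * (\<Sum>l<2 ^ t. cis \<phi> ^ l))"
    if "b < 2 ^ k" for x y b
    using that by (simp add: expo)
  then show ?thesis
    by (simp add: mean_at_zero_def pow sum_distrib_right[symmetric] mult.commute)
qed

lemma mean_at_zero_sum:
  assumes "\<And>a. a \<in> A \<Longrightarrow> mean_at_zero bx t ee (\<psi> a)"
  shows "mean_at_zero bx t ee (\<lambda>i. \<Sum>a\<in>A. c a * \<psi> a i)"
  unfolding mean_at_zero_def
proof (intro allI impI)
  fix x y b assume b: "b < (2::nat) ^ k"
  have "run X bx ee (\<lambda>i. \<Sum>a\<in>A. c a * \<psi> a i) (x, y, b) = (\<Sum>a\<in>A. c a * run X bx ee (\<psi> a) (x, y, b))"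
    by (simp add: linear_op_sum[OF run_linear])
  also have "\<dots> = (\<Sum>a\<in>A. \<Sum>l<2 ^ t. c a * (W ^^ l) (\<psi> a) (x, y, b) / 2 ^ t)"
    using assms b by (intro sum.cong) (auto simp: mean_at_zero_def sum_distrib_left sum_divide_distrib)
  also have "\<dots> = (\<Sum>l<2 ^ t. (W ^^ l) (\<lambda>i. \<Sum>a\<in>A. c a * \<psi> a i) (x, y, b)) / 2 ^ t"
    by (subst sum.swap) (simp add: linear_op_sum[OF linear_op_funpow[OF lin]] sum_divide_distrib)
  finally show "run X bx ee (\<lambda>i. \<Sum>a\<in>A. c a * \<psi> a i) (x, y, b)
      = (\<Sum>l<2 ^ t. (W ^^ l) (\<lambda>i. \<Sum>a\<in>A. c a * \<psi> a i) (x, y, b)) / 2 ^ t" .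
qed

lemma mean_at_zero_lift:
  assumes ee: "eigenvalue_estimation X bx k w W t ee"
  shows "mean_at_zero bx t ee (L f)"
proof -
  obtain lam v where eb: "sorted_eigenbasis X D lam v"
    using discriminant_basis_exists by blast
  note T = eigenbasis_top[OF s0 s1 eb]
  have eigen: "mean_at_zero bx t ee (L (v j))" if j: "j \<in> {1..card X}" for j
  proof -
    have "L (mv X D (v j)) = (\<lambda>i. complex_of_real (lam j) * L (v j) i)"
      unfolding lift_scale[symmetric] by (rule lift_cong) (use T(2)[OF j] in auto)
    then have rel: "W (W (L (v j))) = (\<lambda>i. 2 * (complex_of_real (lam j) * W (L (v j)) i) - L (v j) i)"
      using walk_mv[of "v j"] by (simp add: linear_op_scale[OF lin])
    have nsq: "nsq B (L (v j)) = 1"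
      using T(1) j by (simp add: nsq_lift orthonormal_def dot_def)
    have l: "-1 \<le> lam j" "lam j \<le> 1" using T(3)[OF j] by auto
    obtain c1 c2 \<Psi>1 \<Psi>2 \<phi>1 \<phi>2 where d: "L (v j) = (\<lambda>i. c1 * \<Psi>1 i + c2 * \<Psi>2 i)"
      "supported_on B \<Psi>1" "W \<Psi>1 = (\<lambda>i. cis \<phi>1 * \<Psi>1 i)"
      "supported_on B \<Psi>2" "W \<Psi>2 = (\<lambda>i. cis \<phi>2 * \<Psi>2 i)"
      by (rule eigenvector_decomposition[OF lift_supported nsq l rel])
    \<comment> \<open>The combination of two eigenvectors is written as a sum over the booleans so
      that \<open>mean_at_zero_sum\<close> covers it.\<close>
    have "mean_at_zero bx t ee (\<lambda>i. \<Sum>a\<in>{True, False}. (if a then c1 else c2) * (if a then \<Psi>1 else \<Psi>2) i)"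
      by (rule mean_at_zero_sum)
        (use mean_at_zero_eigenvector[OF ee d(2,3)] mean_at_zero_eigenvector[OF ee d(4,5)] in auto)
    then show ?thesis by (simp add: d(1))
  qed
  have "L f = L (\<lambda>x. \<Sum>j=1..card X. dot X (v j) f * v j x)"
    by (rule lift_cong) (rule orthonormal_expansion[OF fin T(1)])
  also have "\<dots> = (\<lambda>i. \<Sum>j=1..card X. complex_of_real (dot X (v j) f) * L (v j) i)"
    by (rule lift_sum)
  finally have "L f = (\<lambda>i. \<Sum>j=1..card X. complex_of_real (dot X (v j) f) * L (v j) i)" .
  then show ?thesis by (simp only:) (rule mean_at_zero_sum, rule eigen)
qed

text \<open>Ancilla values below 2^k are those with estimate m = 0, and only they are counted. There
  the state is a + \<epsilon>, with a = cos |v_n> fixed by the mean, and |a|^2 <= 2 |a +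
  \<epsilon>|^2 + 2 |\<epsilon>|^2 is the origin of the factor 1/2.\<close>

lemma marked_after_estimation:
  assumes ee: "eigenvalue_estimation X bx k w W t ee"
  shows "(\<Sum>x\<in>M. \<Sum>y\<in>X. \<Sum>b<2 ^ k. (cmod (run X bx ee (L U) (x, y, b)))\<^sup>2)
    \<ge> (1 - sin2 s) * sin2 s / 2 - 2 * ((sin2 s)\<^sup>2 * extended_HT X P \<pi> M) / 4 ^ t"
proof -
  define a where "a = (\<lambda>i. complex_of_real (cosine s) * L (principal s) i)"
  define \<epsilon> where "\<epsilon> = (\<lambda>i. 1 / 2 ^ t * (\<Sum>l<2 ^ t. (W ^^ l) (L (rest s)) i))"
  let ?r = "run X bx ee (L U)"
  let ?S = "M \<times> X \<times> {..<2 ^ k}"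
  have LU: "L U = (\<lambda>i. complex_of_real (cosine s) * L (principal s) i + L (rest s) i)"
  proof -
    have "L U = L (\<lambda>x. cosine s * principal s x + rest s x)"
      by (rule lift_cong) (simp add: rest_def)
    then show ?thesis by (simp add: lift_add lift_scale)
  qed
  have pow: "(W ^^ l) (L U) = (\<lambda>i. a i + (W ^^ l) (L (rest s)) i)" for l
    unfolding LU a_def
    by (simp add: linear_op_add[OF linear_op_funpow[OF lin]] linear_op_scale[OF linear_op_funpow[OF lin]] pow_principal)
  have r: "?r (x, y, b) = a (x, y, b) + \<epsilon> (x, y, b)" if "b < 2 ^ k" for x y b
    using mean_at_zero_lift[OF ee, of U] that
    by (simp add: mean_at_zero_def pow \<epsilon>_def sum.distrib add_divide_distrib)
  have sub: "?S \<subseteq> B" using M_proper by (auto simp: basis_def)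
  have "nsq ?S a = nsq ?S (\<lambda>i. ?r i - \<epsilon> i)"
    unfolding nsq_def by (intro sum.cong) (auto simp: r)
  also have "\<dots> \<le> 2 * nsq ?S ?r + 2 * nsq ?S \<epsilon>"
    by (rule nsq_diff_le)
  also have "nsq ?S \<epsilon> \<le> nsq B \<epsilon>"
    unfolding nsq_def using fin_B sub by (intro sum_mono2) auto
  also have "nsq B \<epsilon> = 1 / 4 ^ t * nsq B (\<lambda>i. \<Sum>l<2 ^ t. (W ^^ l) (L (rest s)) i)"
  proof -
    have "((2::real) ^ t)\<^sup>2 = 4 ^ t" by (simp add: power2_eq_square flip: power_mult_distrib)
    then show ?thesis unfolding \<epsilon>_def nsq_scale by (simp add: norm_divide norm_power power_divide)
  qed
  also have "\<dots> \<le> 1 / 4 ^ t * (2 * ((sin2 s)\<^sup>2 * extended_HT X P \<pi> M))"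
    by (intro mult_left_mono nsq_pow_rest) auto
  finally have le: "nsq ?S a \<le> 2 * nsq ?S ?r + 2 * (1 / 4 ^ t * (2 * ((sin2 s)\<^sup>2 * extended_HT X P \<pi> M)))"
    by simp
  have z1: "(\<Sum>y\<in>X. (cmod (z y))\<^sup>2) = 1" using unit by (simp add: unit_vector_def)
  have "nsq ?S a = (\<Sum>x\<in>M. \<Sum>y\<in>X. \<Sum>b<2 ^ k. if b = (0::nat) then (cosine s)\<^sup>2 * (principal s x)\<^sup>2 * (cmod (z y))\<^sup>2 else 0)"
    unfolding nsq_def sum.cartesian_product
  proof (intro sum.cong refl)
    fix i assume "i \<in> M \<times> X \<times> {..<(2::nat) ^ k}"
    moreover obtain x y b where "i = (x, y, b)" by (rule prod_cases3)
    moreover have "x \<in> M \<Longrightarrow> x \<in> X" using M_proper by blast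
    ultimately show "(cmod (a i))\<^sup>2
        = (case i of (x, y, b) \<Rightarrow> if b = 0 then (cosine s)\<^sup>2 * (principal s x)\<^sup>2 * (cmod (z y))\<^sup>2 else 0)"
      by (auto simp: a_def lift_def norm_mult power_mult_distrib)
  qed
  also have "\<dots> = (cosine s)\<^sup>2 * (\<Sum>x\<in>M. (principal s x)\<^sup>2)"
    by (simp add: sum_distrib_left[symmetric] z1)
  finally have na: "nsq ?S a = (1 - sin2 s) * sin2 s"
    by (simp add: cosine_sq[OF s1] top_marked_mass[OF s1])
  have "nsq ?S ?r = (\<Sum>x\<in>M. \<Sum>y\<in>X. \<Sum>b<2 ^ k. (cmod (?r (x, y, b)))\<^sup>2)"
    by (simp add: nsq_def sum.cartesian_product case_prod_unfold)
  then show ?thesis using le na by simp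
qed

text \<open>The first measurement yields a marked vertex with weight pM. As states are not
  renormalised, its other outcome leaves \<open>sqrt (1 - pM)\<close> times |U>, so the second stage
  contributes its probability times 1 - pM.\<close>

lemma success_prob_lower_bound:
  assumes bx: "boxes_for X E P \<pi> M z bx" and ee: "eigenvalue_estimation X bx k w W t ee"
  shows "success_prob X bx z (k + t + 2, search_algorithm k t ee)
    \<ge> pM + (1 - pM) * ((1 - sin2 s) * sin2 s / 2 - 2 * ((sin2 s)\<^sup>2 * extended_HT X P \<pi> M) / 4 ^ t)"
proof -
  let ?n = "k + t"
  define \<psi> where "\<psi> = run X bx [Gate {} Setup, Gate {} (Check ?n)] (initial_state z)"
  define \<psi>0 where "\<psi>0 = (\<lambda>(u, v, a). if bit a ?n then 0 else \<psi> (u, v, a))"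
  define \<psi>1 where "\<psi>1 = (\<lambda>(u, v, a). if bit a ?n then \<psi> (u, v, a) else 0)"
  let ?r = "run X bx ee (L U)"
  have mk: "marked bx = M" using bx by (simp add: boxes_for_def)
  have setup_z: "mat_apply X (setup_mat bx) (\<lambda>x'. of_bool (a = 0) * (z x' * z y)) x
      = of_bool (a = (0::nat)) * z y * (if x \<in> X then complex_of_real (sqrt (\<pi> x)) else 0)" for x y a
  proof -
    have "mat_apply X (setup_mat bx) (\<lambda>x'. of_bool (a = 0) * z y * z x') x
        = of_bool (a = 0) * z y * mat_apply X (setup_mat bx) z x"
      by (simp add: linear_op_scale[OF mat_apply_linear])
    moreover have "mat_apply X (setup_mat bx) z x = (if x \<in> X then complex_of_real (sqrt (\<pi> x)) else 0)"
      using bx by (simp add: boxes_for_def mat_apply_def)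
    ultimately show ?thesis by (simp add: mult.commute mult.left_commute)
  qed
  have \<psi>: "\<psi> (x, y, a) = of_bool ((if x \<in> M then flip_bit ?n a else a) = 0) * z y *
      (if x \<in> X then complex_of_real (sqrt (\<pi> x)) else 0)" for x y a
    unfolding \<psi>_def by (simp add: initial_state_def setup_z mk)
  have "\<psi>0 (x, y, a) = complex_of_real (sqrt (1 - pM)) * L U (x, y, a)" for x y a
    using pM_less_1 not_bit_small[of 0 ?n ?n]
    by (auto simp: \<psi>0_def \<psi> lift_def unmarked_state_def flip_bit_eq_0_iff bit_exp_iff)
  then have \<psi>0: "\<psi>0 = (\<lambda>i. complex_of_real (sqrt (1 - pM)) * L U i)" by auto
  have out1: "\<pi> x \<le> output_prob X bx (k + t + 2) OutputVertex \<psi>1 x" if x: "x \<in> M" for x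
  proof -
    have xX: "x \<in> X" using x M_proper by auto
    have z1: "(\<Sum>y\<in>X. (cmod (z y))\<^sup>2) = 1" using unit by (simp add: unit_vector_def)
    \<comment> \<open>On a marked vertex the first \<open>Check\<close> turns the ancilla value 0
      into \<open>2 ^ ?n\<close>, so all the amplitude sits there.\<close>
    have "\<pi> x = (\<Sum>y\<in>X. (cmod (\<psi>1 (x, y, 2 ^ ?n)))\<^sup>2)"
      using x xX pi_nonneg[OF xX] z1
      by (simp add: \<psi>1_def \<psi> flip_bit_eq_0_iff bit_exp_iff norm_mult power_mult_distrib sum_distrib_right[symmetric])
    also have "\<dots> \<le> (\<Sum>y\<in>X. \<Sum>a<2 ^ (k + t + 2). (cmod (\<psi>1 (x, y, a)))\<^sup>2)"
      by (intro sum_mono member_le_sum) (auto simp: power_add)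
    finally show ?thesis by simp
  qed
  have out0: "(\<Sum>y\<in>X. \<Sum>b<2 ^ k. (1 - pM) * (cmod (?r (x, y, b)))\<^sup>2)
    \<le> output_prob X bx (k + t + 2) (Apply (ee @ [Gate {} (Check (?n + 1))])
             (Measure (?n + 1) NoMarkedVertex OutputVertex)) \<psi>0 x" if x: "x \<in> M" for x
  proof -
    define \<chi> where "\<chi> = (\<lambda>(u, v, a). if bit a (?n + 1)
      then run X bx (ee @ [Gate {} (Check (?n + 1))]) \<psi>0 (u, v, a) else 0)"
    have small: "b < 2 ^ (?n + 1)" if "b < 2 ^ k" for b :: nat
      using that by (rule less_le_trans) (intro power_increasing, auto)
    \<comment> \<open>On a marked vertex the second \<open>Check\<close> moves an ancilla value
      \<open>b\<close> below \<open>2 ^ k\<close> to \<open>b + 2 ^ (?n + 1)\<close>, and outcome 1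
      retains it. Other estimates only add to the probability.\<close>
    have \<chi>: "\<chi> (x, y, b + 2 ^ (?n + 1)) = complex_of_real (sqrt (1 - pM)) * ?r (x, y, b)"
      if b: "b < 2 ^ k" for y b
    proof -
      have f: "b + 2 ^ (?n + 1) = flip_bit (?n + 1) b" using flip_bit_small[OF small[OF b]] by simp
      have "bit (b + 2 ^ (?n + 1)) (?n + 1)"
        unfolding f using not_bit_small[OF small[OF b] order_refl] by (simp add: bit_flip_bit_iff)
      moreover have "flip_bit (?n + 1) (b + 2 ^ (?n + 1)) = b"
        unfolding f by (rule flip_bit_involution)
      ultimately show ?thesis
        unfolding \<chi>_def by (simp add: run_append \<psi>0 linear_op_scale[OF run_linear] mk x del: add_Suc_right)
    qed
    have \<chi>_norm: "(1 - pM) * (cmod (?r (x, y, b)))\<^sup>2 = (cmod (\<chi> (x, y, b + 2 ^ (?n + 1))))\<^sup>2"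
      if "b < 2 ^ k" for y b
      unfolding \<chi>[OF that] norm_mult power_mult_distrib using pM_less_1 by simp
    have "(\<Sum>y\<in>X. \<Sum>b<2 ^ k. (1 - pM) * (cmod (?r (x, y, b)))\<^sup>2)
        = (\<Sum>y\<in>X. \<Sum>b<2 ^ k. (cmod (\<chi> (x, y, b + 2 ^ (?n + 1))))\<^sup>2)"
      by (intro sum.cong refl \<chi>_norm) simp
    also have "\<dots> = (\<Sum>y\<in>X. \<Sum>a\<in>(\<lambda>b. b + 2 ^ (?n + 1)) ` {..<2 ^ k}. (cmod (\<chi> (x, y, a)))\<^sup>2)"
      by (subst sum.reindex) (auto simp: inj_on_def)
    also have "\<dots> \<le> (\<Sum>y\<in>X. \<Sum>a<2 ^ (k + t + 2). (cmod (\<chi> (x, y, a)))\<^sup>2)"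
    proof (intro sum_mono sum_mono2)
      have "b + 2 ^ (?n + 1) < 2 ^ (k + t + 2)" if "b < 2 ^ k" for b :: nat
        using small[OF that] by (simp add: power_add)
      then show "(\<lambda>b. b + 2 ^ (?n + 1)) ` {..<(2::nat) ^ k} \<subseteq> {..<2 ^ (k + t + 2)}"
        by blast
    qed auto
    finally show ?thesis by (simp add: \<chi>_def cong: if_cong)
  qed
  have "pM + (1 - pM) * ((1 - sin2 s) * sin2 s / 2 - 2 * ((sin2 s)\<^sup>2 * extended_HT X P \<pi> M) / 4 ^ t)
      \<le> pM + (1 - pM) * (\<Sum>x\<in>M. \<Sum>y\<in>X. \<Sum>b<2 ^ k. (cmod (?r (x, y, b)))\<^sup>2)"
    using marked_after_estimation[OF ee] pM_less_1 by (intro add_left_mono mult_left_mono) auto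
  also have "\<dots> = (\<Sum>x\<in>M. (\<Sum>y\<in>X. \<Sum>b<2 ^ k. (1 - pM) * (cmod (?r (x, y, b)))\<^sup>2) + \<pi> x)"
    by (simp add: sum.distrib sum_distrib_left marked_mass_def)
  also have "\<dots> \<le> success_prob X bx z (k + t + 2, search_algorithm k t ee)"
    unfolding success_prob_def mk search_algorithm_def prod.case output_prob.simps(1)[of X bx "k + t + 2" "[Gate {} Setup, Gate {} (Check (k + t))]"]
      output_prob.simps(2)[of X bx "k + t + 2" "k + t"]
    using out0 out1 unfolding \<psi>0_def \<psi>1_def \<psi>_def by (intro sum_mono add_mono) simp_all
  finally show ?thesis .
qed

end

section \<open>Eigenvalue estimation\<close>

lemma bit_pair:
  fixes m b :: nat
  assumes "b < 2 ^ k"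
  shows "bit (m * 2 ^ k + b) q \<longleftrightarrow> (if q < k then bit b q else bit m (q - k))"
proof (cases "q < k")
  case True
  have "take_bit k (m * 2 ^ k + b) = b" using assms by (simp add: take_bit_eq_mod)
  then show ?thesis using True bit_take_bit_iff[of k "m * 2 ^ k + b" q] by simp
next
  case False
  then obtain r where "q = k + r" by (metis le_add_diff_inverse not_less)
  then show ?thesis using assms by (simp add: bit_iff_odd power_add div_mult2_eq)
qed

lemma flip_bit_pair:
  fixes m b :: nat
  assumes "b < 2 ^ k" "q < k"
  shows "flip_bit q (m * 2 ^ k + b) = m * 2 ^ k + flip_bit q b"
  by (rule bit_eqI) (use assms flip_bit_less[OF assms] in \<open>auto simp: bit_flip_bit_iff bit_pair\<close>)

lemma div_mod_pair:
  fixes m b w :: nat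
  assumes "b < 2 ^ k" "j \<le> k"
  shows "(m * 2 ^ k + b) div 2 ^ j * 2 ^ j = m * 2 ^ k + b div 2 ^ j * 2 ^ j"
    and "(m * 2 ^ k + b) mod 2 ^ j = b mod 2 ^ j"
    and "w < 2 ^ j \<Longrightarrow> b div 2 ^ j * 2 ^ j + w < 2 ^ k"
proof -
  obtain r where k: "k = j + r" using assms(2) le_Suc_ex by blast
  have e: "m * 2 ^ k + b = (m * 2 ^ r) * 2 ^ j + b" by (simp add: k power_add)
  show "(m * 2 ^ k + b) div 2 ^ j * 2 ^ j = m * 2 ^ k + b div 2 ^ j * 2 ^ j"
  proof -
    have "(m * 2 ^ k + b) div 2 ^ j = m * 2 ^ r + b div 2 ^ j" unfolding e by simp
    then show ?thesis by (simp only:) (simp add: k power_add algebra_simps)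
  qed
  show "(m * 2 ^ k + b) mod 2 ^ j = b mod 2 ^ j"
    unfolding e by simp
  assume w: "w < 2 ^ j"
  have "b div 2 ^ j < 2 ^ r" using assms(1) by (simp add: k power_add less_mult_imp_div_less mult.commute)
  then have "b div 2 ^ j + 1 \<le> 2 ^ r" by simp
  then have "(b div 2 ^ j + 1) * 2 ^ j \<le> 2 ^ r * 2 ^ j" by (rule mult_le_mono1)
  then show "b div 2 ^ j * 2 ^ j + w < 2 ^ k" using w by (simp add: k power_add mult.commute)
qed

text \<open>\<open>\<psi>'\<close> is the part of \<open>\<psi>\<close> whose qubits \<open>k, k + 1, \<dots>\<close> encode \<open>m\<close>.\<close>

definition slice :: "nat \<Rightarrow> nat \<Rightarrow> 'v state \<Rightarrow> 'v state \<Rightarrow> bool" where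
  "slice k m \<psi> \<psi>' \<longleftrightarrow> (\<forall>x y b. b < 2 ^ k \<longrightarrow> \<psi>' (x, y, b) = \<psi> (x, y, m * 2 ^ k + b))"

lemma slice_prim:
  assumes "targets g \<subseteq> {..<k}" "slice k m \<psi> \<psi>'"
  shows "slice k m (prim_sem X bx g \<psi>) (prim_sem X bx g \<psi>')"
proof (cases g)
  case (Static j U)
  then have j: "j \<le> k" using assms(1) by (simp add: lessThan_subset_iff)
  show ?thesis unfolding slice_def
  proof (intro allI impI)
    fix x y b assume b: "b < (2::nat) ^ k"
    have "mat_apply (X \<times> {..<2 ^ j}) (U x) (\<lambda>(y', w). \<psi>' (x, y', b div 2 ^ j * 2 ^ j + w))
      = mat_apply (X \<times> {..<2 ^ j}) (U x) (\<lambda>(y', w). \<psi> (x, y', (m * 2 ^ k + b) div 2 ^ j * 2 ^ j + w))"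
      unfolding mat_apply_def
      by (intro ext if_cong refl sum.cong arg_cong2[where f = "(*)"])
        (use assms(2) div_mod_pair[OF b j] in \<open>auto simp: slice_def add.assoc\<close>)
    then show "prim_sem X bx g \<psi>' (x, y, b) = prim_sem X bx g \<psi> (x, y, m * 2 ^ k + b)"
      by (simp add: Static div_mod_pair[OF b j])
  qed
next
  case (Check q)
  then have q: "q < k" using assms(1) by simp
  then show ?thesis using assms(2) flip_bit_pair[OF _ q] flip_bit_less[OF _ q]
    by (auto simp: slice_def Check)
next
  case Shift
  then show ?thesis using assms(2) by (auto simp: slice_def shift_op_eq shift3_def)
qed (use assms(2) in \<open>auto simp: slice_def mat_apply_def case_prod_unfold\<close>)

lemma slice_gate:
  assumes "wf_gate X k (Gate Q g)" "slice k m \<psi> \<psi>'"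
  shows "slice k m (gate_sem X bx (Gate Q g) \<psi>) (gate_sem X bx (Gate Q g) \<psi>')"
proof -
  have "targets g \<subseteq> {..<k}" and Q: "Q \<subseteq> {..<k}" using assms(1) by auto
  then have s: "slice k m (prim_sem X bx g \<psi>) (prim_sem X bx g \<psi>')"
    using slice_prim assms(2) by blast
  have "(\<forall>q\<in>Q. bit (m * 2 ^ k + b) q) \<longleftrightarrow> (\<forall>q\<in>Q. bit b q)" if "b < 2 ^ k" for b
    using Q that by (auto simp: bit_pair)
  then show ?thesis using s assms(2) by (auto simp: slice_def)
qed

lemma slice_controlled_gate:
  assumes "wf_gate X k g" "slice k m \<psi> \<psi>'" "k \<le> q"
  shows "slice k m (gate_sem X bx (control_gate q g) \<psi>)
    (if bit m (q - k) then gate_sem X bx g \<psi>' else \<psi>')"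
proof (cases g)
  case (Gate Q p)
  have "bit (m * 2 ^ k + b) q \<longleftrightarrow> bit m (q - k)" if "b < 2 ^ k" for b
    using that assms(3) by (auto simp: bit_pair)
  then show ?thesis
    using slice_gate[OF assms(1,2)[unfolded Gate], of bx] assms(2) by (auto simp: slice_def Gate)
qed

text \<open>The circuit touches only qubits below k, while the control qubit q is constant on a
  slice, with value bit q - k of m; so each slice sees either the whole circuit or nothing.\<close>

lemma slice_controlled:
  assumes "wf_circuit X k w" "slice k m \<psi> \<psi>'" "k \<le> q"
  shows "slice k m (run X bx (controlled q w) \<psi>) (if bit m (q - k) then run X bx w \<psi>' else \<psi>')"
  using assms(1,2)
proof (induction w arbitrary: \<psi> \<psi>')
  case Nil
  then show ?case by (simp add: controlled_def)
next
  case (Cons g w)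
  have wf: "wf_gate X k g" "wf_circuit X k w" using Cons.prems(1) by (auto simp: wf_circuit_def)
  have "slice k m (run X bx (controlled q w) (gate_sem X bx (control_gate q g) \<psi>))
    (if bit m (q - k) then run X bx w (if bit m (q - k) then gate_sem X bx g \<psi>' else \<psi>')
     else (if bit m (q - k) then gate_sem X bx g \<psi>' else \<psi>'))"
    by (rule Cons.IH[OF wf(2) slice_controlled_gate[OF wf(1) Cons.prems(2) assms(3)]])
  then show ?case by (cases "bit m (q - k)") (simp_all add: controlled_def)
qed

text \<open>The product of the walk state \<open>\<Psi>\<close> with the state \<open>c\<close> of
  the estimate register.\<close>

definition with_estimate :: "nat \<Rightarrow> nat \<Rightarrow> 'v state \<Rightarrow> (nat \<Rightarrow> complex) \<Rightarrow> 'v state" where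
  "with_estimate k t \<Psi> c = (\<lambda>(x, y, a). if a < 2 ^ (k + t) then \<Psi> (x, y, a mod 2 ^ k) * c (a div 2 ^ k) else 0)"

lemma with_estimate_cong:
  "(\<And>m. m < 2 ^ t \<Longrightarrow> c m = c' m) \<Longrightarrow> with_estimate k t \<Psi> c = with_estimate k t \<Psi> c'"
  by (auto simp: with_estimate_def fun_eq_iff power_add less_mult_imp_div_less mult.commute)

lemma with_estimate_zero:
  assumes "supported_on (basis X k) \<Psi>"
  shows "\<Psi> = with_estimate k t \<Psi> (\<lambda>m. of_bool (m = 0))"
proof (rule ext, clarify)
  fix x y and a :: nat
  show "\<Psi> (x, y, a) = with_estimate k t \<Psi> (\<lambda>m. of_bool (m = 0)) (x, y, a)"
  proof (cases "a < 2 ^ k")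
    case True
    moreover have "a < 2 ^ (k + t)" using True by (rule less_le_trans) simp
    ultimately show ?thesis by (simp add: with_estimate_def)
  next
    case False
    then have "a div 2 ^ k \<noteq> 0" by (simp add: div_eq_0_iff)
    moreover have "\<Psi> (x, y, a) = 0" using assms False by (auto simp: supported_on_def basis_def)
    ultimately show ?thesis by (simp add: with_estimate_def)
  qed
qed

text \<open>Phase kickback: on an eigenvector, the controlled walk multiplies the amplitude of those
  m whose bit j is set by the eigenvalue.\<close>

lemma run_controlled_walk:
  assumes w: "implements X bx k w W" and \<Psi>: "supported_on (basis X k) \<Psi>"
    and eig: "W \<Psi> = (\<lambda>i. \<mu> * \<Psi> i)"
  shows "run X bx (controlled (k + j) w) (with_estimate k t \<Psi> c)
    = with_estimate k t \<Psi> (\<lambda>m. c m * (if bit m j then \<mu> else 1))"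
proof (rule ext, clarify)
  fix x y and a :: nat
  define m where "m = a div 2 ^ k"
  define b where "b = a mod 2 ^ k"
  have a: "a = m * 2 ^ k + b" "b < 2 ^ k"
    unfolding m_def b_def by (rule div_mult_mod_eq[symmetric]) simp
  \<comment> \<open>The value 0 for \<open>m \<ge> 2 ^ t\<close> lets one slice argument cover also
    the ancilla values outside the estimate register.\<close>
  define e where "e = (if m < 2 ^ t then c m else 0)"
  have lt: "m * 2 ^ k + b' < 2 ^ (k + t) \<longleftrightarrow> m < 2 ^ t" if "b' < 2 ^ k" for b'
  proof -
    have "m * 2 ^ k + b' < 2 ^ (k + t) \<longleftrightarrow> (m * 2 ^ k + b') div 2 ^ k < 2 ^ t"
      using div_less_iff_less_mult[of "2 ^ k" "m * 2 ^ k + b'" "2 ^ t"] by (simp add: power_add mult.commute del: div_mult_self1 div_mult_self2 div_mult_self3 div_mult_self4)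
    then show ?thesis using that by simp
  qed
  have s: "slice k m (with_estimate k t \<Psi> c) (\<lambda>i. e * \<Psi> i)"
    using lt by (auto simp: slice_def with_estimate_def e_def)
  have run: "run X bx w (\<lambda>i. e * \<Psi> i) = (\<lambda>i. e * (\<mu> * \<Psi> i))"
    using w \<Psi> by (simp add: linear_op_scale[OF run_linear] implements_def eig)
  have "slice k m (run X bx (controlled (k + j) w) (with_estimate k t \<Psi> c))
      (if bit m j then (\<lambda>i. e * (\<mu> * \<Psi> i)) else (\<lambda>i. e * \<Psi> i))"
    using slice_controlled[OF _ s, of X w "k + j" bx] w unfolding run by (simp add: implements_def)
  then have "run X bx (controlled (k + j) w) (with_estimate k t \<Psi> c) (x, y, a)
      = (if bit m j then e * (\<mu> * \<Psi> (x, y, b)) else e * \<Psi> (x, y, b))"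
    using a by (simp add: slice_def split: if_splits)
  also have "\<dots> = with_estimate k t \<Psi> (\<lambda>m. c m * (if bit m j then \<mu> else 1)) (x, y, a)"
    using lt[OF a(2)] a by (simp add: with_estimate_def e_def)
  finally show "run X bx (controlled (k + j) w) (with_estimate k t \<Psi> c) (x, y, a)
      = with_estimate k t \<Psi> (\<lambda>m. c m * (if bit m j then \<mu> else 1)) (x, y, a)" .
qed

section \<open>Unitaries on the estimate register as static gates\<close>

lemma sum_pairs:
  "(\<Sum>a<2 ^ (k + t). G (a mod 2 ^ k) (a div 2 ^ k)) = (\<Sum>b<2 ^ k. \<Sum>l<2 ^ t. G b l)"
  for G :: "nat \<Rightarrow> nat \<Rightarrow> complex"
proof -
  have "(\<Sum>b<2 ^ k. \<Sum>l<2 ^ t. G b l) = (\<Sum>(b, l)\<in>{..<2 ^ k} \<times> {..<2 ^ t}. G b l)"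
    by (simp add: sum.cartesian_product)
  also have "\<dots> = (\<Sum>a<2 ^ (k + t). G (a mod 2 ^ k) (a div 2 ^ k))"
  proof (rule sum.reindex_bij_witness[where i = "\<lambda>a. (a mod 2 ^ k, a div 2 ^ k)" and j = "\<lambda>(b, l). l * 2 ^ k + b"])
    fix p :: "nat \<times> nat" assume p: "p \<in> {..<2 ^ k} \<times> {..<2 ^ t}"
    then obtain b l where bl: "p = (b, l)" "b < 2 ^ k" "l < 2 ^ t" by auto
    have "l * 2 ^ k + b < 2 ^ (k + t)"
    proof -
      have "(l + 1) * 2 ^ k \<le> 2 ^ t * 2 ^ k" using bl(3) by (intro mult_le_mono1) simp
      then show ?thesis using bl(2) by (simp add: power_add mult.commute)
    qed
    then show "(case p of (b, l) \<Rightarrow> l * 2 ^ k + b) \<in> {..<2 ^ (k + t)}" by (simp add: bl)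
  qed (auto simp: power_add less_mult_imp_div_less mult.commute)
  finally show ?thesis by simp
qed

text \<open>The matrix of I tensor F. A static gate on k + t qubits also sees the second register
  and the k work qubits, on which the identity is imposed by the two equations in the test.\<close>

definition on_estimate :: "nat \<Rightarrow> (nat \<Rightarrow> nat \<Rightarrow> complex) \<Rightarrow> 'v \<Rightarrow> ('v \<times> nat) cmat" where
  "on_estimate k F x = (\<lambda>(y, a) (y', a').
     if y = y' \<and> a mod 2 ^ k = a' mod 2 ^ k then F (a div 2 ^ k) (a' div 2 ^ k) else 0)"

lemma sum_on_estimate:
  fixes G :: "nat \<Rightarrow> complex"
  assumes "finite X" "y \<in> X"
  shows "(\<Sum>(y', a')\<in>X \<times> {..<2 ^ (k + t)}. if y = y' \<and> a mod 2 ^ k = a' mod 2 ^ k then G (a' div 2 ^ k) else 0)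
    = (\<Sum>l<2 ^ t. G l)"
proof -
  have "(\<Sum>(y', a')\<in>X \<times> {..<2 ^ (k + t)}. if y = y' \<and> a mod 2 ^ k = a' mod 2 ^ k then G (a' div 2 ^ k) else 0)
      = (\<Sum>y'\<in>X. if y = y' then \<Sum>a'<2 ^ (k + t). if a mod 2 ^ k = a' mod 2 ^ k then G (a' div 2 ^ k) else 0 else 0)"
    unfolding sum.cartesian_product[symmetric] by (intro sum.cong) (auto intro!: sum.neutral)
  also have "\<dots> = (\<Sum>a'<2 ^ (k + t). if a mod 2 ^ k = a' mod 2 ^ k then G (a' div 2 ^ k) else 0)"
    using assms by simp
  also have "\<dots> = (\<Sum>b<2 ^ k. \<Sum>l<2 ^ t. if a mod 2 ^ k = b then G l else 0)"
    by (rule sum_pairs)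
  also have "\<dots> = (\<Sum>b<2 ^ k. if a mod 2 ^ k = b then (\<Sum>l<2 ^ t. G l) else 0)"
    by (intro sum.cong) (auto intro!: sum.neutral)
  also have "\<dots> = (\<Sum>l<2 ^ t. G l)" by simp
  finally show ?thesis .
qed

lemma unitary_on_estimate:
  fixes X :: "'v set"
  assumes fin: "finite X" and F: "unitary_on {..<2 ^ t} F"
  shows "unitary_on (X \<times> {..<2 ^ (k + t)}) (on_estimate k F x)"
proof -
  let ?S = "X \<times> {..<(2::nat) ^ (k + t)}"
  define row :: "'v \<Rightarrow> nat \<Rightarrow> (nat \<Rightarrow> complex) \<Rightarrow> 'v \<times> nat \<Rightarrow> complex" where "row = (\<lambda>y a h (y', l). if y = y' \<and> a mod 2 ^ k = l mod 2 ^ k then h (l div 2 ^ k) else (0::complex))"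
  have lt: "a div 2 ^ k < 2 ^ t" if "a < 2 ^ (k + t)" for a :: nat
    using that by (simp add: power_add less_mult_imp_div_less mult.commute)
  have pair_eq: "(a div 2 ^ k = a' div 2 ^ k \<and> a mod 2 ^ k = a' mod 2 ^ k) = (a = a')" for a a' :: nat
    by (metis div_mult_mod_eq)
  \<comment> \<open>The functions \<open>H\<close> and \<open>H'\<close> stand for rows or columns
    of F, conjugated as needed, so that both unitarity equations are instances of one claim.\<close>
  have main: "(\<Sum>p\<in>?S. row y a (H (a div 2 ^ k)) p * row y2 a2 (H' (a2 div 2 ^ k)) p) = of_bool ((y, a) = (y2, a2))"
    if ya: "y \<in> X" "a < 2 ^ (k + t)" "a2 < 2 ^ (k + t)"
      and H: "\<And>i j. i < 2 ^ t \<Longrightarrow> j < 2 ^ t \<Longrightarrow> (\<Sum>l<2 ^ t. H i l * H' j l) = of_bool (i = j)"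
    for y y2 a a2 and H H' :: "nat \<Rightarrow> nat \<Rightarrow> complex"
  proof (cases "y = y2 \<and> a mod 2 ^ k = a2 mod 2 ^ k")
    case True
    then have "(\<Sum>p\<in>?S. row y a (H (a div 2 ^ k)) p * row y2 a2 (H' (a2 div 2 ^ k)) p)
      = (\<Sum>(y', l)\<in>?S. if y = y' \<and> a mod 2 ^ k = l mod 2 ^ k then H (a div 2 ^ k) (l div 2 ^ k) * H' (a2 div 2 ^ k) (l div 2 ^ k) else 0)"
      by (intro sum.cong) (auto simp: row_def)
    also have "\<dots> = (\<Sum>l<2 ^ t. H (a div 2 ^ k) l * H' (a2 div 2 ^ k) l)"
      by (rule sum_on_estimate[OF fin ya(1)])
    also have "\<dots> = of_bool (a div 2 ^ k = a2 div 2 ^ k)" by (rule H) (use lt ya in auto)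
    also have "\<dots> = of_bool ((y, a) = (y2, a2))" using True pair_eq[of a a2] by auto
    finally show ?thesis .
  next
    case False
    then have "(\<Sum>p\<in>?S. row y a (H (a div 2 ^ k)) p * row y2 a2 (H' (a2 div 2 ^ k)) p) = 0"
      by (intro sum.neutral) (auto simp: row_def)
    then show ?thesis using False by auto
  qed
  show ?thesis
    unfolding unitary_on_def
  proof (intro conjI ballI)
    fix i j assume i: "i \<in> ?S" and j: "j \<in> ?S"
    obtain y a y2 a2 where ij: "i = (y, a)" "j = (y2, a2)" by (metis surj_pair)
    have "(\<Sum>l\<in>?S. cnj (on_estimate k F x l i) * on_estimate k F x l j)
      = (\<Sum>p\<in>?S. row y a (\<lambda>l. cnj (F l (a div 2 ^ k))) p * row y2 a2 (\<lambda>l. F l (a2 div 2 ^ k)) p)"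
      by (intro sum.cong) (auto simp: on_estimate_def row_def ij split: if_splits)
    also have "\<dots> = of_bool (i = j)"
      unfolding ij by (rule main[where H = "\<lambda>i l. cnj (F l i)" and H' = "\<lambda>j l. F l j"])
        (use i j F in \<open>auto simp: ij unitary_on_def\<close>)
    finally show "(\<Sum>l\<in>?S. cnj (on_estimate k F x l i) * on_estimate k F x l j) = of_bool (i = j)" .
    have "(\<Sum>l\<in>?S. on_estimate k F x i l * cnj (on_estimate k F x j l))
      = (\<Sum>p\<in>?S. row y a (F (a div 2 ^ k)) p * row y2 a2 (\<lambda>l. cnj (F (a2 div 2 ^ k) l)) p)"
      by (intro sum.cong) (auto simp: on_estimate_def row_def ij split: if_splits)
    also have "\<dots> = of_bool (i = j)"
      unfolding ij by (rule main[where H = F and H' = "\<lambda>j l. cnj (F j l)"])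
        (use i j F in \<open>auto simp: ij unitary_on_def\<close>)
    finally show "(\<Sum>l\<in>?S. on_estimate k F x i l * cnj (on_estimate k F x j l)) = of_bool (i = j)" .
  qed
qed

lemma run_on_estimate:
  assumes fin: "finite X" and \<Psi>: "supported_on (basis X k) \<Psi>"
  shows "gate_sem X bx (Gate {} (Static (k + t) (on_estimate k F))) (with_estimate k t \<Psi> c)
    = with_estimate k t \<Psi> (\<lambda>m. \<Sum>l<2 ^ t. F m l * c l)"
proof (rule ext, clarify)
  fix x y and a :: nat
  let ?lhs = "gate_sem X bx (Gate {} (Static (k + t) (on_estimate k F))) (with_estimate k t \<Psi> c) (x, y, a)"
  show "?lhs = with_estimate k t \<Psi> (\<lambda>m. \<Sum>l<2 ^ t. F m l * c l) (x, y, a)"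
  proof (cases "a < 2 ^ (k + t) \<and> y \<in> X")
    case True
    have "?lhs = (\<Sum>p\<in>X \<times> {..<2 ^ (k + t)}. on_estimate k F x (y, a) p *
        (case p of (y', w) \<Rightarrow> with_estimate k t \<Psi> c (x, y', w)))"
      using True by (simp add: mat_apply_def)
    also have "\<dots> = (\<Sum>(y', w)\<in>X \<times> {..<2 ^ (k + t)}. if y = y' \<and> a mod 2 ^ k = w mod 2 ^ k
        then \<Psi> (x, y, a mod 2 ^ k) * (F (a div 2 ^ k) (w div 2 ^ k) * c (w div 2 ^ k)) else 0)"
      by (intro sum.cong) (auto simp: on_estimate_def with_estimate_def)
    also have "\<dots> = (\<Sum>l<2 ^ t. \<Psi> (x, y, a mod 2 ^ k) * (F (a div 2 ^ k) l * c l))"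
      by (rule sum_on_estimate[OF fin]) (use True in simp)
    also have "\<dots> = with_estimate k t \<Psi> (\<lambda>m. \<Sum>l<2 ^ t. F m l * c l) (x, y, a)"
      using True by (simp add: with_estimate_def sum_distrib_left)
    finally show ?thesis .
  next
    case False
    have r: "with_estimate k t \<Psi> c' (x, y, a) = 0" for c'
      using False \<Psi> by (auto simp: with_estimate_def supported_on_def basis_def)
    have "?lhs = 0"
    proof (cases "y \<in> X")
      case True
      then have "\<not> a < 2 ^ (k + t)" using False by simp
      then have "\<not> a div 2 ^ (k + t) * 2 ^ (k + t) + w < 2 ^ (k + t)" for w
        by (simp add: not_less) (metis One_nat_def Suc_leI add_leD1 div_greater_zero_iff le_add1 mult_le_mono1 nat_mult_1 order_trans zero_less_numeral zero_less_power)
      then show ?thesis by (simp add: mat_apply_def with_estimate_def case_prod_unfold)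
    qed (simp add: mat_apply_def)
    then show ?thesis by (simp add: r)
  qed
qed

section \<open>The Fourier matrix and the estimation circuit\<close>

definition fourier :: "nat \<Rightarrow> nat \<Rightarrow> nat \<Rightarrow> complex" where
  "fourier t m l = cis (2 * pi * real m * real l / 2 ^ t) / sqrt (2 ^ t)"

lemma fourier_sym: "fourier t m l = fourier t l m"
  by (simp add: fourier_def mult.commute mult.left_commute)

text \<open>The sum is geometric, its ratio \<open>r\<close> being a quotient of two roots of unity
  of order dividing 2^t. Distinct indices give \<open>r \<noteq> 1\<close>, while
  \<open>r ^ 2 ^ t = 1\<close>.\<close>

lemma fourier_rows:
  assumes "i < 2 ^ t" "j < 2 ^ t"
  shows "(\<Sum>l<2 ^ t. fourier t i l * cnj (fourier t j l)) = of_bool (i = j)"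
proof -
  define \<omega> where "\<omega> = (\<lambda>m::nat. cis (2 * pi * real m / real (2 ^ t)))"
  define r where "r = \<omega> i * cnj (\<omega> j)"
  have F: "fourier t m l = \<omega> m ^ l / sqrt (2 ^ t)" for m l
    by (simp add: fourier_def \<omega>_def DeMoivre mult.commute mult.left_commute)
  have sq: "complex_of_real (sqrt (2 ^ t)) * complex_of_real (sqrt (2 ^ t)) = 2 ^ t"
    by (simp flip: of_real_mult)
  have "(\<Sum>l<2 ^ t. fourier t i l * cnj (fourier t j l)) = (\<Sum>l<2 ^ t. r ^ l) / 2 ^ t"
    unfolding sum_divide_distrib
    by (intro sum.cong) (auto simp: F r_def power_mult_distrib sq)
  also have "\<dots> = of_bool (i = j)"
  proof (cases "i = j")
    case True
    have "r = 1" by (simp add: r_def True \<omega>_def cis_cnj cis_mult)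
    then show ?thesis using True by simp
  next
    case False
    have bij: "bij_betw \<omega> {..<2 ^ t} {z. z ^ (2 ^ t) = 1}"
      unfolding \<omega>_def by (rule bij_betw_roots_unity) simp
    then have "\<omega> i \<noteq> \<omega> j" using False assms by (auto simp: bij_betw_def inj_on_def)
    moreover have c1: "cnj (\<omega> j) * \<omega> j = 1" by (simp add: \<omega>_def cis_cnj cis_mult)
    ultimately have "r \<noteq> 1" unfolding r_def
      by (metis mult.assoc mult.left_neutral mult.right_neutral)
    moreover have "\<omega> i ^ 2 ^ t = 1" "\<omega> j ^ 2 ^ t = 1"
      using bij assms by (auto simp: bij_betw_def)
    then have "r ^ 2 ^ t = 1" by (simp add: r_def power_mult_distrib flip: complex_cnj_power)
    ultimately have "(\<Sum>l<2 ^ t. r ^ l) = 0" by (simp add: sum_gp_strict)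
    then show ?thesis using False by simp
  qed
  finally show ?thesis .
qed

lemma fourier_unitary: "unitary_on {..<2 ^ t} (fourier t)"
  unfolding unitary_on_def
proof (intro conjI ballI)
  fix i j :: nat assume ij: "i \<in> {..<2 ^ t}" "j \<in> {..<2 ^ t}"
  then show "(\<Sum>l<2 ^ t. fourier t i l * cnj (fourier t j l)) = of_bool (i = j)"
    by (simp add: fourier_rows)
  have "(\<Sum>l<2 ^ t. cnj (fourier t l i) * fourier t l j) = (\<Sum>l<2 ^ t. fourier t j l * cnj (fourier t i l))"
    by (intro sum.cong) (auto simp: fourier_sym[of t _ i] fourier_sym[of t _ j])
  then show "(\<Sum>l<2 ^ t. cnj (fourier t l i) * fourier t l j) = of_bool (i = j)"
    using ij by (simp add: fourier_rows eq_commute)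
qed

lemma fourier_cnj_unitary: "unitary_on {..<2 ^ t} (\<lambda>i j. cnj (fourier t i j))"
proof -
  have "(\<lambda>i j. cnj (fourier t i j)) = adjoint_mat (fourier t)"
    by (intro ext) (simp add: adjoint_mat_def fourier_sym)
  then show ?thesis using unitary_on_adjoint[OF fourier_unitary] by simp
qed

text \<open>Textbook phase estimation. On |0> the Fourier matrix gives the uniform superposition, so
  it takes the place of Hadamard gates; qubit k + j controls 2^j calls of the walk, which makes 2^t
  - 1 calls in all.\<close>

definition estimation_steps :: "nat \<Rightarrow> nat \<Rightarrow> 'v estep list" where
  "estimation_steps k t = FreeStep (on_estimate k (fourier t)) #
     concat (map (\<lambda>j. replicate (2 ^ j) (CallWalk (k + j))) [0..<t]) @
     [FreeStep (on_estimate k (\<lambda>i j. cnj (fourier t i j)))]"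

definition estimation_circuit :: "nat \<Rightarrow> nat \<Rightarrow> 'v circuit \<Rightarrow> 'v circuit" where
  "estimation_circuit k t w = concat (map (expand_step k t w) (estimation_steps k t))"

text \<open>The j-th block contributes 2^j to the exponent exactly when bit j of m is set, so n
  blocks produce the number formed by the lowest n bits of m.\<close>

lemma call_steps:
  assumes w: "implements X bx k w W" and \<Psi>: "supported_on (basis X k) \<Psi>"
    and eig: "W \<Psi> = (\<lambda>i. \<mu> * \<Psi> i)"
  shows "run X bx (concat (map (expand_step k t w) (concat (map (\<lambda>j. replicate (2 ^ j) (CallWalk (k + j))) [0..<n]))))
      (with_estimate k t \<Psi> c) = with_estimate k t \<Psi> (\<lambda>m. c m * \<mu> ^ take_bit n m)"
proof (induction n)
  case 0
  then show ?case by simp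
next
  case (Suc n)
  have rep: "run X bx (concat (replicate r (controlled (k + n) w))) (with_estimate k t \<Psi> d)
      = with_estimate k t \<Psi> (\<lambda>m. d m * (if bit m n then \<mu> ^ r else 1))" for r d
  proof (induction r arbitrary: d)
    case 0
    then show ?case by (simp cong: if_cong)
  next
    case (Suc r)
    show ?case
      unfolding replicate_Suc concat.simps run_append run_controlled_walk[OF w \<Psi> eig] Suc.IH
      by (rule with_estimate_cong) simp
  qed
  show ?case
    by (simp add: run_append Suc.IH rep)
      (rule with_estimate_cong, simp add: take_bit_Suc_from_most power_add)
qed

lemma eigenvalue_estimation_exists:
  fixes X :: "'v set"
  assumes fin: "finite X" and w: "implements X bx k w W"
  shows "eigenvalue_estimation X bx k w W t (estimation_circuit k t w)"
  unfolding eigenvalue_estimation_def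
proof (intro conjI exI[of _ "estimation_steps k t"] allI impI)
  show "estimation_circuit k t w = concat (map (expand_step k t w) (estimation_steps k t))"
    by (simp add: estimation_circuit_def)
  show "k \<le> q" "q < k + t" if "CallWalk q \<in> set (estimation_steps k t :: 'v estep list)" for q
    using that by (auto simp: estimation_steps_def)
  have "length (filter is_call (concat (map (\<lambda>j. replicate (2 ^ j) (CallWalk (k + j))) [0..<n]) :: 'v estep list)) = 2 ^ n - 1" for n
    by (induction n) (simp_all add: is_call_def)
  then show "length (filter is_call (estimation_steps k t :: 'v estep list)) \<le> 2 ^ t"
    by (simp add: estimation_steps_def is_call_def)
  have wf_w: "wf_circuit X k w" using w by (simp add: implements_def)
  have wf_controlled: "wf_circuit X (k + t) (controlled (k + j) w)" if j: "j < t" for j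
    unfolding wf_circuit_def
  proof
    fix g assume "g \<in> set (controlled (k + j) w)"
    then obtain Q p where g: "g = Gate (insert (k + j) Q) p" "Gate Q p \<in> set w"
      unfolding controlled_def by (metis (no_types, lifting) control_gate.simps gate.exhaust image_iff list.set_map)
    from wf_w g(2) have "wf_gate X k (Gate Q p)" by (auto simp: wf_circuit_def simp del: wf_gate.simps)
    then have "targets p \<subseteq> {..<k}" "Q \<subseteq> {..<k}" "Q \<inter> targets p = {}" "unitary_prim X p"
      by auto
    then show "wf_gate X (k + t) g" using j by (auto simp: g)
  qed
  show "wf_circuit X (k + t) (estimation_circuit k t w)"
    using wf_controlled unitary_on_estimate[OF fin fourier_unitary] unitary_on_estimate[OF fin fourier_cnj_unitary]
    by (auto simp: estimation_circuit_def estimation_steps_def wf_circuit_def)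
  fix \<Psi> \<phi>
  assume *: "supported_on (basis X k) \<Psi> \<and> \<Psi> \<noteq> (\<lambda>_. 0) \<and> W \<Psi> = (\<lambda>i. cis \<phi> * \<Psi> i)"
  then have \<Psi>: "supported_on (basis X k) \<Psi>" and eig: "W \<Psi> = (\<lambda>i. cis \<phi> * \<Psi> i)" by auto
  let ?out = "\<lambda>(x, y, a). let m = a div 2 ^ k in
      if m < 2 ^ t
      then \<Psi> (x, y, a mod 2 ^ k) *
        (1 / 2 ^ t * (\<Sum>l<2 ^ t. exp (- 2 * pi * \<i> * of_nat l * of_nat m / 2 ^ t) * exp (\<i> * \<phi> * of_nat l)))
      else 0"
  have sq: "complex_of_real (sqrt (2 ^ t)) * complex_of_real (sqrt (2 ^ t)) = 2 ^ t"
    by (simp flip: of_real_mult)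
  \<comment> \<open>The factor \<open>2 ^ t\<close> compensates the factors 1 / sqrt(2^t) of the two
    Fourier matrices and cancels against the 1 / 2^t of the specification.\<close>
  have expo: "exp (- 2 * pi * \<i> * of_nat l * of_nat m / 2 ^ t) * exp (\<i> * \<phi> * of_nat l)
      = 2 ^ t * (cnj (fourier t m l) * (fourier t l 0 * cis \<phi> ^ l))" for l m
  proof -
    have "cnj (fourier t m l) = exp (- 2 * pi * \<i> * of_nat l * of_nat m / 2 ^ t) / sqrt (2 ^ t)"
    proof -
      have "cnj (fourier t m l) = cis (- (2 * pi * real m * real l / 2 ^ t)) / sqrt (2 ^ t)"
        by (simp add: fourier_def cis_cnj)
      then show ?thesis by (simp add: cis_conv_exp mult.commute mult.left_commute)
    qed
    moreover have "fourier t l 0 = 1 / sqrt (2 ^ t)" by (simp add: fourier_def)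
    moreover have "cis \<phi> ^ l = exp (\<i> * \<phi> * of_nat l)"
      by (simp add: cis_conv_exp exp_of_nat_mult[symmetric] mult.commute)
    ultimately show ?thesis by (simp add: sq[symmetric])
  qed
  define c where "c = (\<lambda>m. \<Sum>l<2 ^ t. cnj (fourier t m l) * (fourier t l 0 * cis \<phi> ^ l))"
  have "run X bx (estimation_circuit k t w) (with_estimate k t \<Psi> (\<lambda>m. of_bool (m = 0)))
      = with_estimate k t \<Psi> (\<lambda>m. \<Sum>l<2 ^ t. cnj (fourier t m l) *
          ((\<Sum>l'<2 ^ t. fourier t l l' * of_bool (l' = 0)) * cis \<phi> ^ take_bit t l))"
    by (simp add: estimation_circuit_def estimation_steps_def run_append run_on_estimate[OF fin \<Psi>]
        call_steps[OF w \<Psi> eig] del: gate_sem.simps)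
  also have "\<dots> = with_estimate k t \<Psi> c"
  proof (rule with_estimate_cong)
    fix m
    have "(\<Sum>l'<2 ^ t. fourier t l l' * of_bool (l' = 0)) = fourier t l 0" for l
    proof -
      have "(\<Sum>l'<2 ^ t. fourier t l l' * of_bool (l' = 0)) = (\<Sum>l'<2 ^ t. if l' = 0 then fourier t l l' else 0)"
        by (intro sum.cong) auto
      then show ?thesis by (subst (asm) sum.delta) auto
    qed
    then show "(\<Sum>l<2 ^ t. cnj (fourier t m l) *
          ((\<Sum>l'<2 ^ t. fourier t l l' * of_bool (l' = 0)) * cis \<phi> ^ take_bit t l)) = c m"
      unfolding c_def by (intro sum.cong) (auto simp: take_bit_nat_eq_self)
  qed
  finally have "run X bx (estimation_circuit k t w) \<Psi> = with_estimate k t \<Psi> c"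
    using with_estimate_zero[OF \<Psi>, of t] by simp
  also have "\<dots> = ?out"
    unfolding expo sum_distrib_left[symmetric] c_def[symmetric]
    by (auto simp: with_estimate_def fun_eq_iff c_def Let_def power_add div_less_iff_less_mult mult.commute)
  finally show "run X bx (estimation_circuit k t w) \<Psi> = ?out" .
qed

lemma estimation_circuit_cost:
  fixes w :: "'v circuit"
  shows "(\<Sum>g\<leftarrow>estimation_circuit k t w. gate_cost S U C g) = (2 ^ t - 1) * (\<Sum>g\<leftarrow>w. gate_cost S U C g)"
proof -
  have ctl: "(\<Sum>g\<leftarrow>controlled q w. gate_cost S U C g) = (\<Sum>g\<leftarrow>w. gate_cost S U C g)" for q
  proof -
    have "gate_cost S U C (control_gate q g) = gate_cost S U C g" for g :: "'v gate"
      by (cases g) simp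
    then show ?thesis by (simp add: controlled_def o_def)
  qed
  have rep: "(\<Sum>g\<leftarrow>concat (replicate r (controlled q w)). gate_cost S U C g)
      = real r * (\<Sum>g\<leftarrow>w. gate_cost S U C g)" for r q
    by (induction r) (simp_all add: ctl algebra_simps)
  have "(\<Sum>g\<leftarrow>concat (map (expand_step k t w) (concat (map (\<lambda>j. replicate (2 ^ j) (CallWalk (k + j))) [0..<n]))). gate_cost S U C g)
      = (2 ^ n - 1) * (\<Sum>g\<leftarrow>w. gate_cost S U C g)" for n
    by (induction n) (simp_all add: rep algebra_simps)
  then show ?thesis by (simp add: estimation_circuit_def estimation_steps_def)
qed

section \<open>Implementing the walk operator\<close>

lemma supported_ext:
  assumes "supported_on (basis X k) f" "supported_on (basis X k) g"
    and "\<And>x y a. x \<in> X \<Longrightarrow> y \<in> X \<Longrightarrow> a < 2 ^ k \<Longrightarrow> f (x, y, a) = g (x, y, a)"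
  shows "f = g"
proof (rule ext, clarify)
  fix x y a
  show "f (x, y, a) = g (x, y, a)"
  proof (cases "(x, y, a) \<in> basis X k")
    case True
    then show ?thesis using assms(3) by (simp add: basis_def)
  next
    case False
    then show ?thesis using assms(1,2) by (simp add: supported_on_def)
  qed
qed

text \<open>Circuits are operators on states, whereas \<open>interpolated_update\<close> asks for a
  unitary matrix on a finite basis. Tracking a circuit together with its reverse, as mutually
  inverse and adjoint operators, composes gate by gate and leaves a single conversion to a matrix at
  the end.\<close>

definition unitary_pair ::
  "'i set \<Rightarrow> (('i \<Rightarrow> complex) \<Rightarrow> 'i \<Rightarrow> complex) \<Rightarrow> (('i \<Rightarrow> complex) \<Rightarrow> 'i \<Rightarrow> complex) \<Rightarrow> bool" where
  "unitary_pair B F G \<longleftrightarrow> linear_op F \<and> linear_op G \<and>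
     (\<forall>f. supported_on B f \<longrightarrow> supported_on B (F f) \<and> supported_on B (G f) \<and> F (G f) = f \<and> G (F f) = f) \<and>
     (\<forall>f g. supported_on B f \<longrightarrow> supported_on B g \<longrightarrow> cip B (F f) g = cip B f (G g))"

lemma unitary_pair_comp:
  assumes "unitary_pair B F G" "unitary_pair B F' G'"
  shows "unitary_pair B (\<lambda>f. F' (F f)) (\<lambda>f. G (G' f))"
  using assms linear_op_comp[of F' F] linear_op_comp[of G G'] by (simp add: unitary_pair_def)

lemma supported_unit: "j \<in> B \<Longrightarrow> supported_on B (\<lambda>i. of_bool (i = j))"
  by (auto simp: supported_on_def)

lemma sum_unit:
  fixes f :: "'i \<Rightarrow> complex"
  assumes "finite B" "i \<in> B"
  shows "(\<Sum>j\<in>B. f j * of_bool (i = j)) = f i" "(\<Sum>j\<in>B. f j * of_bool (j = i)) = f i"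
    "(\<Sum>j\<in>B. of_bool (j = i) * f j) = f i"
proof -
  have "(\<Sum>j\<in>B. f j * of_bool (i = j)) = (\<Sum>j\<in>B. if i = j then f j else 0)"
    "(\<Sum>j\<in>B. f j * of_bool (j = i)) = (\<Sum>j\<in>B. if i = j then f j else 0)"
    "(\<Sum>j\<in>B. of_bool (j = i) * f j) = (\<Sum>j\<in>B. if i = j then f j else 0)"
    by (intro sum.cong; auto)+
  then show "(\<Sum>j\<in>B. f j * of_bool (i = j)) = f i" "(\<Sum>j\<in>B. f j * of_bool (j = i)) = f i"
    "(\<Sum>j\<in>B. of_bool (j = i) * f j) = f i"
    using assms by simp_all
qed

text \<open>The columns of V are the images of the standard basis vectors under F. Adjointness
  identifies the conjugate transpose with the matrix of G, and the inverse laws then become the two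
  unitarity equations.\<close>

lemma unitary_pair_matrix:
  assumes fin: "finite B" and FG: "unitary_pair B F G"
  obtains V where "unitary_on B V" "\<And>f. supported_on B f \<Longrightarrow> mat_apply B V f = F f"
    "\<And>f. supported_on B f \<Longrightarrow> mat_apply B (adjoint_mat V) f = G f"
proof -
  define \<delta> :: "'a \<Rightarrow> 'a \<Rightarrow> complex" where "\<delta> = (\<lambda>j i. of_bool (i = j))"
  define V where "V = (\<lambda>i j. F (\<delta> j) i)"
  have s\<delta>: "supported_on B (\<delta> j)" if "j \<in> B" for j
    unfolding \<delta>_def by (rule supported_unit[OF that])
  have lin: "linear_op F" "linear_op G" using FG by (auto simp: unitary_pair_def)
  have sF: "supported_on B (F f)" and sG: "supported_on B (G f)" and inv: "F (G f) = f" "G (F f) = f"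
    if "supported_on B f" for f using FG that by (auto simp: unitary_pair_def)
  have adj: "cip B (F f) g = cip B f (G g)" if "supported_on B f" "supported_on B g" for f g
    using FG that by (auto simp: unitary_pair_def)
  have exp: "f = (\<lambda>i. \<Sum>j\<in>B. f j * \<delta> j i)" if "supported_on B f" for f
  proof
    fix i show "f i = (\<Sum>j\<in>B. f j * \<delta> j i)"
    proof (cases "i \<in> B")
      case True
      then show ?thesis using sum_unit(1)[OF fin True, of f] by (simp add: \<delta>_def)
    next
      case False
      then have "(\<Sum>j\<in>B. f j * \<delta> j i) = 0" by (intro sum.neutral) (auto simp: \<delta>_def)
      then show ?thesis using False that by (simp add: supported_on_def)
    qed
  qed
  have cnj_of_bool: "cnj (of_bool Q) = of_bool Q" for Q by (cases Q) simp_all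
  have cip\<delta>: "cip B (\<delta> j) g = g j" if "j \<in> B" for j g
    using sum_unit(3)[OF fin that, of g] by (simp add: cip_def \<delta>_def cnj_of_bool)
  have cip\<delta>': "cip B g (\<delta> j) = cnj (g j)" if "j \<in> B" for j g
    using cip\<delta>[OF that, of g] cnj_cip[of B "\<delta> j" g] by simp
  have app: "mat_apply B (\<lambda>i j. H (\<delta> j) i) f = H f"
    if H: "linear_op H" "\<And>f. supported_on B f \<Longrightarrow> supported_on B (H f)" and f: "supported_on B f" for H f
  proof
    fix i
    have "H f = H (\<lambda>i. \<Sum>j\<in>B. f j * \<delta> j i)"
      using exp[OF f] by (rule arg_cong)
    also have "\<dots> = (\<lambda>i. \<Sum>j\<in>B. f j * H (\<delta> j) i)"
      by (rule linear_op_sum[OF H(1)])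
    finally have "H f i = (\<Sum>j\<in>B. f j * H (\<delta> j) i)"
      by (rule fun_cong)
    then show "mat_apply B (\<lambda>i j. H (\<delta> j) i) f i = H f i"
      using H(2)[OF f] by (auto simp: mat_apply_def supported_on_def mult.commute)
  qed
  have V: "mat_apply B V f = F f" if "supported_on B f" for f
    unfolding V_def by (rule app[OF lin(1) sF that])
  have VG: "cnj (V j i) = G (\<delta> j) i" if "i \<in> B" "j \<in> B" for i j
  proof -
    have "cnj (V j i) = cip B (F (\<delta> i)) (\<delta> j)" by (simp add: V_def cip\<delta>'[OF that(2)])
    also have "\<dots> = G (\<delta> j) i" using that by (simp add: adj s\<delta> cip\<delta>)
    finally show ?thesis .
  qed
  have "mat_apply B (adjoint_mat V) f = mat_apply B (\<lambda>i j. G (\<delta> j) i) f" for f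
    unfolding mat_apply_def adjoint_mat_def
    by (intro ext if_cong refl sum.cong arg_cong2[where f = "(*)"]) (auto simp: VG)
  then have Vadj: "mat_apply B (adjoint_mat V) f = G f" if "supported_on B f" for f
    using app[OF lin(2) sG that] by simp
  have "unitary_on B V"
    unfolding unitary_on_def
  proof (intro conjI ballI)
    fix i j assume ij: "i \<in> B" "j \<in> B"
    have "(\<Sum>l\<in>B. cnj (V l i) * V l j) = cip B (F (\<delta> i)) (F (\<delta> j))"
      by (simp add: cip_def V_def)
    also have "\<dots> = of_bool (i = j)"
      using ij by (simp add: adj s\<delta> sF inv cip\<delta>) (simp add: \<delta>_def)
    finally show "(\<Sum>l\<in>B. cnj (V l i) * V l j) = of_bool (i = j)" .
    have "(\<Sum>l\<in>B. V i l * cnj (V j l)) = cip B (G (\<delta> i)) (G (\<delta> j))"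
      unfolding cip_def by (intro sum.cong refl) (use ij in \<open>simp add: VG[symmetric]\<close>)
    also have "\<dots> = cnj (cip B (F (G (\<delta> j))) (\<delta> i))"
      using ij by (simp add: adj s\<delta> sG cnj_cip)
    also have "\<dots> = of_bool (i = j)"
      using ij by (simp add: s\<delta> inv cnj_cip cip\<delta>) (simp add: \<delta>_def)
    finally show "(\<Sum>l\<in>B. V i l * cnj (V j l)) = of_bool (i = j)" .
  qed
  then show thesis using V Vadj by (rule that)
qed

lemma unitary_pair_run_Cons:
  assumes "unitary_pair B (gate_sem X bx g) (gate_sem X bx h)" "unitary_pair B (run X bx gs) (run X bx hs)"
  shows "unitary_pair B (run X bx (g # gs)) (run X bx (hs @ [h]))"
proof -
  have "run X bx (g # gs) = (\<lambda>f. run X bx gs (gate_sem X bx g f))"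
    "run X bx (hs @ [h]) = (\<lambda>f. gate_sem X bx h (run X bx hs f))"
    by (auto simp: run_append)
  then show ?thesis using unitary_pair_comp[OF assms] by simp
qed

lemma unitary_pair_run_Nil: "unitary_pair B (run X bx []) (run X bx [])"
  by (simp add: unitary_pair_def linear_op_def)

lemma unitary_pair_Check:
  fixes X :: "'v set"
  assumes "q < k"
  shows "unitary_pair (basis X k) (gate_sem X bx (Gate {} (Check q))) (gate_sem X bx (Gate {} (Check q)))"
proof -
  define \<sigma> :: "'v \<times> 'v \<times> nat \<Rightarrow> 'v \<times> 'v \<times> nat" where "\<sigma> = (\<lambda>(x, y, a). (x, y, if x \<in> marked bx then flip_bit q a else (a::nat)))"
  let ?C = "gate_sem X bx (Gate {} (Check q))"
  have g: "?C f i = f (\<sigma> i)" for f :: "'v state" and i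
    by (cases i) (simp add: \<sigma>_def)
  have inv: "\<sigma> (\<sigma> i) = i" for i
    by (cases i) (auto simp: \<sigma>_def flip_bit_involution)
  have "\<sigma> i \<in> basis X k" if "i \<in> basis X k" for i
    using that flip_bit_less[OF _ assms] by (auto simp: \<sigma>_def basis_def)
  then have B: "\<sigma> i \<in> basis X k \<longleftrightarrow> i \<in> basis X k" for i
    using inv by metis
  have bij: "bij_betw \<sigma> (basis X k) (basis X k)"
    by (intro bij_betw_byWitness[where f' = \<sigma>]) (auto simp: inv B)
  have cip: "cip (basis X k) (?C f) h = cip (basis X k) f (?C h)" for f h
  proof -
    have "cip (basis X k) (?C f) h = (\<Sum>i\<in>basis X k. cnj (f (\<sigma> i)) * h (\<sigma> (\<sigma> i)))"
      by (simp only: cip_def g inv)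
    also have "\<dots> = (\<Sum>i\<in>basis X k. cnj (f i) * h (\<sigma> i))"
      by (rule sum.reindex_bij_betw[OF bij, where g = "\<lambda>i. cnj (f i) * h (\<sigma> i)"])
    finally show ?thesis by (simp only: cip_def g)
  qed
  have "?C (?C f) = f" for f
    by (rule ext) (simp only: g inv)
  moreover have "supported_on (basis X k) (?C f)" if "supported_on (basis X k) f" for f
    using that unfolding supported_on_def g by (simp add: B del: split_paired_All)
  ultimately show ?thesis
    unfolding unitary_pair_def by (simp add: gate_sem_linear cip del: gate_sem.simps)
qed

lemma unitary_pair_Static:
  assumes fin: "finite X" and U: "\<And>x. x \<in> X \<Longrightarrow> unitary_on (X \<times> {..<2 ^ k}) (U x)"
  shows "unitary_pair (basis X k) (gate_sem X bx (Gate {} (Static k U)))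
    (gate_sem X bx (Gate {} (Static k (\<lambda>x. adjoint_mat (U x)))))"
proof -
  let ?S = "X \<times> {..<(2::nat) ^ k}"
  let ?G = "\<lambda>K. gate_sem X bx (Gate {} (Static k K))"
  have finS: "finite ?S" using fin by simp
  have slice: "(\<lambda>(y, w). ?G K f (x, y, w)) = mat_apply ?S (K x) (\<lambda>(y, w). f (x, y, w))"
    if f: "supported_on (basis X k) f" for K f x
  proof (rule ext, clarify)
    fix y w
    show "?G K f (x, y, w) = mat_apply ?S (K x) (\<lambda>(y, w). f (x, y, w)) (y, w)"
    proof (cases "w < 2 ^ k")
      case True
      then show ?thesis by simp
    next
      case False
      then have "2 ^ k \<le> w div 2 ^ k * 2 ^ k"
        using div_greater_zero_iff[of w "2 ^ k"] by (metis Suc_leI mult_le_mono1 nat_mult_1 not_less One_nat_def zero_less_numeral zero_less_power)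
      then have "\<not> w div 2 ^ k * 2 ^ k + w' < 2 ^ k" for w' by linarith
      then have "f (x, y', w div 2 ^ k * 2 ^ k + w') = 0" for y' w'
        using f unfolding supported_on_def basis_def by blast
      then show ?thesis using False by (simp add: mat_apply_def case_prod_unfold)
    qed
  qed
  have ss: "supported_on ?S (\<lambda>(y, w). f (x, y, w))" if "supported_on (basis X k) f" for f x
    using that by (auto simp: supported_on_def basis_def)
  have supp: "supported_on (basis X k) (?G K f)" if f: "supported_on (basis X k) f" for K f
    unfolding supported_on_def
  proof (intro allI impI)
    fix i assume i: "i \<notin> basis X k"
    obtain x y w where xyw: "i = (x, y, w)" by (rule prod_cases3)
    have "?G K f i = mat_apply ?S (K x) (\<lambda>(y, w). f (x, y, w)) (y, w)"
      using fun_cong[OF slice[OF f, where K = K and x = x], of "(y, w)"] xyw by simp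
    also have "\<dots> = 0"
    proof (cases "x \<in> X")
      case True
      then show ?thesis using i xyw by (auto simp: mat_apply_def basis_def)
    next
      case False
      then show ?thesis using f by (auto simp: mat_apply_def supported_on_def basis_def intro!: sum.neutral)
    qed
    finally show "?G K f i = 0" .
  qed
  have inv: "?G K (?G L f) = f"
    if f: "supported_on (basis X k) f"
      and KL: "\<And>x g. x \<in> X \<Longrightarrow> supported_on ?S g \<Longrightarrow> mat_apply ?S (K x) (mat_apply ?S (L x) g) = g" for K L f
  proof (rule supported_ext[OF supp[OF supp[OF f]] f])
    fix x y a assume "x \<in> X" "y \<in> X" "a < (2::nat) ^ k"
    have "(\<lambda>(y, w). ?G K (?G L f) (x, y, w)) = (\<lambda>(y, w). f (x, y, w))"
      using slice[OF supp[OF f], where K = K and x = x] slice[OF f, where K = L and x = x] KL[OF \<open>x \<in> X\<close> ss[OF f]] by simp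
    from fun_cong[OF this, of "(y, a)"] show "?G K (?G L f) (x, y, a) = f (x, y, a)" by simp
  qed
  have cips: "cip (basis X k) f g = (\<Sum>x\<in>X. cip ?S (\<lambda>(y, w). f (x, y, w)) (\<lambda>(y, w). g (x, y, w)))" for f g
    by (simp add: cip_def basis_def sum.cartesian_product case_prod_unfold)
  have cip: "cip (basis X k) (?G U f) g = cip (basis X k) f (?G (\<lambda>x. adjoint_mat (U x)) g)"
    if "supported_on (basis X k) f" "supported_on (basis X k) g" for f g
    unfolding cips slice[OF that(1)] slice[OF that(2)]
    using cip_mat_apply_adjoint[of ?S "adjoint_mat (U _)"] by simp
  show ?thesis
    unfolding unitary_pair_def
    using supp cip inv[where K = U and L = "\<lambda>x. adjoint_mat (U x)"]
      inv[where L = U and K = "\<lambda>x. adjoint_mat (U x)"]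
      unitary_adjoint_left[OF finS U] unitary_adjoint_right[OF finS U]
    by (simp add: gate_sem_linear del: gate_sem.simps)
qed

lemma unitary_pair_Update:
  assumes fin: "finite X" and U: "unitary_on (X \<times> X) (update_mat bx)"
  shows "unitary_pair (basis X k) (gate_sem X bx (Gate {q} UpdateV)) (gate_sem X bx (Gate {q} UpdateVadj))"
proof -
  let ?S = "X \<times> X"
  define H where "H = (\<lambda>K f (x, y, a). if bit (a::nat) q
    then mat_apply ?S K (\<lambda>(x', y'). f (x', y', a)) (x, y) else f (x, y, a))"
  have gates: "gate_sem X bx (Gate {q} UpdateV) = H (update_mat bx)"
    "gate_sem X bx (Gate {q} UpdateVadj) = H (adjoint_mat (update_mat bx))"
    by (auto simp: H_def fun_eq_iff)
  have finS: "finite ?S" using fin by simp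
  have slice: "(\<lambda>(x, y). H K f (x, y, a)) = (if bit a q then mat_apply ?S K (\<lambda>(x, y). f (x, y, a)) else (\<lambda>(x, y). f (x, y, a)))"
    for K f a
    by (auto simp: H_def)
  have ss: "supported_on ?S (\<lambda>(x, y). f (x, y, a))" if "supported_on (basis X k) f" for f a
    using that by (auto simp: supported_on_def basis_def)
  have supp: "supported_on (basis X k) (H K f)" if f: "supported_on (basis X k) f" for K f
    using f by (auto simp: supported_on_def basis_def H_def mat_apply_def intro!: sum.neutral)
  have inv: "H K (H L f) = f"
    if f: "supported_on (basis X k) f"
      and KL: "\<And>g. supported_on ?S g \<Longrightarrow> mat_apply ?S K (mat_apply ?S L g) = g" for K L f
  proof (rule ext, clarify)
    fix x y a
    have "(\<lambda>(x, y). H K (H L f) (x, y, a)) = (\<lambda>(x, y). f (x, y, a))"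
      using slice[of K "H L f" a] slice[of L f a] KL[OF ss[OF f]] by simp
    from fun_cong[OF this, of "(x, y)"] show "H K (H L f) (x, y, a) = f (x, y, a)" by simp
  qed
  have cips: "cip (basis X k) f g = (\<Sum>a<2 ^ k. cip ?S (\<lambda>(x, y). f (x, y, a)) (\<lambda>(x, y). g (x, y, a)))" for f g
  proof -
    have "cip (basis X k) f g = (\<Sum>x\<in>X. \<Sum>a<2 ^ k. \<Sum>y\<in>X. cnj (f (x, y, a)) * g (x, y, a))"
      unfolding cip_def sum_basis by (intro sum.cong refl sum.swap)
    also have "\<dots> = (\<Sum>a<2 ^ k. \<Sum>x\<in>X. \<Sum>y\<in>X. cnj (f (x, y, a)) * g (x, y, a))"
      by (rule sum.swap)
    finally show ?thesis by (simp add: cip_def sum.cartesian_product case_prod_unfold)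
  qed
  have cip: "cip (basis X k) (H (update_mat bx) f) g = cip (basis X k) f (H (adjoint_mat (update_mat bx)) g)" for f g
    unfolding cips slice
    using cip_mat_apply_adjoint[of ?S "adjoint_mat (update_mat bx)"] by (intro sum.cong) auto
  show ?thesis
    unfolding unitary_pair_def gates
    using gate_sem_linear[of X bx "Gate {q} UpdateV"] gate_sem_linear[of X bx "Gate {q} UpdateVadj"]
      supp cip inv unitary_adjoint_left[OF finS U] unitary_adjoint_right[OF finS U]
    unfolding gates by blast
qed

text \<open>
  The direct sum, over the values \<open>\<kappa>\<close> of \<open>key\<close>, of the reflections along the vectors
  \<open>\<rho>\<close> restricted to \<open>{i. key i = \<kappa>}\<close>.  A reflection along \<open>a - b\<close> exchanges the orthogonal unit
  vectors \<open>a\<close> and \<open>b\<close>.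
\<close>

definition block_reflection :: "('i \<Rightarrow> 'k) \<Rightarrow> ('i \<Rightarrow> complex) \<Rightarrow> 'i cmat" where
  "block_reflection key \<rho> = (\<lambda>i j. of_bool (i = j) - of_bool (key i = key j) * \<rho> i * cnj (\<rho> j))"

lemma adjoint_block_reflection [simp]: "adjoint_mat (block_reflection key \<rho>) = block_reflection key \<rho>"
  by (intro ext) (auto simp: adjoint_mat_def block_reflection_def)

lemma mat_apply_block_reflection:
  assumes "finite S" "i \<in> S"
  shows "mat_apply S (block_reflection key \<rho>) f i
    = f i - \<rho> i * (\<Sum>j\<in>S. if key i = key j then cnj (\<rho> j) * f j else 0)"
proof -
  have "mat_apply S (block_reflection key \<rho>) f i
      = (\<Sum>j\<in>S. f j * of_bool (i = j) - \<rho> i * (if key i = key j then cnj (\<rho> j) * f j else 0))"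
    using assms by (auto simp: mat_apply_def block_reflection_def algebra_simps intro!: sum.cong)
  then show ?thesis
    by (simp add: sum_subtractf sum_unit(1)[OF assms] sum_distrib_left)
qed

text \<open>On a block where the squared norm of rho is 2, I - |rho><rho| is the Householder
  reflection along rho. Being self-adjoint, the matrix is unitary as soon as it squares to the
  identity.\<close>

lemma unitary_block_reflection:
  assumes fin: "finite S"
    and norm: "\<And>i. i \<in> S \<Longrightarrow> (\<Sum>j\<in>S. if key i = key j then cnj (\<rho> j) * \<rho> j else 0) = 2"
  shows "unitary_on S (block_reflection key \<rho>)"
proof -
  let ?K = "block_reflection key \<rho>"
  have sq: "(\<Sum>l\<in>S. ?K i l * ?K l j) = of_bool (i = j)" if ij: "i \<in> S" "j \<in> S" for i j
  proof -
    have "(\<Sum>l\<in>S. ?K i l * ?K l j) = mat_apply S ?K (\<lambda>l. ?K l j) i"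
      using ij by (simp add: mat_apply_def)
    also have "\<dots> = ?K i j - \<rho> i * (\<Sum>l\<in>S. if key i = key l then cnj (\<rho> l) * ?K l j else 0)"
      by (rule mat_apply_block_reflection[OF fin ij(1)])
    also have "(\<Sum>l\<in>S. if key i = key l then cnj (\<rho> l) * ?K l j else 0)
        = (\<Sum>l\<in>S. (of_bool (key i = key j) * cnj (\<rho> l)) * of_bool (l = j)
            - of_bool (key i = key j) * cnj (\<rho> j) * (if key i = key l then cnj (\<rho> l) * \<rho> l else 0))"
      by (intro sum.cong) (auto simp: block_reflection_def algebra_simps)
    also have "\<dots> = - of_bool (key i = key j) * cnj (\<rho> j)"
      unfolding sum_subtractf sum_unit(2)[OF fin ij(2)] sum_distrib_left[symmetric] norm[OF ij(1)] by simp
    finally show ?thesis by (auto simp: block_reflection_def)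
  qed
  have cnj: "cnj (?K i j) = ?K j i" for i j by (auto simp: block_reflection_def)
  show ?thesis unfolding unitary_on_def using sq by (simp add: cnj)
qed

lemma sum_by_parity:
  fixes F :: "nat \<Rightarrow> complex"
  assumes "r < 2"
  shows "(\<Sum>b<2 ^ 3. if r = b mod 2 then F b else 0) = F r + F (r + 2) + F (r + 4) + F (r + 6)"
proof -
  have eq: "{..<2 ^ 3} = {0, 1, 2, 3, 4, 5, 6, 7 :: nat}" by auto
  have "r = 0 \<or> r = 1" using assms by auto
  then show ?thesis unfolding eq by (elim disjE) (simp_all, simp_all add: numeral_2_eq_2 numeral_3_eq_3)
qed

text \<open>
  Work qubit 0 holds the result of \<open>Check\<close>, and work qubits 1 and 2 a coin \<open>b div 2\<close>.  Where the
  vertex is marked the first static unitary takes \<open>|z\<rangle>|0\<rangle>\<close> to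
  \<open>\<surd>(1 - s) |z\<rangle>|1\<rangle> + \<surd>s |x\<rangle>|2\<rangle>\<close> and \<open>V(P)\<close> is applied for coin 1; the second one, acting on the coin
  only, returns it to 0.  Where the vertex is unmarked, the same happens with 0 in place of \<open>s\<close>.
\<close>

definition stay :: "real \<Rightarrow> nat \<Rightarrow> real" where
  "stay s b = (if odd b then s else 0)"

definition split_vec :: "('v \<Rightarrow> complex) \<Rightarrow> real \<Rightarrow> 'v \<Rightarrow> 'v \<times> nat \<Rightarrow> complex" where
  "split_vec z s x = (\<lambda>(y, b).
     if b div 2 = 0 then z y
     else if b div 2 = 1 then - complex_of_real (sqrt (1 - stay s b)) * z y
     else if b div 2 = 2 then - complex_of_real (sqrt (stay s b)) * of_bool (y = x)
     else 0)"

text \<open>With \<open>d x = P x x\<close> this is the square root of the diagonal entry of P(s) at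
  x, for a marked vertex if b is odd and for an unmarked one if b is even.\<close>

definition loop_amp :: "real \<Rightarrow> ('v \<Rightarrow> real) \<Rightarrow> 'v \<Rightarrow> nat \<Rightarrow> real" where
  "loop_amp s d x b = sqrt ((1 - stay s b) * d x + stay s b)"

text \<open>For each content y of the second register this is a difference a - b of orthogonal unit
  vectors of the coin, with a = |0>. For y different from x only coin 1 has arrived, and b = |1>.
  For y = x coins 1 and 2 have arrived with amplitudes A and B, and b = (A |1> + B |2>) / nu with nu
  = \<open>loop_amp\<close>. When nu = 0 nothing arrives at x, and b = |1> merely keeps the matrix
  unitary.\<close>

definition merge_vec :: "real \<Rightarrow> ('v \<Rightarrow> real) \<Rightarrow> 'v \<Rightarrow> 'v \<times> nat \<Rightarrow> complex" where
  "merge_vec s d x = (\<lambda>(y, b).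
     if b div 2 = 0 then 1
     else if b div 2 = 1 then
       (if y = x \<and> loop_amp s d x b \<noteq> 0
        then - complex_of_real (sqrt ((1 - stay s b) * d x) / loop_amp s d x b) else -1)
     else if b div 2 = 2 \<and> y = x \<and> loop_amp s d x b \<noteq> 0
       then - complex_of_real (sqrt (stay s b) / loop_amp s d x b)
     else 0)"

definition split_static :: "('v \<Rightarrow> complex) \<Rightarrow> real \<Rightarrow> 'v \<Rightarrow> ('v \<times> nat) cmat" where
  "split_static z s x = block_reflection (\<lambda>(y, b). b mod 2) (split_vec z s x)"

definition merge_static :: "real \<Rightarrow> ('v \<Rightarrow> real) \<Rightarrow> 'v \<Rightarrow> ('v \<times> nat) cmat" where
  "merge_static s d x = block_reflection (\<lambda>(y, b). (y, b mod 2)) (merge_vec s d x)"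

text \<open>The factor \<open>sqrt 2\<close> normalises the reflection vector, making the block
  reflection I - 2 |z,0><z,0|; the outer sign turns it into the reflection about |z>|0>.\<close>

definition ref_static :: "('v \<Rightarrow> complex) \<Rightarrow> 'v \<Rightarrow> ('v \<times> nat) cmat" where
  "ref_static z x = (\<lambda>i j. - block_reflection (\<lambda>_. ()) (\<lambda>(y, b). of_bool (b = 0) * complex_of_real (sqrt 2) * z y) i j)"

definition update_circuit :: "('v \<Rightarrow> complex) \<Rightarrow> ('v \<Rightarrow> real) \<Rightarrow> real \<Rightarrow> 'v circuit" where
  "update_circuit z d s = [Gate {} (Check 0), Gate {} (Static 3 (split_static z s)), Gate {1} UpdateV,
     Gate {} (Static 3 (merge_static s d)), Gate {} (Check 0)]"

text \<open>The gates in reverse order. \<open>Check\<close> and the two block reflections are their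
  own adjoints, so only the update gate changes.\<close>

definition update_circuit_adj :: "('v \<Rightarrow> complex) \<Rightarrow> ('v \<Rightarrow> real) \<Rightarrow> real \<Rightarrow> 'v circuit" where
  "update_circuit_adj z d s = [Gate {} (Check 0), Gate {} (Static 3 (merge_static s d)), Gate {1} UpdateVadj,
     Gate {} (Static 3 (split_static z s)), Gate {} (Check 0)]"

definition walk_circuit :: "('v \<Rightarrow> complex) \<Rightarrow> ('v \<Rightarrow> real) \<Rightarrow> real \<Rightarrow> 'v circuit" where
  "walk_circuit z d s = [Gate {} (Static 3 (ref_static z))] @ update_circuit z d s @ [Gate {} Shift]
     @ update_circuit_adj z d s"

lemma walk_circuit_cost: "(\<Sum>g\<leftarrow>walk_circuit z d s. gate_cost S U C g) = 3 * U + 4 * C"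
  by (simp add: walk_circuit_def update_circuit_def update_circuit_adj_def)

section \<open>Unitarity and action of the static gates\<close>

context reference_vector
begin

lemma unitary_split_static:
  assumes x: "x \<in> X" and s: "0 \<le> s" "s \<le> 1"
  shows "unitary_on (X \<times> {..<2 ^ 3}) (split_static z s x)"
  unfolding split_static_def
proof (rule unitary_block_reflection)
  show "finite (X \<times> {..<(2::nat) ^ 3})" using fin_X by simp
  fix i assume "i \<in> X \<times> {..<(2::nat) ^ 3}"
  obtain y0 b0 where i: "i = (y0, b0)" by (cases i)
  define r where "r = b0 mod 2"
  have r: "r < 2" by (simp add: r_def)
  have st: "stay s (r + 2) = stay s r" "stay s (r + 4) = stay s r" by (simp_all add: stay_def)
  have st01: "0 \<le> stay s r" "stay s r \<le> 1" using s by (auto simp: stay_def)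
  have sq: "complex_of_real (sqrt (1 - stay s r)) * complex_of_real (sqrt (1 - stay s r)) = 1 - complex_of_real (stay s r)"
    "complex_of_real (sqrt (stay s r)) * complex_of_real (sqrt (stay s r)) = complex_of_real (stay s r)"
    using st01 by (simp_all flip: of_real_mult)
  let ?F = "\<lambda>y b. cnj (split_vec z s x (y, b)) * split_vec z s x (y, b)"
  have dv: "r div 2 = 0" "(r + 2) div 2 = 1" "(r + 4) div 2 = 2" "(r + 6) div 2 = 3" using r by auto
  have vals: "split_vec z s x (y, r) = z y"
    "split_vec z s x (y, r + 2) = - complex_of_real (sqrt (1 - stay s r)) * z y"
    "split_vec z s x (y, r + 4) = - complex_of_real (sqrt (stay s r)) * of_bool (y = x)"
    "split_vec z s x (y, r + 6) = 0" for y
    unfolding split_vec_def prod.case dv st by simp_all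
  have e: "cnj (- complex_of_real u * v) * (- complex_of_real u * v) = (complex_of_real u * complex_of_real u) * (cnj v * v)" for u v
    by (simp add: mult.commute mult.left_commute)
  have e': "cnj (of_bool Q) * of_bool Q = (of_bool Q :: complex)" for Q by (cases Q) simp_all
  have F: "?F y r + ?F y (r + 2) + ?F y (r + 4) + ?F y (r + 6)
      = cnj (z y) * z y + (1 - complex_of_real (stay s r)) * (cnj (z y) * z y) + complex_of_real (stay s r) * of_bool (y = x)" for y
    unfolding vals e sq e' by simp
  let ?sum = "(\<Sum>j\<in>X \<times> {..<2 ^ 3}. if (case i of (y, b) \<Rightarrow> b mod 2) = (case j of (y, b) \<Rightarrow> b mod 2)
        then cnj (split_vec z s x j) * split_vec z s x j else 0)"
  have "?sum
      = (\<Sum>y\<in>X. \<Sum>b<2 ^ 3. if r = b mod 2 then ?F y b else 0)"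
    unfolding sum.cartesian_product by (intro sum.cong) (auto simp: i r_def)
  also have "\<dots> = (\<Sum>y\<in>X. cnj (z y) * z y + (1 - complex_of_real (stay s r)) * (cnj (z y) * z y) + complex_of_real (stay s r) * of_bool (y = x))"
    unfolding sum_by_parity[OF r] F ..
  also have "\<dots> = 2"
    unfolding sum.distrib sum_distrib_left[symmetric] z_norm
    using sum_unit(2)[OF fin_X x, of "\<lambda>_. complex_of_real (stay s r)"] by (simp add: sum_distrib_left)
  finally show "?sum = 2" .
qed

lemma sum_merge_block:
  fixes F :: "'v \<Rightarrow> nat \<Rightarrow> complex"
  assumes y: "y \<in> X" and r: "r < 2"
  shows "(\<Sum>j\<in>X \<times> {..<2 ^ 3}. if (y, r) = (case j of (y', b) \<Rightarrow> (y', b mod 2)) then (case j of (y', b) \<Rightarrow> F y' b) else 0)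
    = F y r + F y (r + 2) + F y (r + 4) + F y (r + 6)"
proof -
  have "(\<Sum>j\<in>X \<times> {..<2 ^ 3}. if (y, r) = (case j of (y', b) \<Rightarrow> (y', b mod 2)) then (case j of (y', b) \<Rightarrow> F y' b) else 0)
      = (\<Sum>(y', b)\<in>X \<times> {..<2 ^ 3}. if y = y' \<and> r = b mod 2 then F y' b else 0)"
    by (intro sum.cong) (auto split: if_splits)
  also have "\<dots> = (\<Sum>y'\<in>X. if y = y' then \<Sum>b<2 ^ 3. if r = b mod 2 then F y' b else 0 else 0)"
    unfolding sum.cartesian_product[symmetric] by (intro sum.cong) (auto intro!: sum.neutral)
  also have "\<dots> = (\<Sum>b<2 ^ 3. if r = b mod 2 then F y b else 0)" using y fin_X by simp
  finally show ?thesis unfolding sum_by_parity[OF r] .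
qed

lemma merge_vec_values:
  assumes r: "r < 2"
  shows "merge_vec s d x (y, r) = 1"
    "merge_vec s d x (y, r + 2) = (if y = x \<and> loop_amp s d x r \<noteq> 0
        then - complex_of_real (sqrt ((1 - stay s r) * d x) / loop_amp s d x r) else -1)"
    "merge_vec s d x (y, r + 4) = (if y = x \<and> loop_amp s d x r \<noteq> 0
        then - complex_of_real (sqrt (stay s r) / loop_amp s d x r) else 0)"
    "merge_vec s d x (y, r + 6) = 0"
proof -
  have st: "stay s (r + 2) = stay s r" "stay s (r + 4) = stay s r" by (simp_all add: stay_def)
  have la: "loop_amp s d x (r + 2) = loop_amp s d x r" "loop_amp s d x (r + 4) = loop_amp s d x r"
    unfolding loop_amp_def st by simp_all
  have dv: "r div 2 = 0" "(r + 2) div 2 = 1" "(r + 4) div 2 = 2" "(r + 6) div 2 = 3" using r by auto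
  show "merge_vec s d x (y, r) = 1"
    "merge_vec s d x (y, r + 2) = (if y = x \<and> loop_amp s d x r \<noteq> 0
        then - complex_of_real (sqrt ((1 - stay s r) * d x) / loop_amp s d x r) else -1)"
    "merge_vec s d x (y, r + 4) = (if y = x \<and> loop_amp s d x r \<noteq> 0
        then - complex_of_real (sqrt (stay s r) / loop_amp s d x r) else 0)"
    "merge_vec s d x (y, r + 6) = 0"
    unfolding merge_vec_def prod.case dv st la by simp_all
qed

lemma loop_amp_sq:
  assumes "0 \<le> s" "s \<le> 1" "0 \<le> d x"
  shows "0 \<le> (1 - stay s r) * d x" "0 \<le> stay s r" "loop_amp s d x r * loop_amp s d x r = (1 - stay s r) * d x + stay s r"
  using assms by (auto simp: stay_def loop_amp_def)

lemma unitary_merge_static: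
  assumes x: "x \<in> X" and s: "0 \<le> s" "s \<le> 1" and d: "0 \<le> d x"
  shows "unitary_on (X \<times> {..<2 ^ 3}) (merge_static s d x)"
  unfolding merge_static_def
proof (rule unitary_block_reflection)
  show "finite (X \<times> {..<(2::nat) ^ 3})" using fin_X by simp
  fix i assume i': "i \<in> X \<times> {..<(2::nat) ^ 3}"
  obtain y b0 where i: "i = (y, b0)" by (cases i)
  then have y: "y \<in> X" using i' by simp
  define r where "r = b0 mod 2"
  have r: "r < 2" by (simp add: r_def)
  define \<nu> where "\<nu> = loop_amp s d x r"
  define A where "A = sqrt ((1 - stay s r) * d x)"
  define B where "B = sqrt (stay s r)"
  have AB: "A * A + B * B = \<nu> * \<nu>"
    using loop_amp_sq[of s d x r] s d by (simp add: A_def B_def \<nu>_def)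
  let ?F = "\<lambda>y b. cnj (merge_vec s d x (y, b)) * merge_vec s d x (y, b)"
  let ?sum = "(\<Sum>j\<in>X \<times> {..<2 ^ 3}. if (case i of (y, b) \<Rightarrow> (y, b mod 2)) = (case j of (y, b) \<Rightarrow> (y, b mod 2))
        then cnj (merge_vec s d x j) * merge_vec s d x j else 0)"
  have "?sum
      = (\<Sum>j\<in>X \<times> {..<2 ^ 3}. if (y, r) = (case j of (y', b) \<Rightarrow> (y', b mod 2)) then (case j of (y', b) \<Rightarrow> ?F y' b) else 0)"
    by (intro sum.cong) (auto simp: i r_def)
  also have "\<dots> = ?F y r + ?F y (r + 2) + ?F y (r + 4) + ?F y (r + 6)"
    by (rule sum_merge_block[OF y r])
  also have "\<dots> = 2"
  proof (cases "y = x \<and> \<nu> \<noteq> 0")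
    case True
    have "complex_of_real (A / \<nu>) * complex_of_real (A / \<nu>) + complex_of_real (B / \<nu>) * complex_of_real (B / \<nu>)
        = complex_of_real ((A * A + B * B) / (\<nu> * \<nu>))"
      by (simp add: add_divide_distrib)
    also have "\<dots> = 1" using True by (simp add: AB)
    finally show ?thesis
      using True unfolding merge_vec_values[OF r] \<nu>_def[symmetric] A_def[symmetric] B_def[symmetric] by simp
  next
    case False
    then show ?thesis
      unfolding merge_vec_values[OF r] \<nu>_def[symmetric] by auto
  qed
  finally show "?sum = 2" .
qed

lemma ref_static_norm:
  "(\<Sum>(y, b)\<in>X \<times> {..<2 ^ 3}. cnj (of_bool (b = (0::nat)) * complex_of_real (sqrt 2) * z y) * f (y, b))
    = complex_of_real (sqrt 2) * (\<Sum>y\<in>X. cnj (z y) * f (y, 0))"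
proof -
  have "(\<Sum>(y, b)\<in>X \<times> {..<2 ^ 3}. cnj (of_bool (b = (0::nat)) * complex_of_real (sqrt 2) * z y) * f (y, b))
      = (\<Sum>y\<in>X. \<Sum>b<2 ^ 3. of_bool (b = 0) * (complex_of_real (sqrt 2) * cnj (z y) * f (y, b)))"
    unfolding sum.cartesian_product by (intro sum.cong) auto
  then show ?thesis unfolding sum_of_bool_0 by (simp add: sum_distrib_left mult.assoc)
qed

lemma unitary_ref_static: "unitary_on (X \<times> {..<2 ^ 3}) (ref_static z x)"
proof -
  let ?\<rho> = "\<lambda>(y, b). of_bool (b = (0::nat)) * complex_of_real (sqrt 2) * z y"
  have sq: "complex_of_real (sqrt 2) * complex_of_real (sqrt 2) = 2" by (simp flip: of_real_mult)
  have "(\<Sum>j\<in>X \<times> {..<2 ^ 3}. cnj (?\<rho> j) * ?\<rho> j)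
      = (\<Sum>(y, b)\<in>X \<times> {..<2 ^ 3}. cnj (of_bool (b = (0::nat)) * complex_of_real (sqrt 2) * z y) * ?\<rho> (y, b))"
    by (intro sum.cong) auto
  also have "\<dots> = complex_of_real (sqrt 2) * (\<Sum>y\<in>X. cnj (z y) * ?\<rho> (y, 0))"
    by (rule ref_static_norm)
  also have "\<dots> = complex_of_real (sqrt 2) * (complex_of_real (sqrt 2) * (\<Sum>y\<in>X. cnj (z y) * z y))"
    by (simp add: sum_distrib_left mult.left_commute)
  also have "\<dots> = 2" by (simp add: z_norm sq)
  finally have "unitary_on (X \<times> {..<(2::nat) ^ 3}) (block_reflection (\<lambda>_. ()) ?\<rho>)"
    by (intro unitary_block_reflection) (use fin_X in simp_all)
  then show ?thesis by (simp add: unitary_on_def ref_static_def)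
qed

lemma static_apply:
  assumes "b < 2 ^ k"
  shows "gate_sem X bx (Gate {} (Static k K)) \<psi> (u, v, b)
    = mat_apply (X \<times> {..<2 ^ k}) (K u) (\<lambda>(y, w). \<psi> (u, y, w)) (v, b)"
  using assms by simp

lemma run_ref_static:
  assumes \<psi>: "supported_on (basis X 3) \<psi>"
  shows "gate_sem X bx (Gate {} (Static 3 (ref_static z))) \<psi> = ref_op X z \<psi>"
proof (rule supported_ext)
  have "unitary_pair (basis X 3) (gate_sem X bx (Gate {} (Static 3 (ref_static z))))
      (gate_sem X bx (Gate {} (Static 3 (\<lambda>x. adjoint_mat (ref_static z x)))))"
    by (rule unitary_pair_Static[OF fin_X unitary_ref_static])
  then show "supported_on (basis X 3) (gate_sem X bx (Gate {} (Static 3 (ref_static z))) \<psi>)"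
    using \<psi> unfolding unitary_pair_def by blast
  show "supported_on (basis X 3) (ref_op X z \<psi>)" by (rule ref_op_supported[OF \<psi>])
  fix x y a assume xy: "x \<in> X" "y \<in> X" and a: "a < (2::nat) ^ 3"
  let ?\<rho> = "\<lambda>(y, b). of_bool (b = (0::nat)) * complex_of_real (sqrt 2) * z y"
  let ?f = "\<lambda>(y, w). \<psi> (x, y, w)"
  have sq: "complex_of_real (sqrt 2) * complex_of_real (sqrt 2) = 2" by (simp flip: of_real_mult)
  define S where "S = (\<Sum>y\<in>X. cnj (z y) * \<psi> (x, y, 0))"
  define m where "m = mat_apply (X \<times> {..<2 ^ 3}) (ref_static z x) ?f (y, a)"
  have "m = - mat_apply (X \<times> {..<2 ^ 3}) (block_reflection (\<lambda>_. ()) ?\<rho>) ?f (y, a)"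
    by (simp add: m_def mat_apply_def ref_static_def sum_negf)
  also have "mat_apply (X \<times> {..<2 ^ 3}) (block_reflection (\<lambda>_. ()) ?\<rho>) ?f (y, a)
      = ?f (y, a) - ?\<rho> (y, a) * (\<Sum>j\<in>X \<times> {..<2 ^ 3}. if () = () then cnj (?\<rho> j) * ?f j else 0)"
    by (rule mat_apply_block_reflection) (use fin_X xy a in simp_all)
  also have "(\<Sum>j\<in>X \<times> {..<2 ^ 3}. if () = () then cnj (?\<rho> j) * ?f j else 0)
      = (\<Sum>(y, b)\<in>X \<times> {..<2 ^ 3}. cnj (of_bool (b = (0::nat)) * complex_of_real (sqrt 2) * z y) * ?f (y, b))"
    by (intro sum.cong) auto
  also have "\<dots> = complex_of_real (sqrt 2) * (\<Sum>y\<in>X. cnj (z y) * ?f (y, 0))"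
    by (rule ref_static_norm)
  finally have "m = (complex_of_real (sqrt 2) * complex_of_real (sqrt 2)) * (of_bool (a = 0) * z y * S) - \<psi> (x, y, a)"
    unfolding prod.case S_def[symmetric] by (simp add: mult.commute mult.left_commute)
  then show "gate_sem X bx (Gate {} (Static 3 (ref_static z))) \<psi> (x, y, a) = ref_op X z \<psi> (x, y, a)"
    unfolding static_apply[OF a] sq m_def S_def ref_op_def prod.case .
qed

text \<open>\<open>\<phi>\<close> is the result of \<open>Check\<close> in qubit 0, so
  \<open>\<phi>\<close>, \<open>\<phi> + 2\<close> and \<open>\<phi> + 4\<close> are the coins 0, 1,
  2 with that result. The input a is a unit vector orthogonal to its target b, hence has product 1
  with the reflection vector a - b; subtracting a - b leaves b.\<close>

lemma split_action:
  assumes u: "u \<in> X" and v: "v \<in> X" and b: "b < 2 ^ 3" and \<phi>: "\<phi> < 2"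
  shows "mat_apply (X \<times> {..<2 ^ 3}) (split_static z s u) (\<lambda>(y, w). of_bool (w = \<phi>) * z y) (v, b)
    = (if b = \<phi> + 2 then complex_of_real (sqrt (1 - stay s \<phi>)) * z v
       else if b = \<phi> + 4 then complex_of_real (sqrt (stay s \<phi>)) * of_bool (v = u) else 0)"
proof -
  define r where "r = b mod 2"
  have r: "r < 2" by (simp add: r_def)
  let ?g = "\<lambda>(y, w). of_bool (w = \<phi>) * z y"
  let ?sum = "(\<Sum>j\<in>X \<times> {..<2 ^ 3}. if (case (v, b) of (y, b) \<Rightarrow> b mod 2) = (case j of (y, b) \<Rightarrow> b mod 2)
        then cnj (split_vec z s u j) * ?g j else 0)"
  have "?sum
      = (\<Sum>y\<in>X. \<Sum>w<2 ^ 3. if r = w mod 2 then cnj (split_vec z s u (y, w)) * (of_bool (w = \<phi>) * z y) else 0)"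
    unfolding sum.cartesian_product by (intro sum.cong) (auto simp: r_def)
  also have "\<dots> = (\<Sum>y\<in>X. of_bool (r = \<phi>) * (cnj (z y) * z y))"
  proof -
    have "r div 2 = 0" using r by simp
    then have "split_vec z s u (y, r) = z y" for y by (simp add: split_vec_def)
    moreover have "r + 2 \<noteq> \<phi>" "r + 4 \<noteq> \<phi>" "r + 6 \<noteq> \<phi>" using \<phi> by auto
    ultimately show ?thesis unfolding sum_by_parity[OF r] by (intro sum.cong) auto
  qed
  also have "\<dots> = of_bool (r = \<phi>)" by (simp add: sum_distrib_left[symmetric] z_norm)
  finally have inner: "?sum = of_bool (r = \<phi>)" .
  have "mat_apply (X \<times> {..<2 ^ 3}) (split_static z s u) ?g (v, b) = ?g (v, b) - split_vec z s u (v, b) * of_bool (r = \<phi>)"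
    unfolding split_static_def inner[symmetric]
    by (rule mat_apply_block_reflection) (use fin_X v b in simp_all)
  moreover have "stay s b = stay s r" by (simp add: stay_def r_def)
  moreover have "b = r \<or> b = r + 2 \<or> b = r + 4 \<or> b = r + 6"
    using b unfolding r_def by simp presburger
  moreover have "r div 2 = 0" "(r + 2) div 2 = 1" "(r + 4) div 2 = 2" "(r + 6) div 2 = 3" using r by auto
  ultimately show ?thesis
    using \<phi> r by (elim disjE) (auto simp: split_vec_def)
qed

lemma merge_action:
  assumes u: "u \<in> X" and v: "v \<in> X" and b: "b < 2 ^ 3" and \<phi>: "\<phi> < 2"
    and s: "0 \<le> s" "s \<le> 1" and d: "0 \<le> d u" and Pd: "P u u = d u" and P: "0 \<le> P u v"
  shows "mat_apply (X \<times> {..<2 ^ 3}) (merge_static s d u)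
      (\<lambda>(y, w). if w = \<phi> + 2 then complex_of_real (sqrt (1 - stay s \<phi>) * sqrt (P u y))
        else if w = \<phi> + 4 then complex_of_real (sqrt (stay s \<phi>)) * of_bool (y = u) else 0) (v, b)
    = of_bool (b = \<phi>) * complex_of_real (sqrt ((1 - stay s \<phi>) * P u v + stay s \<phi> * of_bool (v = u)))"
proof -
  define r where "r = b mod 2"
  have r: "r < 2" by (simp add: r_def)
  let ?g = "\<lambda>(y, w). if w = \<phi> + 2 then complex_of_real (sqrt (1 - stay s \<phi>) * sqrt (P u y))
        else if w = \<phi> + 4 then complex_of_real (sqrt (stay s \<phi>)) * of_bool (y = u) else 0"
  define \<nu> where "\<nu> = loop_amp s d u \<phi>"
  define A where "A = sqrt ((1 - stay s \<phi>) * P u v)"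
  define B where "B = sqrt (stay s \<phi>) * of_bool (v = u)"
  define R where "R = sqrt ((1 - stay s \<phi>) * P u v + stay s \<phi> * of_bool (v = u))"
  have gA: "complex_of_real (sqrt (1 - stay s \<phi>) * sqrt (P u v)) = complex_of_real A"
    by (simp add: A_def real_sqrt_mult)
  have gB: "complex_of_real (sqrt (stay s \<phi>)) * of_bool (v = u) = complex_of_real B"
    by (simp add: B_def)
  define m2 where "m2 = (if v = u \<and> \<nu> \<noteq> 0 then - (A / \<nu>) else -1)"
  define m4 where "m4 = (if v = u \<and> \<nu> \<noteq> 0 then - (B / \<nu>) else 0)"
  have mv: "merge_vec s d u (v, \<phi>) = 1" "merge_vec s d u (v, \<phi> + 2) = complex_of_real m2"
    "merge_vec s d u (v, \<phi> + 4) = complex_of_real m4" "merge_vec s d u (v, \<phi> + 6) = 0"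
    unfolding merge_vec_values[OF \<phi>] \<nu>_def[symmetric] m2_def m4_def A_def B_def using Pd by auto
  let ?sum = "(\<Sum>j\<in>X \<times> {..<2 ^ 3}. if (case (v, b) of (y, b) \<Rightarrow> (y, b mod 2)) = (case j of (y, b) \<Rightarrow> (y, b mod 2))
        then cnj (merge_vec s d u j) * ?g j else 0)"
  have "?sum
      = (\<Sum>j\<in>X \<times> {..<2 ^ 3}. if (v, r) = (case j of (y', b) \<Rightarrow> (y', b mod 2))
          then (case j of (y', b) \<Rightarrow> cnj (merge_vec s d u (y', b)) * ?g (y', b)) else 0)"
    by (intro sum.cong) (auto simp: r_def)
  also have "\<dots> = cnj (merge_vec s d u (v, r)) * ?g (v, r) + cnj (merge_vec s d u (v, r + 2)) * ?g (v, r + 2)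
      + cnj (merge_vec s d u (v, r + 4)) * ?g (v, r + 4) + cnj (merge_vec s d u (v, r + 6)) * ?g (v, r + 6)"
    by (rule sum_merge_block[OF v r])
  also have "\<dots> = of_bool (r = \<phi>) * complex_of_real (m2 * A + m4 * B)"
    using r \<phi> mv gA gB by auto
  finally have inner: "?sum = of_bool (r = \<phi>) * complex_of_real (m2 * A + m4 * B)" .
  have act: "mat_apply (X \<times> {..<2 ^ 3}) (merge_static s d u) ?g (v, b)
      = ?g (v, b) - merge_vec s d u (v, b) * (of_bool (r = \<phi>) * complex_of_real (m2 * A + m4 * B))"
    unfolding merge_static_def inner[symmetric]
    by (rule mat_apply_block_reflection) (use fin_X v b in simp_all)
  have st: "0 \<le> 1 - stay s \<phi>" "0 \<le> stay s \<phi>" using s by (auto simp: stay_def)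
  \<comment> \<open>The product of the input with the reflection vector is \<open>- R\<close>. The
    reflection therefore puts \<open>R\<close> at coin 0, and the other two equations say that it
    cancels what was at coins 1 and 2. At the loop \<open>R\<close> is nu, by A^2 + B^2 = nu^2;
    elsewhere B = 0 and R = A.\<close>
  have R: "m2 * A + m4 * B = - R \<and> A + m2 * R = 0 \<and> B + m4 * R = 0"
  proof (cases "v = u")
    case True
    then have "R = \<nu>" using Pd by (simp add: R_def \<nu>_def loop_amp_def)
    have AB: "A * A + B * B = \<nu> * \<nu>"
      using True st d Pd loop_amp_sq[where s = s and d = d and x = u and r = \<phi>] s by (simp add: A_def B_def \<nu>_def)
    show ?thesis
    proof (cases "\<nu> = 0")
      case True
      then have "A = 0" "B = 0" using AB by (auto simp: sum_squares_eq_zero_iff)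
      then show ?thesis using True \<open>R = \<nu>\<close> by simp
    next
      case False
      have "m2 * A + m4 * B = - ((A * A + B * B) / \<nu>)"
        using \<open>v = u\<close> False by (simp add: m2_def m4_def add_divide_distrib)
      then show ?thesis using \<open>v = u\<close> False \<open>R = \<nu>\<close> by (simp add: AB m2_def m4_def)
    qed
  next
    case False
    then show ?thesis by (simp add: m2_def m4_def B_def R_def A_def)
  qed
  then have R': "complex_of_real (m2 * A + m4 * B) = - complex_of_real R"
    "complex_of_real A + complex_of_real m2 * complex_of_real R = 0"
    "complex_of_real B + complex_of_real m4 * complex_of_real R = 0"
    by (auto simp flip: of_real_mult of_real_add)
  have "b = r \<or> b = r + 2 \<or> b = r + 4 \<or> b = r + 6"
    using b unfolding r_def by simp presburger
  then show ?thesis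
    unfolding act R_def[symmetric]
    using r \<phi> mv gA gB R' by (cases "r = \<phi>"; elim disjE) auto
qed

end

text \<open>The function \<open>d\<close> is separate from \<open>P\<close> because the circuit may
  be built from the loop probabilities, while all else about the chain reaches it through the
  boxes.\<close>

locale walk_implementation = reference_vector X z
  for X :: "'v set" and z :: "'v \<Rightarrow> complex" +
  fixes E :: "('v \<times> 'v) set" and P :: "'v \<Rightarrow> 'v \<Rightarrow> real" and \<pi> :: "'v \<Rightarrow> real" and M :: "'v set"
    and bx :: "'v boxes" and d :: "'v \<Rightarrow> real" and s :: real
  assumes graph: "undirected_graph X E" and bx: "boxes_for X E P \<pi> M z bx"
    and P_nonneg: "\<And>x y. x \<in> X \<Longrightarrow> y \<in> X \<Longrightarrow> 0 \<le> P x y"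
    and P_diag: "\<And>x. x \<in> X \<Longrightarrow> P x x = d x" and s01: "0 \<le> s" "s \<le> 1"
begin

abbreviation "B3 \<equiv> basis X 3"

lemma d_nonneg: "x \<in> X \<Longrightarrow> 0 \<le> d x"
  using P_nonneg P_diag by metis

lemma boxes: "marked bx = M" "edges bx = E" "unitary_on (X \<times> X) (update_mat bx)"
  using bx by (auto simp: boxes_for_def)

lemma pair_split: "unitary_pair B3 (gate_sem X bx (Gate {} (Static 3 (split_static z s))))
    (gate_sem X bx (Gate {} (Static 3 (split_static z s))))"
proof -
  have "(\<lambda>x. adjoint_mat (split_static z s x)) = split_static z s"
    by (simp add: split_static_def fun_eq_iff)
  then show ?thesis
    using unitary_pair_Static[OF fin_X, where U = "split_static z s" and bx = bx and k = 3]
      unitary_split_static[OF _ s01] by (simp del: gate_sem.simps)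
qed

lemma pair_merge: "unitary_pair B3 (gate_sem X bx (Gate {} (Static 3 (merge_static s d))))
    (gate_sem X bx (Gate {} (Static 3 (merge_static s d))))"
proof -
  have "(\<lambda>x. adjoint_mat (merge_static s d x)) = merge_static s d"
    by (simp add: merge_static_def fun_eq_iff)
  then show ?thesis
    using unitary_pair_Static[OF fin_X, where U = "merge_static s d" and bx = bx and k = 3]
      unitary_merge_static[OF _ s01 d_nonneg] by (simp del: gate_sem.simps)
qed

lemma pair_check: "unitary_pair B3 (gate_sem X bx (Gate {} (Check 0))) (gate_sem X bx (Gate {} (Check 0)))"
  by (rule unitary_pair_Check) simp

lemma pair_update: "unitary_pair B3 (run X bx (update_circuit z d s)) (run X bx (update_circuit_adj z d s))"
  using unitary_pair_run_Cons[OF pair_check unitary_pair_run_Cons[OF pair_split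
      unitary_pair_run_Cons[OF unitary_pair_Update[OF fin_X boxes(3)]
      unitary_pair_run_Cons[OF pair_merge unitary_pair_run_Cons[OF pair_check unitary_pair_run_Nil]]]]]
  by (simp add: update_circuit_def update_circuit_adj_def del: run_Cons)

text \<open>The first \<open>Check\<close> writes \<open>\<phi>\<close>, which selects the weight
  \<open>\<sigma>\<close> of staying; the walk is split into staying and moving, V(P) acts on the
  moving part, and merging restores coin 0 with the amplitudes of P(s). The last
  \<open>Check\<close> erases \<open>\<phi>\<close>, which is possible because the vertex register
  is still x.\<close>

lemma update_circuit_action:
  assumes x: "x \<in> X" and uvb: "u \<in> X" "v \<in> X" "b < 2 ^ 3"
  shows "run X bx (update_circuit z d s) (\<lambda>(u, v, b). of_bool (u = x \<and> b = 0) * z v) (u, v, b)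
    = of_bool (u = x \<and> b = 0) * complex_of_real (sqrt (interpolated P M s x v))"
proof -
  define \<phi> :: nat where "\<phi> = of_bool (x \<in> M)"
  have \<phi>: "\<phi> < 2" by (simp add: \<phi>_def)
  define \<sigma> where "\<sigma> = stay s \<phi>"
  have \<sigma>: "\<sigma> = (if x \<in> M then s else 0)" by (simp add: \<sigma>_def \<phi>_def stay_def)
  define st0 :: "'v state" where "st0 = (\<lambda>(u, v, b). of_bool (u = x \<and> b = 0) * z v)"
  define st1 where "st1 = gate_sem X bx (Gate {} (Check 0)) st0"
  define st2 where "st2 = gate_sem X bx (Gate {} (Static 3 (split_static z s))) st1"
  define st3 where "st3 = gate_sem X bx (Gate {1} UpdateV) st2"
  define st4 where "st4 = gate_sem X bx (Gate {} (Static 3 (merge_static s d))) st3"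
  define st5 where "st5 = gate_sem X bx (Gate {} (Check 0)) st4"
  have run: "run X bx (update_circuit z d s) st0 = st5"
    by (simp add: update_circuit_def st1_def st2_def st3_def st4_def st5_def del: gate_sem.simps)
  have st1: "st1 (u, v, b) = of_bool (u = x) * (of_bool (b = \<phi>) * z v)" for u v b
    by (simp add: st1_def st0_def boxes \<phi>_def flip_bit_eq_0_iff)
  have st2: "st2 (u, v, b) = of_bool (u = x) * (if b = \<phi> + 2 then complex_of_real (sqrt (1 - \<sigma>)) * z v
       else if b = \<phi> + 4 then complex_of_real (sqrt \<sigma>) * of_bool (v = x) else 0)"
    if "u \<in> X" "v \<in> X" "b < 2 ^ 3" for u v b
  proof -
    have "st2 (u, v, b) = mat_apply (X \<times> {..<2 ^ 3}) (split_static z s u)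
        (\<lambda>i. of_bool (u = x) * (case i of (y, w) \<Rightarrow> of_bool (w = \<phi>) * z y)) (v, b)"
      unfolding st2_def static_apply[OF that(3)] st1 by (simp add: case_prod_unfold)
    also have "\<dots> = of_bool (u = x) * mat_apply (X \<times> {..<2 ^ 3}) (split_static z s u)
        (\<lambda>(y, w). of_bool (w = \<phi>) * z y) (v, b)"
      by (simp only: linear_op_scale[OF mat_apply_linear])
    finally show ?thesis
      unfolding split_action[OF that \<phi>] \<sigma>_def by auto
  qed
  have st3: "st3 (u, v, b) = of_bool (u = x) * (if b = \<phi> + 2 then complex_of_real (sqrt (1 - \<sigma>) * sqrt (P x v))
       else if b = \<phi> + 4 then complex_of_real (sqrt \<sigma>) * of_bool (v = x) else 0)"
    if "u \<in> X" "v \<in> X" "b < 2 ^ 3" for u v b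
  proof -
    \<comment> \<open>Qubit 1 is the low bit of the coin: the update acts on coin 1, spares coin 2,
      and meets coin 3 with amplitude 0.\<close>
    have b1: "bit b 1 \<longleftrightarrow> odd (b div 2)" by (simp add: bit_iff_odd)
    show ?thesis
    proof (cases "b = \<phi> + 2")
      case True
      have "bit b 1" unfolding b1 using True \<phi> by simp
      then have "st3 (u, v, b) = mat_apply (X \<times> X) (update_mat bx) (\<lambda>(u, v). st2 (u, v, b)) (u, v)"
        by (simp add: st3_def)
      also have "\<dots> = mat_apply (X \<times> X) (update_mat bx)
          (\<lambda>i. complex_of_real (sqrt (1 - \<sigma>)) * (case i of (u, v) \<Rightarrow> of_bool (u = x) * z v)) (u, v)"
        unfolding mat_apply_def using that(3) True
        by (intro if_cong refl sum.cong arg_cong2[where f = "(*)"]) (auto simp: st2)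
      also have "\<dots> = complex_of_real (sqrt (1 - \<sigma>)) *
          mat_apply (X \<times> X) (update_mat bx) (\<lambda>(u, v). of_bool (u = x) * z v) (u, v)"
        by (simp only: linear_op_scale[OF mat_apply_linear])
      also have "mat_apply (X \<times> X) (update_mat bx) (\<lambda>(u, v). of_bool (u = x) * z v) (u, v)
          = of_bool (u = x) * complex_of_real (sqrt (P x v))"
        using bx x that unfolding boxes_for_def by blast
      finally show ?thesis using True by (simp add: mult.left_commute)
    next
      case False
      show ?thesis
      proof (cases "bit b 1")
        case True
        moreover have "(\<phi> + 4) div 2 = 2" using \<phi> by auto
        ultimately have "b \<noteq> \<phi> + 4" unfolding b1 by auto
        have "st3 (u, v, b) = mat_apply (X \<times> X) (update_mat bx) (\<lambda>(u, v). st2 (u, v, b)) (u, v)"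
          using True by (simp add: st3_def)
        also have "\<dots> = 0"
          using that(3) False \<open>b \<noteq> \<phi> + 4\<close> unfolding mat_apply_def by (auto simp: st2 intro!: sum.neutral)
        finally show ?thesis using False \<open>b \<noteq> \<phi> + 4\<close> by simp
      next
        case b: False
        then have "st3 (u, v, b) = st2 (u, v, b)" by (simp add: st3_def)
        then show ?thesis using False by (simp only: st2[OF that]) simp
      qed
    qed
  qed
  have st4: "st4 (u, v, b) = of_bool (u = x \<and> b = \<phi>) * complex_of_real (sqrt (interpolated P M s x v))"
    if "u \<in> X" "v \<in> X" "b < 2 ^ 3" for u v b
  proof -
    let ?g = "\<lambda>(y, w). if w = \<phi> + 2 then complex_of_real (sqrt (1 - stay s \<phi>) * sqrt (P x y))
        else if w = \<phi> + 4 then complex_of_real (sqrt (stay s \<phi>)) * of_bool (y = x) else 0"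
    have "st4 (u, v, b) = mat_apply (X \<times> {..<2 ^ 3}) (merge_static s d u) (\<lambda>(y, w). st3 (u, y, w)) (v, b)"
      unfolding st4_def by (rule static_apply[OF that(3)])
    also have "\<dots> = mat_apply (X \<times> {..<2 ^ 3}) (merge_static s d u) (\<lambda>i. of_bool (u = x) * ?g i) (v, b)"
      unfolding mat_apply_def
      by (intro if_cong refl sum.cong arg_cong2[where f = "(*)"]) (use that(1) in \<open>auto simp: st3 \<sigma>_def\<close>)
    also have "\<dots> = of_bool (u = x) * mat_apply (X \<times> {..<2 ^ 3}) (merge_static s d u) ?g (v, b)"
      by (simp only: linear_op_scale[OF mat_apply_linear])
    also have "\<dots> = of_bool (u = x) * (of_bool (b = \<phi>) *
        complex_of_real (sqrt ((1 - stay s \<phi>) * P x v + stay s \<phi> * of_bool (v = x))))"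
    proof (cases "u = x")
      case True
      then show ?thesis
        using merge_action[where s = s and d = d and P = P and \<phi> = \<phi>, OF x that(2,3) \<phi> s01
            d_nonneg[OF x] P_diag[OF x] P_nonneg[OF x that(2)]] by simp
    qed simp
    also have "(1 - stay s \<phi>) * P x v + stay s \<phi> * of_bool (v = x) = interpolated P M s x v"
      unfolding \<sigma>_def[symmetric] \<sigma> by (auto simp: interpolated_def absorbing_def algebra_simps)
    finally show ?thesis by auto
  qed
  have "st5 (u, v, b) = st4 (u, v, if u \<in> M then flip_bit 0 b else b)"
    by (simp add: st5_def boxes)
  also have "\<dots> = of_bool (u = x \<and> (if u \<in> M then flip_bit 0 b else b) = \<phi>) * complex_of_real (sqrt (interpolated P M s x v))"
    using flip_bit_less[OF uvb(3)] uvb(3) by (intro st4[OF uvb(1,2)]) simp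
  also have "(u = x \<and> (if u \<in> M then flip_bit 0 b else b) = \<phi>) \<longleftrightarrow> (u = x \<and> b = 0)"
  proof -
    have "flip_bit 0 b = 1 \<longleftrightarrow> b = 0"
      by (metis flip_bit_involution flip_bit_of_0 power_0)
    then show ?thesis by (auto simp: \<phi>_def)
  qed
  finally show ?thesis using run by (simp add: st0_def)
qed

lemma walk_circuit_implements:
  obtains V where "interpolated_update X P M s z 3 V"
    "implements X bx 3 (walk_circuit z d s) (walk_op X (edges bx) z 3 V)"
proof -
  have fB: "finite B3" by (simp add: finite_basis fin_X)
  obtain V where V: "unitary_on B3 V"
    "\<And>f. supported_on B3 f \<Longrightarrow> mat_apply B3 V f = run X bx (update_circuit z d s) f"
    "\<And>f. supported_on B3 f \<Longrightarrow> mat_apply B3 (adjoint_mat V) f = run X bx (update_circuit_adj z d s) f"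
    using unitary_pair_matrix[OF fB pair_update] by blast
  have "interpolated_update X P M s z 3 V"
    unfolding interpolated_update_def
  proof (intro conjI ballI)
    show "unitary_on B3 V" by (rule V(1))
    fix x i assume x: "x \<in> X" and i: "i \<in> B3"
    obtain u v b where uvb: "i = (u, v, b)" by (rule prod_cases3)
    have s: "supported_on B3 (\<lambda>(u, v, b). of_bool (u = x \<and> b = 0) * z v)"
      using x z_outside by (auto simp: supported_on_def basis_def)
    have "u \<in> X" "v \<in> X" "b < 2 ^ 3" using i uvb by (auto simp: basis_def)
    then show "case i of (x', y, w) \<Rightarrow> mat_apply B3 V (\<lambda>(u, v, b). of_bool (u = x \<and> b = 0) * z v) (x', y, w) =
        of_bool (x' = x \<and> w = 0) * complex_of_real (sqrt (interpolated P M s x y))"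
      unfolding uvb prod.case V(2)[OF s] by (rule update_circuit_action[OF x])
  qed
  moreover have "implements X bx 3 (walk_circuit z d s) (walk_op X (edges bx) z 3 V)"
    unfolding implements_def
  proof (intro conjI allI impI)
    show "wf_circuit X 3 (walk_circuit z d s)"
      using unitary_ref_static unitary_split_static[OF _ s01] unitary_merge_static[OF _ s01 d_nonneg]
      by (auto simp: wf_circuit_def walk_circuit_def update_circuit_def update_circuit_adj_def)
    fix \<psi> assume \<psi>: "supported_on B3 \<psi>"
    have 1: "supported_on B3 (ref_op X z \<psi>)" by (rule ref_op_supported[OF \<psi>])
    have 2: "supported_on B3 (shift_op E (mat_apply B3 V (ref_op X z \<psi>)))"
      by (rule shift_op_supported[OF graph mat_apply_supported])
    have shift: "gate_sem X bx (Gate {} Shift) f = shift_op E f" for f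
      by (auto simp: boxes)
    have "run X bx (walk_circuit z d s) \<psi>
        = run X bx (update_circuit_adj z d s) (shift_op E (run X bx (update_circuit z d s) (ref_op X z \<psi>)))"
      by (simp add: walk_circuit_def run_append run_ref_static[OF \<psi>] shift del: gate_sem.simps)
    then show "run X bx (walk_circuit z d s) \<psi> = walk_op X (edges bx) z 3 V \<psi>"
      by (simp add: walk_op_def boxes V(2)[OF 1] V(3)[OF 2[unfolded V(2)[OF 1]]])
  qed
  ultimately show thesis by (rule that)
qed

end

section \<open>The search algorithm\<close>

text \<open>For this s, sin^2 : cos^2 = pM (1 - p) : p (1 - pM), so an exact p would give sin^2 =
  1/2. The relative error 1/3 together with \<open>p \<le> 1 / 2\<close> confines it to the stated
  interval.\<close>

lemma (in marked_chain) sin2_bounds: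
  assumes p: "p \<le> 1 / 2" "\<bar>p - pM\<bar> \<le> pM / 3"
  defines "s \<equiv> 1 - p / (1 - p)"
  shows "0 \<le> s" "s < 1" "3 / 8 \<le> sin2 s" "sin2 s \<le> 3 / 4"
proof -
  have lo: "2 / 3 * pM \<le> p" and hi: "p \<le> 4 / 3 * pM" using p(2) by linarith+
  have p0: "0 < p" using lo pM_pos by simp
  show "0 \<le> s" "s < 1" using p(1) p0 by (simp_all add: s_def field_simps)
  have "qs s = (pM * (1 - p) + p * (1 - pM)) / (1 - p)"
    unfolding qs_eq s_def using p(1) by (simp add: field_simps)
  then have sin2: "sin2 s = pM * (1 - p) / (pM * (1 - p) + p * (1 - pM))"
    by (simp add: sin2_def)
  have den: "0 < pM * (1 - p) + p * (1 - pM)"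
    using p(1) p0 pM_pos pM_less_1 by (intro add_pos_pos mult_pos_pos) auto
  have pp: "p * pM \<le> 1 / 2 * pM" using p(1) pM_pos by (intro mult_right_mono) auto
  \<comment> \<open>This is \<open>sin2 s \<le> 3 / 4\<close> with the denominators cleared.\<close>
  have "pM * (1 + 2 * p) \<le> 3 * p"
  proof -
    have "pM * (1 + 2 * p) \<le> 3 / 2 * p * (1 + 2 * p)" using lo p0 by (intro mult_right_mono) auto
    also have "\<dots> \<le> 3 / 2 * p * 2" using p(1) p0 by (intro mult_left_mono) auto
    finally show ?thesis by simp
  qed
  then show "sin2 s \<le> 3 / 4" unfolding sin2 using den by (simp add: field_simps)
  show "3 / 8 \<le> sin2 s" unfolding sin2 using den pp hi by (simp add: field_simps)
qed

text \<open>On the given interval (1 - x) x is at least 3/16, its value at 3/4, and x^2 is at most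
  1, so the second stage succeeds with probability at least 3/32 - 1/98 >= 1/36. The total is
  bounded below by a mixture of this and the certain success of the first stage, with weights 1 - pM
  and pM.\<close>

lemma (in search_walk) success_prob_ge:
  assumes bx: "boxes_for X E P \<pi> M z bx" and ee: "eigenvalue_estimation X bx k w W t ee"
    and x: "3 / 8 \<le> sin2 s" "sin2 s \<le> 3 / 4" and t: "196 * extended_HT X P \<pi> M \<le> 4 ^ t"
  shows "1 / 36 \<le> success_prob X bx z (k + t + 2, search_algorithm k t ee)"
proof -
  let ?x = "sin2 s" and ?H = "extended_HT X P \<pi> M"
  define q where "q = (1 - ?x) * ?x / 2 - 2 * (?x\<^sup>2 * ?H) / 4 ^ t"
  have "2 * (?x\<^sup>2 * ?H) / 4 ^ t = 2 * ?x\<^sup>2 * (?H / 4 ^ t)" by simp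
  also have "\<dots> \<le> 2 * ?x\<^sup>2 * (1 / 196)"
    using t by (intro mult_left_mono) (auto simp: field_simps)
  also have "\<dots> \<le> 1 / 98 * 1"
    using x by (simp add: power_le_one)
  finally have "2 * (?x\<^sup>2 * ?H) / 4 ^ t \<le> 1 / 98" by simp
  moreover have "3 / 16 \<le> (1 - ?x) * ?x"
  proof -
    have "0 \<le> (?x - 3 / 8) * (3 / 4 - ?x)" using x by simp
    then have "?x * ?x \<le> 9 / 8 * ?x - 9 / 32" by (simp add: algebra_simps)
    then show ?thesis using x by (simp add: algebra_simps)
  qed
  ultimately have q: "1 / 36 \<le> q" unfolding q_def by linarith
  have "1 / 36 = (pM + (1 - pM)) * (1 / 36 :: real)" by simp
  also have "\<dots> = pM * (1 / 36) + (1 - pM) * (1 / 36)" by (rule distrib_right)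
  also have "\<dots> \<le> pM * 1 + (1 - pM) * q"
    using q pM_pos pM_less_1 by (intro add_mono mult_left_mono) auto
  also have "\<dots> \<le> success_prob X bx z (k + t + 2, search_algorithm k t ee)"
    using success_prob_lower_bound[OF bx ee] by (simp add: q_def)
  finally show ?thesis .
qed

lemma wf_circuit_mono:
  assumes "wf_circuit X N gs" "N \<le> N'"
  shows "wf_circuit X N' gs"
proof -
  have "wf_gate X N' g" if "wf_gate X N g" for g
    using that assms(2) by (cases g) auto
  then show ?thesis using assms(1) by (auto simp: wf_circuit_def)
qed

lemma search_algorithm_cost:
  assumes "0 \<le> S" "0 \<le> U" "0 \<le> C"
  shows "total_cost S U C (3 + t + 2, search_algorithm 3 t (estimation_circuit 3 t (walk_circuit z d s)))
    \<le> S + 2 * C + 2 ^ t * (3 * U + 4 * C)"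
proof -
  have ee: "(\<Sum>g\<leftarrow>estimation_circuit 3 t (walk_circuit z d s). gate_cost S U C g) = (2 ^ t - 1) * (3 * U + 4 * C)"
    by (simp add: estimation_circuit_cost walk_circuit_cost)
  have "(2 ^ t - 1) * (3 * U + 4 * C) \<le> 2 ^ t * (3 * U + 4 * C)"
    using assms by (intro mult_right_mono) auto
  moreover have "0 \<le> 2 ^ t * (3 * U + 4 * C)" using assms by simp
  ultimately show ?thesis
    using assms by (simp add: total_cost_def search_algorithm_def ee)
qed

text \<open>For \<open>1 \<le> T\<close> the ceiling is nonnegative, so \<open>nat\<close> does not
  truncate; rounding up the logarithm costs at most a factor 2.\<close>

lemma two_powr_ceiling_log:
  fixes T :: real
  assumes "1 \<le> T"
  defines "t \<equiv> nat \<lceil>log 2 T\<rceil>"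
  shows "T \<le> 2 ^ t" "2 ^ t \<le> 2 * T"
proof -
  have "0 \<le> log 2 T" using assms(1) by simp
  then have t: "real t = real_of_int \<lceil>log 2 T\<rceil>" unfolding t_def by simp
  have T: "T = 2 powr log 2 T" using assms(1) by simp
  have pow: "(2::real) ^ t = 2 powr real t" by (simp add: powr_realpow)
  have "log 2 T \<le> real t" unfolding t by (rule le_of_int_ceiling)
  then have "2 powr log 2 T \<le> 2 powr real t" by simp
  then show "T \<le> 2 ^ t" using T pow by simp
  have "real t \<le> log 2 T + 1" unfolding t by linarith
  then have "2 powr real t \<le> 2 powr (log 2 T + 1)" by simp
  also have "\<dots> = 2 * T" using T by (simp add: powr_add)
  finally show "2 ^ t \<le> 2 * T" using pow by simp
qed

text \<open>The three work qubits are those of \<open>update_circuit\<close>: the result of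
  \<open>Check\<close> and the two coin qubits. The arguments are exactly the data on which the
  choice of the algorithm may depend.\<close>

definition search_instance ::
  "('v \<Rightarrow> complex) \<Rightarrow> ('v \<Rightarrow> real) \<Rightarrow> real \<Rightarrow> real \<Rightarrow> nat \<times> 'v algorithm" where
  "search_instance z d p T = (let s = 1 - p / (1 - p); t = nat \<lceil>log 2 T\<rceil> in
     (3 + t + 2, search_algorithm 3 t (estimation_circuit 3 t (walk_circuit z d s))))"

lemma search_instance_correct:
  fixes X :: "'v set" and p T :: real
  assumes graph: "undirected_graph X E" and rev: "reversible_chain X P \<pi>" and on_graph: "chain_on_graph X E P"
    and M: "M \<subset> X" "M \<noteq> {}" and unit: "unit_vector X z" and bx: "boxes_for X E P \<pi> M z bx"
    and d: "\<forall>x\<in>X. P x x = d x"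
    and p: "p \<le> 1 / 2" "\<bar>p - marked_mass \<pi> M\<bar> \<le> marked_mass \<pi> M / 3"
    and T: "14 * sqrt (extended_HT X P \<pi> M) \<le> T"
  shows "let s = 1 - p / (1 - p); t = nat \<lceil>log 2 T\<rceil> in
    search_instance z d p T \<in> Search X z bx P M s t \<and>
    (\<forall>A\<in>Search X z bx P M s t. 1 / 36 \<le> success_prob X bx z A) \<and>
    (\<forall>S U C. 0 \<le> S \<and> 0 \<le> U \<and> 0 \<le> C \<longrightarrow> total_cost S U C (search_instance z d p T) \<le> 10 * (S + T * (U + C)))"
proof -
  define s where "s = 1 - p / (1 - p)"
  define t where "t = nat \<lceil>log 2 T\<rceil>"
  define ee where "ee = estimation_circuit 3 t (walk_circuit z d s)"
  define Q where "Q = search_instance z d p T"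
  have Q: "Q = (3 + t + 2, search_algorithm 3 t ee)"
    by (simp add: Q_def search_instance_def ee_def t_def s_def Let_def)
  interpret mc: marked_chain X P \<pi> M by standard (fact rev M)+
  interpret rv: reference_vector X z by standard (fact mc.fin unit)+
  have s: "0 \<le> s" "s < 1" and x: "3 / 8 \<le> mc.sin2 s" "mc.sin2 s \<le> 3 / 4"
    unfolding s_def using mc.sin2_bounds[OF p] by auto
  have edges: "edges bx = E" using bx by (simp add: boxes_for_def)
  let ?H = "extended_HT X P \<pi> M"
  have H: "1 / 2 \<le> ?H" by (rule mc.extended_HT_ge)
  have "(14 * sqrt ?H)\<^sup>2 \<le> T\<^sup>2" using T H by (intro power_mono) auto
  then have T2: "196 * ?H \<le> T\<^sup>2" using H by (simp add: power_mult_distrib)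
  then have "1\<^sup>2 \<le> T\<^sup>2" using H by simp
  moreover have T0: "0 \<le> T" using T H by (meson le_less_trans less_imp_le mult_nonneg_nonneg order_trans real_sqrt_ge_zero zero_le_numeral zero_le_divide_1_iff)
  ultimately have T1: "1 \<le> T" by (rule power2_le_imp_le)
  have Tt: "T \<le> 2 ^ t" "2 ^ t \<le> 2 * T" unfolding t_def using two_powr_ceiling_log[OF T1] by auto
  have "T\<^sup>2 \<le> (2 ^ t)\<^sup>2" using Tt(1) T0 by (rule power_mono)
  also have "(2 ^ t)\<^sup>2 = (4::real) ^ t" by (simp add: power2_eq_square flip: power_mult_distrib)
  finally have Ht: "196 * ?H \<le> 4 ^ t" using T2 by simp
  interpret wi: walk_implementation X z E P \<pi> M bx d s
    by standard (use graph bx mc.P_nonneg d s in auto)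
  obtain V where V: "interpolated_update X P M s z 3 V"
    "implements X bx 3 (walk_circuit z d s) (walk_op X (edges bx) z 3 V)"
    by (rule wi.walk_circuit_implements)
  have est: "eigenvalue_estimation X bx 3 (walk_circuit z d s) (walk_op X (edges bx) z 3 V) t ee"
    unfolding ee_def by (rule eigenvalue_estimation_exists[OF mc.fin V(2)])
  then have "wf_circuit X (3 + t + 2) ee"
    unfolding eigenvalue_estimation_def by (elim conjE) (rule wf_circuit_mono, auto)
  then have wf: "wf_algorithm X (3 + t + 2) (search_algorithm 3 t ee)"
    by (simp add: search_algorithm_def wf_circuit_def)
  have "Q \<in> Search X z bx P M s t"
    unfolding Search_def Q using wf V est by blast
  moreover have "1 / 36 \<le> success_prob X bx z A" if A_in: "A \<in> Search X z bx P M s t" for A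
  proof -
    obtain k ee V w where A: "A = (k + t + 2, search_algorithm k t ee)"
      and V: "interpolated_update X P M s z k V"
      and est: "eigenvalue_estimation X bx k w (walk_op X (edges bx) z k V) t ee"
      using A_in unfolding Search_def by blast
    interpret search_walk X z E P M s k V \<pi>
      by standard (use graph on_graph V s in auto)
    show ?thesis unfolding A by (rule success_prob_ge[OF bx est[unfolded edges] x Ht])
  qed
  moreover have "total_cost S U C Q \<le> 10 * (S + T * (U + C))" if SUC: "0 \<le> S" "0 \<le> U" "0 \<le> C" for S U C
  proof -
    have "total_cost S U C Q \<le> S + 2 * C + 2 ^ t * (3 * U + 4 * C)"
      unfolding Q ee_def by (rule search_algorithm_cost[OF SUC])
    \<comment> \<open>As \<open>1 \<le> T\<close>, the two calls of \<open>Check\<close> outside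
      eigenvalue estimation cost at most 2 T C. With \<open>2 ^ t \<le> 2 * T\<close>, the
      coefficient of T C becomes 2 + 2 * 4 = 10, the constant of the cost bound.\<close>
    also have "\<dots> \<le> S + 2 * (T * C) + 2 * T * (3 * U + 4 * C)"
      using SUC T1 Tt(2) mult_right_mono[OF T1 SUC(3)] by (intro add_mono mult_right_mono) auto
    also have "\<dots> = S + 6 * (T * U) + 10 * (T * C)"
      by (simp add: algebra_simps)
    also have "\<dots> \<le> 10 * S + 10 * (T * U) + 10 * (T * C)"
      using SUC T0 by (intro add_mono) auto
    finally show ?thesis by (simp add: algebra_simps)
  qed
  ultimately show ?thesis
    unfolding Q_def s_def t_def Let_def by blast
qed

theorem theorem23:
  shows "\<exists>c::real. 0 < c \<and>
    (\<forall>(X :: 'v set) (z :: 'v \<Rightarrow> complex) (d :: 'v \<Rightarrow> real) (p :: real) (T :: real).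
     \<exists>Q :: nat \<times> 'v algorithm.
     \<forall>(E :: ('v \<times> 'v) set) (P :: 'v \<Rightarrow> 'v \<Rightarrow> real) (\<pi> :: 'v \<Rightarrow> real) (M :: 'v set) (bx :: 'v boxes).
       undirected_graph X E \<and>
       reversible_chain X P \<pi> \<and>
       chain_on_graph X E P \<and>
       (\<forall>\<mu>. chain_eigenvalue X P \<mu> \<longrightarrow> \<mu> \<in> complex_of_real ` {0..1}) \<and>
       M \<subset> X \<and> M \<noteq> {} \<and>
       unit_vector X z \<and>
       boxes_for X E P \<pi> M z bx \<and>
       (\<forall>x\<in>X. P x x = d x) \<and>
       p \<le> 1 / 2 \<and> \<bar>p - marked_mass \<pi> M\<bar> \<le> marked_mass \<pi> M / 3 \<and>
       T \<ge> 14 * sqrt (extended_HT X P \<pi> M)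
       \<longrightarrow>
       (let s = 1 - p / (1 - p); t = nat \<lceil>log 2 T\<rceil> in
          Q \<in> Search X z bx P M s t \<and>
          (\<forall>A \<in> Search X z bx P M s t. success_prob X bx z A \<ge> 1 / 36) \<and>
          (\<forall>S U C. 0 \<le> S \<and> 0 \<le> U \<and> 0 \<le> C \<longrightarrow> total_cost S U C Q \<le> c * (S + T * (U + C)))))"
  by (rule exI[of _ 10], intro conjI allI exI impI)
    (simp, elim conjE, (rule search_instance_correct; assumption))

end
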